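(* Let $r,\nu\in\{1,-1\}$, let $a,b$ be indeterminates, and put $\delta=b^2-a^2$. For every oriented welded link diagram $L$, let $[L]$ be the rational function of $a,b$ (depending also on $r,\nu$) determined by the skein relations $$[L_+]=a\,[L_v]+b\,[L_o]+\nu b\,[L_u],\qquad [L_-]=-\frac{a}{\delta}\,[L_v]+\frac{b}{\delta}\,[L_o]+\frac{\nu b}{\delta}\,[L_u],$$ $$[L\cup\bigcirc]=-2\nu\,[L],\qquad [L_{\mathrm{vk}}]=r\,[L_{\mathrm{arc}}].$$ Let $w(L)$ be the writhe of $L$ and $v(L)$ the number of virtual (welded) crossings of $L$. Then the quantity $$Y(L)=r^{v(L)}\,(ar-\nu b)^{-w(L)}\,[L]$$ is an invariant of welded links; that is, $Y(L)=Y(L')$ whenever $L$ and $L'$ are diagrams of the same oriented welded link.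
   Context: **Diagrams.** An oriented welded link diagram is a generic immersion of finitely many oriented circles in the plane whose only singularities are transverse double points. Each double point is either a classical crossing (with over/under information) or a virtual crossing, also called a welded crossing (a plain intersection with no over/under information). A classical crossing is positive if the (over-strand direction, under-strand direction) pair is a positively oriented basis of the plane, and negative otherwise. The writhe is $w(L)=\#\{\text{positive classical crossings}\}-\#\{\text{negative classical crossings}\}$. The number $v(L)$ (the virtual writhe) is the number of virtual crossings of $L$. **Moves.** Two diagrams represent the same oriented welded link if they are related by planar isotopy and finitely many of the following local moves and their inverses (with all orientations of the strands allowed). - R1, R2, R3: the classical Reidemeister moves. R1 adds or removes a kink with one classical crossing of either sign (R1a: positive, R1b: negative). R2 adds or removes two classical crossings between two strands, the same strand being over at both. R3 is the usual triangle move with three classical crossings. - V1, V2, V3: the same three moves with every crossing virtual. - M: a strand meeting two other strands in virtual crossings is moved across the classical crossing of those two strands. - F1: a strand passing over two other strands (at two classical crossings) is moved across the virtual crossing of those two strands, remaining over both; that is, a virtual crossing may pass under another strand. **Skein notation.** - $L_+$, $L_-$, $L_v$, $L_o$, $L_u$ denote diagrams that are identical outside a small disk. Inside the disk, $L_+$ has a positive classical crossing and $L_-$ a negative classical crossing. $L_v$ has a virtual crossing of the same two strands. $L_o$ has the oriented smoothing, joining each incoming end to the outgoing end on the same side (drawn as $)($ when both strands point downward). $L_u$ has the other planar smoothing, joining the two incoming ends to each other and the two outgoing ends to each other. The bracket is extended to unoriented diagrams with only virtual crossings, which is what one obtains after all classical crossings have been expanded. - $L\cup\bigcirc$ is $L$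 together with a disjoint embedded circle that meets nothing. - $L_{\mathrm{vk}}$ has a kink with a single virtual crossing (a virtual kink) where $L_{\mathrm{arc}}$ has a plain arc. **Evaluation of the bracket.** Applying the first two skein relations to every classical crossing of $L$ writes $[L]$ as a linear combination of brackets of $3^{\#\text{classical crossings}}$ states, each an unoriented diagram with only virtual crossings. States are evaluated up to planar isotopy and the moves V2 and V3 (under which the bracket is taken to be unchanged), together with the last two skein relations and the normalization $[\emptyset]=1$. Explicitly, a state $S$ consisting of $c(S)$ immersed circles with $v(S)$ virtual crossings in total has value $[S]=r^{v(S)}(-2\nu)^{c(S)}$. *)

theory Defs
  imports
    "HOL-Analysis.Analysis"
    "HOL-Combinatorics.Permutations"
    "HOL-Computational_Algebra.Polynomial_Factorial"
begin

section \<open>Welded link diagrams\<close>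

text \<open>
  The plane is the type \<^typ>\<open>complex\<close>. A circle is the real line modulo 1, so a closed curve is a
  1-periodic function on the reals, and \<open>curve L i\<close> is relevant only for \<open>i < num_comps L\<close>.
  \<open>vcross L\<close> is the set of virtual crossings, as points of the plane, and \<open>over_at L i t\<close> says
  that component \<open>i\<close> passes at parameter \<open>t\<close> through a classical crossing as the over-strand.
\<close>

record wdiagram =
  num_comps :: nat
  curve :: "nat \<Rightarrow> real \<Rightarrow> complex"
  vcross :: "complex set"
  over_at :: "nat \<Rightarrow> real \<Rightarrow> bool"

definition branches :: "wdiagram \<Rightarrow> complex \<Rightarrow> (nat \<times> real) set" where
  "branches L p = {(i, t). i < num_comps L \<and> 0 \<le> t \<and> t < 1 \<and> curve L i t = p}"

definition crossings :: "wdiagram \<Rightarrow> complex set" where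
  "crossings L = {p. card (branches L p) = 2}"

definition classical :: "wdiagram \<Rightarrow> complex set" where
  "classical L = crossings L - vcross L"

definition velocity :: "wdiagram \<Rightarrow> nat \<times> real \<Rightarrow> complex" where
  "velocity L x = vector_derivative (curve L (fst x)) (at (snd x))"

text \<open>\<open>plane_det u v\<close> is the determinant of the pair of plane vectors \<open>(u, v)\<close>.\<close>

definition plane_det :: "complex \<Rightarrow> complex \<Rightarrow> real" where
  "plane_det u v = Re u * Im v - Im u * Re v"

definition closed_immersion :: "(real \<Rightarrow> complex) \<Rightarrow> bool" where
  "closed_immersion f \<longleftrightarrow>
     (\<forall>t. f (t + 1) = f t) \<and> f C1_differentiable_on UNIV \<and>
     (\<forall>t. vector_derivative f (at t) \<noteq> 0)"

text \<open>
  The last condition only normalises \<open>over_at\<close>: it carries no information away from the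
  classical crossings.
\<close>

definition welded_diagram :: "wdiagram \<Rightarrow> bool" where
  "welded_diagram L \<longleftrightarrow>
     (\<forall>i<num_comps L. closed_immersion (curve L i)) \<and>
     (\<forall>p. finite (branches L p) \<and> card (branches L p) \<le> 2) \<and>
     finite (crossings L) \<and>
     (\<forall>p. \<forall>x\<in>branches L p. \<forall>y\<in>branches L p.
        x \<noteq> y \<longrightarrow> plane_det (velocity L x) (velocity L y) \<noteq> 0) \<and>
     vcross L \<subseteq> crossings L \<and>
     (\<forall>i t. over_at L i (t + 1) = over_at L i t) \<and>
     (\<forall>p\<in>classical L. \<exists>!x. x \<in> branches L p \<and> over_at L (fst x) (snd x)) \<and>
     (\<forall>i t. over_at L i t \<longrightarrow> i < num_comps L \<and> curve L i t \<in> classical L)"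

definition over_branch :: "wdiagram \<Rightarrow> complex \<Rightarrow> nat \<times> real" where
  "over_branch L p = (THE x. x \<in> branches L p \<and> over_at L (fst x) (snd x))"

definition under_branch :: "wdiagram \<Rightarrow> complex \<Rightarrow> nat \<times> real" where
  "under_branch L p = (THE x. x \<in> branches L p \<and> \<not> over_at L (fst x) (snd x))"

definition positive_crossing :: "wdiagram \<Rightarrow> complex \<Rightarrow> bool" where
  "positive_crossing L p \<longleftrightarrow>
     plane_det (velocity L (over_branch L p)) (velocity L (under_branch L p)) > 0"

definition writhe :: "wdiagram \<Rightarrow> int" where
  "writhe L = int (card {p \<in> classical L. positive_crossing L p})
            - int (card {p \<in> classical L. \<not> positive_crossing L p})"

definition virtual_writhe :: "wdiagram \<Rightarrow> nat" where
  "virtual_writhe L = card (vcross L)"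


section \<open>Planar isotopy and change of parametrisation\<close>

text \<open>An ambient isotopy: \<open>D s z\<close> is the total derivative of the diffeomorphism \<open>H s\<close> at \<open>z\<close>.\<close>

definition ambient_isotopy :: "(real \<Rightarrow> complex \<Rightarrow> complex) \<Rightarrow> bool" where
  "ambient_isotopy H \<longleftrightarrow>
     continuous_on ({0..1} \<times> UNIV) (\<lambda>(s, z). H s z) \<and>
     (\<forall>z. H 0 z = z) \<and>
     (\<forall>s\<in>{0..1}. bij (H s)) \<and>
     (\<exists>D :: real \<Rightarrow> complex \<Rightarrow> (complex \<Rightarrow>\<^sub>L complex).
        continuous_on ({0..1} \<times> UNIV) (\<lambda>(s, z). D s z) \<and>
        (\<forall>s\<in>{0..1}. \<forall>z. (H s has_derivative blinfun_apply (D s z)) (at z) \<and>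
                         inj (blinfun_apply (D s z))))"

definition planar_isotopic :: "wdiagram \<Rightarrow> wdiagram \<Rightarrow> bool" where
  "planar_isotopic L L' \<longleftrightarrow>
     (\<exists>H. ambient_isotopy H \<and>
        num_comps L' = num_comps L \<and>
        (\<forall>i<num_comps L. \<forall>t. curve L' i t = H 1 (curve L i t) \<and>
                             over_at L' i t = over_at L i t) \<and>
        vcross L' = H 1 ` vcross L)"

text \<open>
  Renumbering of the components and orientation-preserving reparametrisation of the circles do not
  change the diagram as a drawn picture.
\<close>

definition reparametrised :: "wdiagram \<Rightarrow> wdiagram \<Rightarrow> bool" where
  "reparametrised L L' \<longleftrightarrow>
     (\<exists>\<pi> \<theta>. \<pi> permutes {..<num_comps L} \<and>
        (\<forall>i. \<theta> i C1_differentiable_on UNIV \<and>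
             (\<forall>t. \<theta> i (t + 1) = \<theta> i t + 1 \<and> deriv (\<theta> i) t > 0)) \<and>
        num_comps L' = num_comps L \<and>
        (\<forall>i<num_comps L. \<forall>t. curve L' i t = curve L (\<pi> i) (\<theta> i t) \<and>
                             over_at L' i t = over_at L (\<pi> i) (\<theta> i t)) \<and>
        vcross L' = vcross L)"


section \<open>Local moves\<close>

text \<open>
  Up to planar isotopy, the disk in which a local move takes place is the square
  \<open>[-1,1] \<times> [-1,1]\<close>, and the two pictures in it are the explicit ones below. A picture consists of
  strands, parametrised over \<open>[-1,1]\<close>, the set of its virtual crossings, and the set of pairs
  \<open>(j, u)\<close> such that strand \<open>j\<close> is at parameter \<open>u\<close> the over-strand of a classical crossing.
\<close>

definition square :: "complex set" where
  "square = cbox (Complex (-1) (-1)) (Complex 1 1)"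

record tangle =
  num_strands :: nat
  strand :: "nat \<Rightarrow> real \<Rightarrow> complex"
  tvirt :: "complex set"
  tover :: "(nat \<times> real) set"

definition mk_tangle ::
    "(real \<Rightarrow> complex) list \<Rightarrow> complex set \<Rightarrow> (nat \<times> real) set \<Rightarrow> tangle" where
  "mk_tangle cs V U =
     \<lparr>num_strands = length cs, strand = (\<lambda>j. cs ! j), tvirt = V, tover = U\<rparr>"

definition reverse_strands :: "nat set \<Rightarrow> tangle \<Rightarrow> tangle" where
  "reverse_strands J T = T
     \<lparr>strand := (\<lambda>j u. strand T j (if j \<in> J then - u else u)),
      tover := {(j, u). (j, if j \<in> J then - u else u) \<in> tover T}\<rparr>"

text \<open>The arc and the kink (self-crossing at parameters \<open>-1/2\<close> and \<open>1/2\<close>, at the point \<open>i/4\<close>).\<close>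

definition arc1 :: "real \<Rightarrow> complex" where
  "arc1 u = Complex u (u\<^sup>2)"

definition kink1 :: "real \<Rightarrow> complex" where
  "kink1 u = Complex (u * (1 - 16/9 * (1 - u\<^sup>2)\<^sup>2)) (u\<^sup>2)"

text \<open>
  Two parallel vertical strands, and two strands bounding a bigon, crossing at \<open>-i/2\<close> and \<open>i/2\<close>,
  where both parameters are \<open>-1/2\<close> and \<open>1/2\<close>, respectively.
\<close>

definition left2 :: "real \<Rightarrow> complex" where
  "left2 u = Complex (-1/2) u"

definition right2 :: "real \<Rightarrow> complex" where
  "right2 u = Complex (1/2) u"

definition bigon_left2 :: "real \<Rightarrow> complex" where
  "bigon_left2 u = Complex (-1/2 + 8/9 * (1 - u\<^sup>2)\<^sup>2) u"

definition bigon_right2 :: "real \<Rightarrow> complex" where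
  "bigon_right2 u = Complex (1/2 - 8/9 * (1 - u\<^sup>2)\<^sup>2) u"

text \<open>
  Triangle moves: strands 0 and 1 are the diagonals of the square, crossing at the origin, and
  strand 2 runs from \<open>-1\<close> to \<open>1\<close>, above the origin for \<open>\<sigma> = 1\<close> and below it for \<open>\<sigma> = -1\<close>.
  Strand 2 meets strand 0 where both parameters are \<open>\<sigma>/2\<close>, and strand 1 where both are \<open>-\<sigma>/2\<close>.
\<close>

definition diag_up :: "real \<Rightarrow> complex" where
  "diag_up u = Complex u u"

definition diag_down :: "real \<Rightarrow> complex" where
  "diag_down u = Complex u (- u)"

definition across :: "real \<Rightarrow> real \<Rightarrow> complex" where
  "across \<sigma> u = Complex u (\<sigma> * (8/9 * (1 - u\<^sup>2)\<^sup>2))"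

definition triangle :: "real \<Rightarrow> complex set \<Rightarrow> (nat \<times> real) set \<Rightarrow> tangle" where
  "triangle \<sigma> V U = mk_tangle [diag_up, diag_down, across \<sigma>] V U"

definition pt01 :: complex where "pt01 = 0"
definition pt02 :: "real \<Rightarrow> complex" where "pt02 \<sigma> = Complex (\<sigma>/2) (\<sigma>/2)"
definition pt12 :: "real \<Rightarrow> complex" where "pt12 \<sigma> = Complex (-\<sigma>/2) (\<sigma>/2)"

text \<open>The over-passages of a triangle in which strand \<open>j\<close> lies at height \<open>h j\<close>.\<close>

definition layered :: "(nat \<Rightarrow> nat) \<Rightarrow> real \<Rightarrow> (nat \<times> real) set" where
  "layered h \<sigma> =
     {if h 0 > h 1 then (0, 0) else (1, 0),
      if h 2 > h 0 then (2, \<sigma>/2) else (0, \<sigma>/2),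
      if h 2 > h 1 then (2, -\<sigma>/2) else (1, -\<sigma>/2)}"

inductive basic_move :: "tangle \<Rightarrow> tangle \<Rightarrow> bool" where
  R1: "s \<in> {-1/2, 1/2} \<Longrightarrow>
    basic_move (mk_tangle [arc1] {} {}) (mk_tangle [kink1] {} {(0, s)})"
| V1: "basic_move (mk_tangle [arc1] {} {}) (mk_tangle [kink1] {Complex 0 (1/4)} {})"
| R2: "j \<in> {0, 1} \<Longrightarrow>
    basic_move (mk_tangle [left2, right2] {} {})
               (mk_tangle [bigon_left2, bigon_right2] {} {(j, -1/2), (j, 1/2)})"
| V2: "basic_move (mk_tangle [left2, right2] {} {})
                  (mk_tangle [bigon_left2, bigon_right2] {Complex 0 (-1/2), Complex 0 (1/2)} {})"
| R3: "inj_on h {0, 1, 2} \<Longrightarrow>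
    basic_move (triangle 1 {} (layered h 1)) (triangle (-1) {} (layered h (-1)))"
| V3: "basic_move (triangle 1 {pt01, pt02 1, pt12 1} {})
                  (triangle (-1) {pt01, pt02 (-1), pt12 (-1)} {})"
| M: "j \<in> {0, 1} \<Longrightarrow>
    basic_move (triangle 1 {pt02 1, pt12 1} {(j, 0)})
               (triangle (-1) {pt02 (-1), pt12 (-1)} {(j, 0)})"
| F1: "basic_move (triangle 1 {pt01} {(2, 1/2), (2, -1/2)})
                  (triangle (-1) {pt01} {(2, -1/2), (2, 1/2)})"

text \<open>
  \<open>contains_tangle L loc T\<close>: the part of \<open>L\<close> in the square is \<open>T\<close>, where \<open>loc j = (i, a, b)\<close>
  means that strand \<open>j\<close> of \<open>T\<close> is the restriction of component \<open>i\<close> to the parameter interval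
  \<open>[a,b]\<close>, rescaled affinely to \<open>[-1,1]\<close>. Parameters of \<open>L\<close> are meant modulo 1, whence the integer
  shift \<open>m\<close>.
\<close>

definition contains_tangle :: "wdiagram \<Rightarrow> (nat \<Rightarrow> nat \<times> real \<times> real) \<Rightarrow> tangle \<Rightarrow> bool" where
  "contains_tangle L loc T \<longleftrightarrow>
     (\<forall>j<num_strands T. case loc j of (i, a, b) \<Rightarrow>
        i < num_comps L \<and> a < b \<and> b < a + 1 \<and>
        (\<forall>u\<in>{-1..1}.
           curve L i ((a + b) / 2 + u * ((b - a) / 2)) = strand T j u \<and>
           over_at L i ((a + b) / 2 + u * ((b - a) / 2)) = ((j, u) \<in> tover T))) \<and>
     (\<forall>i<num_comps L. \<forall>t. curve L i t \<in> square \<longrightarrow>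
        (\<exists>!j. j < num_strands T \<and>
           (case loc j of (i', a, b) \<Rightarrow> i' = i \<and> (\<exists>m::int. a \<le> t + m \<and> t + m \<le> b)))) \<and>
     vcross L \<inter> square = tvirt T"

definition same_outside_square :: "wdiagram \<Rightarrow> wdiagram \<Rightarrow> bool" where
  "same_outside_square L L' \<longleftrightarrow>
     num_comps L' = num_comps L \<and>
     (\<forall>i<num_comps L. \<forall>t. curve L i t \<notin> square \<or> curve L' i t \<notin> square \<longrightarrow>
        curve L' i t = curve L i t \<and> over_at L' i t = over_at L i t) \<and>
     vcross L' - square = vcross L - square"

definition local_move :: "wdiagram \<Rightarrow> wdiagram \<Rightarrow> bool" where
  "local_move L L' \<longleftrightarrow>
     (\<exists>T T' J loc. basic_move T T' \<and>
        contains_tangle L loc (reverse_strands J T) \<and>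
        contains_tangle L' loc (reverse_strands J T') \<and>
        same_outside_square L L')"

definition welded_step :: "wdiagram \<Rightarrow> wdiagram \<Rightarrow> bool" where
  "welded_step L L' \<longleftrightarrow> welded_diagram L \<and> welded_diagram L' \<and>
     (planar_isotopic L L' \<or> reparametrised L L' \<or> local_move L L')"

definition same_welded_link :: "wdiagram \<Rightarrow> wdiagram \<Rightarrow> bool" where
  "same_welded_link L L' \<longleftrightarrow> welded_diagram L \<and> welded_diagram L' \<and> equivclp welded_step L L'"


section \<open>States and the bracket\<close>

text \<open>
  The three terms of the skein relations: virtualise (\<open>L\<^sub>v\<close>), oriented smoothing (\<open>L\<^sub>o\<close>), and the
  other planar smoothing (\<open>L\<^sub>u\<close>).
\<close>

datatype resolution = Virt | Orient | Unorient

definition states :: "wdiagram \<Rightarrow> (complex \<Rightarrow> resolution) set" where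
  "states L = (classical L \<rightarrow>\<^sub>E UNIV)"

text \<open>
  The circles of the state \<open>S\<close>: cut the components of \<open>L\<close> at the parameters \<open>cuts L S\<close> of the
  smoothed crossings, and glue the ends of the resulting arcs as prescribed by the smoothings. A
  point just before (after) a cut lies on the end coming into (going out of) the crossing there.
  All other crossings of the state are virtual and are passed straight through.
\<close>

definition cuts :: "wdiagram \<Rightarrow> (complex \<Rightarrow> resolution) \<Rightarrow> (nat \<times> real) set" where
  "cuts L S = {(i, t). i < num_comps L \<and> curve L i t \<in> classical L \<and> S (curve L i t) \<noteq> Virt}"

definition state_points :: "wdiagram \<Rightarrow> (complex \<Rightarrow> resolution) \<Rightarrow> (nat \<times> real) set" where
  "state_points L S = {(i, t). i < num_comps L} - cuts L S"

definition incoming :: "wdiagram \<Rightarrow> (complex \<Rightarrow> resolution) \<Rightarrow> nat \<times> real \<Rightarrow> (nat \<times> real) set" where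
  "incoming L S x = {(i, s). i = fst x \<and> s < snd x \<and> (\<forall>t. s \<le> t \<and> t < snd x \<longrightarrow> (i, t) \<notin> cuts L S)}"

definition outgoing :: "wdiagram \<Rightarrow> (complex \<Rightarrow> resolution) \<Rightarrow> nat \<times> real \<Rightarrow> (nat \<times> real) set" where
  "outgoing L S x = {(i, s). i = fst x \<and> snd x < s \<and> (\<forall>t. snd x < t \<and> t \<le> s \<longrightarrow> (i, t) \<notin> cuts L S)}"

inductive joined ::
    "wdiagram \<Rightarrow> (complex \<Rightarrow> resolution) \<Rightarrow> nat \<times> real \<Rightarrow> nat \<times> real \<Rightarrow> bool"
  for L S where
  period: "(i, t) \<in> state_points L S \<Longrightarrow> joined L S (i, t) (i, t + 1)"
| along: "s \<le> t \<Longrightarrow> {i} \<times> {s..t} \<subseteq> state_points L S \<Longrightarrow> joined L S (i, s) (i, t)"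
| oriented: "p \<in> classical L \<Longrightarrow> S p = Orient \<Longrightarrow> x \<in> branches L p \<Longrightarrow> y \<in> branches L p \<Longrightarrow> x \<noteq> y \<Longrightarrow>
    x' \<in> incoming L S x \<Longrightarrow> y' \<in> outgoing L S y \<Longrightarrow> joined L S x' y'"
| unoriented_in: "p \<in> classical L \<Longrightarrow> S p = Unorient \<Longrightarrow> x \<in> branches L p \<Longrightarrow> y \<in> branches L p \<Longrightarrow> x \<noteq> y \<Longrightarrow>
    x' \<in> incoming L S x \<Longrightarrow> y' \<in> incoming L S y \<Longrightarrow> joined L S x' y'"
| unoriented_out: "p \<in> classical L \<Longrightarrow> S p = Unorient \<Longrightarrow> x \<in> branches L p \<Longrightarrow> y \<in> branches L p \<Longrightarrow> x \<noteq> y \<Longrightarrow>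
    x' \<in> outgoing L S x \<Longrightarrow> y' \<in> outgoing L S y \<Longrightarrow> joined L S x' y'"
| symm: "joined L S x y \<Longrightarrow> joined L S y x"
| trans: "joined L S x y \<Longrightarrow> joined L S y z \<Longrightarrow> joined L S x z"

definition num_circles :: "wdiagram \<Rightarrow> (complex \<Rightarrow> resolution) \<Rightarrow> nat" where
  "num_circles L S = card (state_points L S // {(x, y). joined L S x y})"

definition num_virtual :: "wdiagram \<Rightarrow> (complex \<Rightarrow> resolution) \<Rightarrow> nat" where
  "num_virtual L S = card (vcross L \<union> {p \<in> classical L. S p = Virt})"

text \<open>Coefficients of the skein relations; the Boolean argument tells whether the crossing is positive.\<close>

fun skein_coeff :: "'k::field \<Rightarrow> 'k \<Rightarrow> 'k \<Rightarrow> bool \<Rightarrow> resolution \<Rightarrow> 'k" where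
  "skein_coeff a b \<nu> True Virt = a"
| "skein_coeff a b \<nu> True Orient = b"
| "skein_coeff a b \<nu> True Unorient = \<nu> * b"
| "skein_coeff a b \<nu> False Virt = - (a / (b\<^sup>2 - a\<^sup>2))"
| "skein_coeff a b \<nu> False Orient = b / (b\<^sup>2 - a\<^sup>2)"
| "skein_coeff a b \<nu> False Unorient = \<nu> * b / (b\<^sup>2 - a\<^sup>2)"

definition state_value :: "'k::field \<Rightarrow> 'k \<Rightarrow> wdiagram \<Rightarrow> (complex \<Rightarrow> resolution) \<Rightarrow> 'k" where
  "state_value r \<nu> L S = r ^ num_virtual L S * (- 2 * \<nu>) ^ num_circles L S"

definition bracket :: "'k::field \<Rightarrow> 'k \<Rightarrow> 'k \<Rightarrow> 'k \<Rightarrow> wdiagram \<Rightarrow> 'k" where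
  "bracket a b r \<nu> L =
     (\<Sum>S\<in>states L.
        (\<Prod>p\<in>classical L. skein_coeff a b \<nu> (positive_crossing L p) (S p)) * state_value r \<nu> L S)"

definition Y :: "'k::field \<Rightarrow> 'k \<Rightarrow> 'k \<Rightarrow> 'k \<Rightarrow> wdiagram \<Rightarrow> 'k" where
  "Y a b r \<nu> L =
     r ^ virtual_writhe L * (a * r - \<nu> * b) powi (- writhe L) * bracket a b r \<nu> L"

text \<open>Rational functions over the rationals: the inner polynomial variable is \<open>a\<close>, the outer one \<open>b\<close>.\<close>

type_synonym ratfun = "rat poly poly fract"

definition indet_a :: ratfun where
  "indet_a = to_fract [:[:0, 1:]:]"

definition indet_b :: ratfun where
  "indet_b = to_fract [:0, 1:]"

end

theory Submission
  imports Defs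
begin

text \<open>
  Since \<open>r\<^sup>2 = 1\<close>, the virtual crossings drop out, and \<open>Y\<close> is a state sum with weights \<open>1 + \<nu> \<beta>\<close>, \<open>\<beta>\<close>,
  \<open>\<nu> \<beta>\<close> for the three resolutions of a classical crossing, where \<open>\<beta>\<close> is \<open>b / (a r - \<nu> b)\<close> or
  \<open>- b / (a r + \<nu> b)\<close> according to its sign.

  Among the three resolutions of one crossing, the numbers of circles are \<open>k + 1\<close>, \<open>k\<close>, \<open>k\<close> in some
  order, so the powers of \<open>-2\<close> add up to zero. Hence for \<open>\<nu> = 1\<close> the sum collapses to the state
  without smoothings, and \<open>Y(L) = (-2)\<^sup>n\<close> for a link of \<open>n\<close> components.

  For \<open>\<nu> = -1\<close>, write \<open>2\<^sup>c\<close> as the number of orientations of the \<open>c\<close> circles of a state. Each of them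
  labels the arcs of the diagram by whether it agrees with the orientation of \<open>L\<close>. For a fixed
  labelling that changes when passing straight through a crossing, the weights of that crossing
  cancel. What remains is the sum over all \<open>\<epsilon>\<close> from the components to \<open>{\<plusminus>1}\<close> of the product of
  \<open>\<rho>\<^bsup>lk(i, j)\<^esup>\<close> over \<open>\<epsilon>(i) \<noteq> \<epsilon>(j)\<close>, where \<open>\<rho> = (a r - b) / (a r + b)\<close> and \<open>lk(i, j)\<close> counts with
  signs the crossings of \<open>i\<close> over \<open>j\<close>. These linking numbers are invariants of welded links.
\<close>

section \<open>Labellings of the states of a Gauss diagram\<close>

text \<open>The circles of a state are classes of a continuum of points, so how they merge or split
  is not followed directly; counting replaces it. The labellings that fit a state satisfy affine
  conditions over the field with two elements, and their number is \<open>2\<close> to the number of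
  circles. Forgetting the condition at one crossing leaves labellings in which the two incoming and
  the two outgoing labels have equal sums, because every other crossing preserves that sum. They
  fall into three families, each resolution admits two of these, and the affine structure forces one
  family to be empty. So one power of two is the sum of the other two, whence \<open>k + 1\<close>,
  \<open>k\<close>, \<open>k\<close>.

  This half takes place in the Gauss diagram; the plane is remembered only in the signs of
  crossings. Hence no move is ever applied to a bracket. Moves are compared only through signed
  counts of crossings between distinct components.\<close>

text \<open>Two perfect matchings together form a graph whose cycles alternate between them, so all
  cycles are even and a two-colouring exists. The induction removes one edge \<open>{x, m x}\<close>
  and shortens the cycle through it.\<close>

lemma two_matchings_bipartite:
  fixes m n :: "'a \<Rightarrow> 'a"
  assumes "finite E"
    and "\<And>x. x \<in> E \<Longrightarrow> m x \<in> E \<and> m x \<noteq> x \<and> m (m x) = x"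
    and "\<And>x. x \<in> E \<Longrightarrow> n x \<in> E \<and> n x \<noteq> x \<and> n (n x) = x"
  shows "\<exists>g :: 'a \<Rightarrow> bool. \<forall>x\<in>E. g (m x) \<noteq> g x \<and> g (n x) \<noteq> g x"
  using assms
proof (induction "card E" arbitrary: E n rule: less_induct)
  case less
  note m = less.prems(2) and n = less.prems(3)
  show ?case
  proof (cases "E = {}")
    case False
    then obtain x where x: "x \<in> E" by blast
    define y where "y = m x"
    have y: "y \<in> E" "y \<noteq> x" "m y = x" using m[OF x] by (auto simp: y_def)
    define E' where "E' = E - {x, y}"
    have E': "finite E'" "card E' < card E"
      using less.prems(1) x by (auto simp: E'_def intro!: psubset_card_mono)
    have mE': "m z \<in> E' \<and> m z \<noteq> z \<and> m (m z) = z" if "z \<in> E'" for z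
      using that m[of z] m[OF x] y unfolding E'_def by (metis Diff_iff insert_iff y_def empty_iff)
    show ?thesis
    proof (cases "n x = y")
      \<comment> \<open>The matchings share the edge \<open>{x, y}\<close>, a component of its own,
        which may be coloured either way round.\<close>
      case True
      have nE': "n z \<in> E' \<and> n z \<noteq> z \<and> n (n z) = z" if "z \<in> E'" for z
        using that n[of z] n[OF x] True unfolding E'_def by (metis Diff_iff insert_iff empty_iff)
      from less.hyps[OF E'(2,1) mE' nE'] obtain g :: "'a \<Rightarrow> bool"
        where g: "\<forall>z\<in>E'. g (m z) \<noteq> g z \<and> g (n z) \<noteq> g z" by blast
      have "\<forall>z\<in>E. (g(x := True, y := False)) (m z) \<noteq> (g(x := True, y := False)) z \<and>
                   (g(x := True, y := False)) (n z) \<noteq> (g(x := True, y := False)) z"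
      proof
        fix z assume "z \<in> E"
        then consider "z = x" | "z = y" | "z \<in> E'" by (auto simp: E'_def)
        then show "(g(x := True, y := False)) (m z) \<noteq> (g(x := True, y := False)) z \<and>
                   (g(x := True, y := False)) (n z) \<noteq> (g(x := True, y := False)) z"
        proof cases
          case 3
          then show ?thesis using g mE'[OF 3] nE'[OF 3] by (auto simp: E'_def)
        qed (use y n[OF x] True y_def in auto)
      qed
      then show ?thesis by blast
    next
      case False
      define p q where "p = n x" and "q = n y"
      have pq: "p \<in> E'" "q \<in> E'" "p \<noteq> q" "n p = x" "n q = y"
        using n[OF x] n[OF y(1)] False y(2) unfolding p_def q_def E'_def by auto
      \<comment> \<open>The path \<open>p - x - y - q\<close> is contracted to a single edge
        \<open>p - q\<close>. A colouring of the rest separates \<open>p\<close> from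
        \<open>q\<close>, so \<open>x\<close> and \<open>y\<close> can be put back with alternating
        colours.\<close>
      define n' where "n' = n(p := q, q := p)"
      have nE': "n' z \<in> E' \<and> n' z \<noteq> z \<and> n' (n' z) = z" if "z \<in> E'" for z
      proof (cases "z = p \<or> z = q")
        case True
        then show ?thesis using pq by (auto simp: n'_def)
      next
        case F: False
        then have "n z \<in> E' \<and> n z \<noteq> p \<and> n z \<noteq> q"
          using that n[of z] n[OF x] n[OF y(1)] unfolding E'_def p_def q_def
          by force
        then show ?thesis using F that n[of z] unfolding n'_def E'_def by auto
      qed
      from less.hyps[OF E'(2,1) mE' nE'] obtain g :: "'a \<Rightarrow> bool"
        where g: "\<forall>z\<in>E'. g (m z) \<noteq> g z \<and> g (n' z) \<noteq> g z" by blast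
      define h where "h = g(x := \<not> g p, y := \<not> g q)"
      have gpq: "g p \<noteq> g q" using bspec[OF g pq(1)] pq(3) by (simp add: n'_def)
      have "\<forall>z\<in>E. h (m z) \<noteq> h z \<and> h (n z) \<noteq> h z"
      proof
        fix z assume "z \<in> E"
        then consider "z = x" | "z = y" | "z = p" | "z = q" | "z \<in> E'" "z \<noteq> p" "z \<noteq> q" 
          by (auto simp: E'_def)
        then show "h (m z) \<noteq> h z \<and> h (n z) \<noteq> h z"
        proof cases
          case 5
          then have "n z = n' z" by (simp add: n'_def)
          moreover have "m z \<in> E'" "n' z \<in> E'" "g (m z) \<noteq> g z" "g (n' z) \<noteq> g z"
            using mE' nE' g 5(1) by blast+
          ultimately show ?thesis using 5(1) unfolding h_def E'_def by auto
        next
          case 1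
          then have "m z = y" "n z = p" by (simp_all add: y_def p_def)
          then show ?thesis using 1 y(2) gpq pq(1) unfolding h_def E'_def by auto
        next
          case 2
          then have "m z = x" "n z = q" using y by (simp_all add: q_def)
          then show ?thesis using 2 y(2) gpq pq(2) unfolding h_def E'_def by auto
        next
          case 3
          then have "m p \<in> E'" "g (m p) \<noteq> g p" using mE' pq g by auto
          then show ?thesis using 3 pq y(2) unfolding h_def E'_def by auto
        next
          case 4
          then have "m q \<in> E'" "g (m q) \<noteq> g q" using mE' pq g by auto
          then show ?thesis using 4 pq y(2) unfolding h_def E'_def by auto
        qed
      qed
      then show ?thesis by blast
    qed
  qed auto
qed

section \<open>Summation over the resolutions of all crossings\<close>

lemma UNIV_resolution: "(UNIV :: resolution set) = {Virt, Orient, Unorient}"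
  by (auto intro: resolution.exhaust)

lemma sum_resolution: "(\<Sum>c\<in>UNIV. f c) = f Virt + f Orient + f Unorient"
  by (simp add: UNIV_resolution add.assoc)

lemma sum_PiE_insert:
  assumes "finite X" "p \<notin> X" "finite T"
  shows "(\<Sum>S\<in>insert p X \<rightarrow>\<^sub>E T. G S) = (\<Sum>S\<in>X \<rightarrow>\<^sub>E T. \<Sum>c\<in>T. G (S(p := c)))"
proof -
  have "(\<Sum>S\<in>insert p X \<rightarrow>\<^sub>E T. G S) = (\<Sum>(c, S)\<in>T \<times> (X \<rightarrow>\<^sub>E T). G (S(p := c)))"
    unfolding PiE_insert_eq using inj_combinator[OF assms(2), of "\<lambda>_. T"]
    by (subst sum.reindex) (auto simp: case_prod_unfold)
  also have "\<dots> = (\<Sum>c\<in>T. \<Sum>S\<in>X \<rightarrow>\<^sub>E T. G (S(p := c)))"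
    by (simp add: sum.cartesian_product)
  finally show ?thesis by (simp add: sum.swap[of _ T])
qed

text \<open>Crossings are removed one at a time: with weights \<open>1 + c\<close>,
  \<open>c\<close>, \<open>c\<close> the sum over the resolutions of \<open>p\<close> is the
  \<open>Virt\<close> term plus \<open>c\<close> times a sum that vanishes by \<open>skein\<close>.
  The function \<open>F\<close> varies in the induction because crossings already treated are frozen
  as \<open>Virt\<close> inside it.\<close>

lemma state_sum_all_virtual:
  fixes F :: "('p \<Rightarrow> resolution) \<Rightarrow> 'k::comm_ring_1" and w :: "'p \<Rightarrow> resolution \<Rightarrow> 'k"
  assumes "finite X"
    and skein: "\<And>S p. S \<in> X \<rightarrow>\<^sub>E UNIV \<Longrightarrow> p \<in> X \<Longrightarrow>
      F (S(p := Virt)) + F (S(p := Orient)) + F (S(p := Unorient)) = 0"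
    and w: "\<And>p. p \<in> X \<Longrightarrow> w p Unorient = w p Orient \<and> w p Virt = 1 + w p Orient"
  shows "(\<Sum>S\<in>X \<rightarrow>\<^sub>E UNIV. (\<Prod>p\<in>X. w p (S p)) * F S) = F (\<lambda>p\<in>X. Virt)"
  using assms
proof (induction X arbitrary: F rule: finite_induct)
  case empty
  then show ?case by (simp add: restrict_def)
next
  case (insert p X)
  have fin: "finite (UNIV :: resolution set)" by (simp add: UNIV_resolution)
  have "(\<Sum>S\<in>insert p X \<rightarrow>\<^sub>E UNIV. (\<Prod>q\<in>insert p X. w q (S q)) * F S) =
        (\<Sum>S\<in>X \<rightarrow>\<^sub>E UNIV. \<Sum>c\<in>UNIV. (\<Prod>q\<in>X. w q (S q)) * (w p c * F (S(p := c))))"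
    unfolding sum_PiE_insert[OF insert.hyps(1,2) fin]
  proof (intro sum.cong refl)
    fix S c
    have "(\<Prod>q\<in>X. w q ((S(p := c)) q)) = (\<Prod>q\<in>X. w q (S q))"
      using insert.hyps by (intro prod.cong) auto
    then show "(\<Prod>q\<in>insert p X. w q ((S(p := c)) q)) * F (S(p := c)) =
          (\<Prod>q\<in>X. w q (S q)) * (w p c * F (S(p := c)))"
      using insert.hyps by (simp add: mult_ac)
  qed
  also have "\<dots> = (\<Sum>S\<in>X \<rightarrow>\<^sub>E UNIV. (\<Prod>q\<in>X. w q (S q)) * F (S(p := Virt)))"
  proof (intro sum.cong refl)
    fix S :: "'p \<Rightarrow> resolution" assume S: "S \<in> X \<rightarrow>\<^sub>E UNIV"
    have "S(p := Virt) \<in> insert p X \<rightarrow>\<^sub>E UNIV" using S by (auto simp: PiE_def extensional_def)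
    from insert.prems(1)[OF this, of p]
    have "F (S(p := Virt)) + F (S(p := Orient)) + F (S(p := Unorient)) = 0"
      unfolding fun_upd_upd by blast
    moreover have "(\<Sum>c\<in>UNIV. w p c * F (S(p := c))) =
      F (S(p := Virt)) + w p Orient * (F (S(p := Virt)) + F (S(p := Orient)) + F (S(p := Unorient)))"
      using insert.prems(2)[of p] by (simp add: sum_resolution algebra_simps)
    ultimately show "(\<Sum>c\<in>UNIV. (\<Prod>q\<in>X. w q (S q)) * (w p c * F (S(p := c)))) =
      (\<Prod>q\<in>X. w q (S q)) * F (S(p := Virt))"
      by (simp add: sum_distrib_left[symmetric])
  qed
  also have "\<dots> = F ((\<lambda>q\<in>X. Virt)(p := Virt))"
  proof (rule insert.IH)
    fix S :: "'p \<Rightarrow> resolution" and q assume S: "S \<in> X \<rightarrow>\<^sub>E UNIV" "q \<in> X"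
    have "S(p := Virt) \<in> insert p X \<rightarrow>\<^sub>E UNIV" using S by (auto simp: PiE_def extensional_def)
    from insert.prems(1)[OF this, of q]
    show "F ((S(q := Virt))(p := Virt)) + F ((S(q := Orient))(p := Virt)) + F ((S(q := Unorient))(p := Virt)) = 0"
      using S insert.hyps by (subst (1 2 3) fun_upd_twist) (auto simp del: fun_upd_apply)
  qed (use insert.prems in auto)
  also have "(\<lambda>q\<in>X. Virt)(p := Virt) = (\<lambda>q\<in>insert p X. Virt)"
    by (auto simp: fun_eq_iff)
  finally show ?case .
qed

text \<open>
  \<open>K\<close> consists of the arcs into which marked points cut the components, an arc being named by its
  initial point; \<open>pr\<close> gives the arc that ends where a given arc begins. A label tells whether a
  circle of the state runs along or against the arc.
\<close>

locale gauss_diagram =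
  fixes K X :: "'x set" and pr mate :: "'x \<Rightarrow> 'x" and pt :: "'x \<Rightarrow> 'p"
  assumes finite_K: "finite K"
    and pr: "bij_betw pr K K"
    and X_sub: "X \<subseteq> K"
    and mate: "x \<in> X \<Longrightarrow> mate x \<in> X \<and> mate x \<noteq> x \<and> mate (mate x) = x"
    and pt_eq: "x \<in> X \<Longrightarrow> y \<in> X \<Longrightarrow> pt x = pt y \<longleftrightarrow> y = x \<or> y = mate x"
begin

text \<open>At a passage \<open>x\<close> the arc \<open>pr x\<close> comes in and the arc
  \<open>x\<close> goes out; \<open>mate x\<close> is the other passage through the same crossing.
  In the case \<open>Unorient\<close> two heads, or two tails, of arcs are glued, so a circle runs
  along one of the two arcs and against the other.\<close>

definition consistent :: "('x \<Rightarrow> bool) \<Rightarrow> resolution \<Rightarrow> 'x \<Rightarrow> bool" where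
  "consistent f c x = (case c of Virt \<Rightarrow> f (pr x) = f x | Orient \<Rightarrow> f (pr x) = f (mate x)
     | Unorient \<Rightarrow> f (pr x) \<noteq> f (pr (mate x)) \<and> f x \<noteq> f (mate x))"

text \<open>\<open>P\<close> is the set of crossings whose condition is suspended. Marked points
  outside \<open>X\<close> are base points on a strand, where the label cannot change.\<close>

definition labellings_off :: "'p set \<Rightarrow> ('p \<Rightarrow> resolution) \<Rightarrow> ('x \<Rightarrow> bool) set" where
  "labellings_off P S = {f \<in> K \<rightarrow>\<^sub>E UNIV. (\<forall>x\<in>K - X. f (pr x) = f x) \<and>
     (\<forall>x\<in>X. pt x \<notin> P \<longrightarrow> consistent f (S (pt x)) x)}"

abbreviation labellings :: "('p \<Rightarrow> resolution) \<Rightarrow> ('x \<Rightarrow> bool) set" where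
  "labellings \<equiv> labellings_off {}"

lemma finite_X: "finite X"
  using finite_K X_sub by (rule finite_subset[rotated])

lemma finite_labellings_off: "finite (labellings_off P S)"
  by (rule finite_subset[of _ "K \<rightarrow>\<^sub>E UNIV"]) (auto simp: labellings_off_def finite_K intro!: finite_PiE)

lemma pr_in: "x \<in> K \<Longrightarrow> pr x \<in> K"
  using pr by (auto simp: bij_betw_def)

lemma mate_in: "x \<in> X \<Longrightarrow> mate x \<in> X" "x \<in> X \<Longrightarrow> mate x \<in> K"
  using mate X_sub by auto

lemma pt_mate: "x \<in> X \<Longrightarrow> pt (mate x) = pt x"
  using pt_eq[of x "mate x"] mate[of x] by simp

text \<open>
  The beginnings and ends of arcs are matched in two ways, along the arcs and at the marked points.
  A colouring that both matchings reverse gives a labelling.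
\<close>

lemma labellings_nonempty: "labellings S \<noteq> {}"
proof -
  define nx where "nx = the_inv_into K pr"
  have nx: "nx (pr x) = x" "pr (nx x) = x" "nx x \<in> K" if "x \<in> K" for x
    using that pr the_inv_into_f_f[of pr K] f_the_inv_into_f[of pr K] the_inv_into_into[of pr K x K]
    by (auto simp: nx_def bij_betw_def)
  define m :: "bool \<times> 'x \<Rightarrow> bool \<times> 'x" where "m = (\<lambda>(b, x). if b then (False, pr x) else (True, nx x))"
  define n :: "bool \<times> 'x \<Rightarrow> bool \<times> 'x" where
    "n = (\<lambda>(b, x). if x \<notin> X then (\<not> b, x) else
            (case S (pt x) of Virt \<Rightarrow> (\<not> b, x) | Orient \<Rightarrow> (\<not> b, mate x) | Unorient \<Rightarrow> (b, mate x)))"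
  have "\<exists>g :: bool \<times> 'x \<Rightarrow> bool. \<forall>x\<in>UNIV \<times> K. g (m x) \<noteq> g x \<and> g (n x) \<noteq> g x"
  proof (rule two_matchings_bipartite)
    show "finite ((UNIV :: bool set) \<times> K)" using finite_K by simp
    show "m x \<in> UNIV \<times> K \<and> m x \<noteq> x \<and> m (m x) = x" if "x \<in> UNIV \<times> K" for x
      using that nx pr_in by (auto simp: m_def split: if_splits)
    show "n x \<in> UNIV \<times> K \<and> n x \<noteq> x \<and> n (n x) = x" if "x \<in> UNIV \<times> K" for x
      using that mate mate_in pt_mate by (auto simp: n_def split: resolution.splits if_splits)
  qed
  then obtain g :: "bool \<times> 'x \<Rightarrow> bool"
    where g: "\<And>b x. x \<in> K \<Longrightarrow> g (m (b, x)) \<noteq> g (b, x)" "\<And>b x. x \<in> K \<Longrightarrow> g (n (b, x)) \<noteq> g (b, x)" by auto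
  define f where "f = (\<lambda>x\<in>K. g (False, x))"
  have f: "f x = g (False, x)" "f (pr x) = (\<not> g (True, x))" if "x \<in> K" for x
    using that g(1)[OF that, of True] pr_in[OF that] by (auto simp: f_def m_def)
  have "f \<in> labellings S"
    unfolding labellings_off_def
  proof (clarsimp, intro conjI ballI)
    show "f \<in> K \<rightarrow>\<^sub>E UNIV" by (simp add: f_def)
    show "f (pr x) = f x" if "x \<in> K - X" for x
      using that g(2)[of x True] by (auto simp: f n_def)
    show "consistent f (S (pt x)) x" if "x \<in> X" for x
    proof -
      have K: "x \<in> K" "mate x \<in> K" using that X_sub mate_in by auto
      show ?thesis
        using g(2)[OF K(1), of True] g(2)[OF K(1), of False] that
        by (auto simp: f[OF K(1)] f[OF K(2)] n_def consistent_def split: resolution.splits)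
    qed
  qed
  then show ?thesis by blast
qed

text \<open>Since \<open>pr\<close> permutes the arcs, the differences \<open>f (pr y) - f y\<close>
  sum to zero over all arcs. At every other crossing each of the three resolutions makes the
  differences of the two passages cancel, so they cancel at \<open>x\<close> as well.\<close>

lemma conservation:
  assumes f: "f \<in> labellings_off {pt x} S" and x: "x \<in> X"
  shows "of_bool (f (pr x)) + of_bool (f (pr (mate x))) = (of_bool (f x) + of_bool (f (mate x)) :: int)"
proof -
  define d :: "'x \<Rightarrow> int" where "d y = of_bool (f (pr y)) - of_bool (f y)" for y
  have "(\<Sum>y\<in>K. of_bool (f (pr y)) :: int) = (\<Sum>y\<in>K. of_bool (f y))"
    using sum.reindex_bij_betw[OF pr, of "\<lambda>y. of_bool (f y)"] by simp
  then have 0: "sum d K = 0" by (simp add: d_def sum_subtractf)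
  define X' where "X' = X - {x, mate x}"
  have mX': "mate y \<in> X'" "mate (mate y) = y" "pt y \<noteq> pt x" "y \<in> X" "mate y \<in> X" if "y \<in> X'" for y
    using that mate[of y] mate[OF x] pt_eq[OF x, of y] unfolding X'_def by (auto simp: pt_mate)
  have "bij_betw mate X' X'"
    by (rule bij_betw_byWitness[of _ mate]) (use mX' in auto)
  then have "sum d X' = (\<Sum>y\<in>X'. d (mate y))"
    by (simp add: sum.reindex_bij_betw)
  \<comment> \<open>Doubling pairs every passage with its mate without choosing one passage from
    each crossing.\<close>
  then have "2 * sum d X' = (\<Sum>y\<in>X'. d y + d (mate y))"
    by (simp add: sum.distrib)
  also have "\<dots> = 0"
  proof (rule sum.neutral, rule ballI)
    fix y assume y: "y \<in> X'"
    have "consistent f (S (pt y)) y" "consistent f (S (pt y)) (mate y)"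
      using f mX'[OF y] mX'[OF mX'(1)[OF y]] pt_mate[of y] unfolding labellings_off_def by auto
    then show "d y + d (mate y) = 0"
      using mX'[OF y] by (auto simp: consistent_def d_def split: resolution.splits)
  qed
  finally have 1: "sum d X' = 0" by simp
  have "sum d K = sum d X"
    using f by (intro sum.mono_neutral_right finite_K X_sub) (auto simp: labellings_off_def d_def)
  also have "\<dots> = sum d X' + (d x + d (mate x))"
    unfolding X'_def using mate[OF x] x finite_X
    by (subst sum.subset_diff[of "{x, mate x}" X]) auto
  finally show ?thesis using 0 1 by (simp add: d_def)
qed

lemma labellings_fun_upd:
  assumes "x \<in> X"
  shows "labellings (S(pt x := c)) =
    {f \<in> labellings_off {pt x} S. consistent f c x \<and> consistent f c (mate x)}"
proof -
  have "x' \<in> X \<and> pt x' = pt x \<longleftrightarrow> x' = x \<or> x' = mate x" for x'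
    using assms mate_in(1) pt_eq[OF assms, of x'] pt_mate by metis
  then have "(\<forall>z\<in>X. pt z \<notin> {} \<longrightarrow> consistent f ((S(pt x := c)) (pt z)) z) \<longleftrightarrow>
      (\<forall>z\<in>X. pt z \<notin> {pt x} \<longrightarrow> consistent f (S (pt z)) z) \<and> consistent f c x \<and> consistent f c (mate x)" for f
    by (auto split: if_splits) (metis fun_upd_apply)+
  then show ?thesis unfolding labellings_off_def by blast
qed

text \<open>If \<open>b < c\<close>, then \<open>2 ^ a\<close> would lie strictly between
  \<open>2 ^ c\<close> and \<open>2 ^ Suc c\<close>.\<close>

lemma two_power_eq_sum:
  assumes "(2::nat) ^ a = 2 ^ b + 2 ^ c"
  shows "b = c \<and> a = Suc b"
proof -
  have "b = c" if "(2::nat) ^ a = 2 ^ b + 2 ^ c" "b \<le> c" for b c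
  proof (rule ccontr)
    assume "b \<noteq> c"
    then have bc: "b < c" using that by simp
    have "(2::nat) ^ c < 2 ^ a" using that by simp
    then have "c < a" by simp
    then have "(2::nat) ^ Suc c \<le> 2 ^ a" by (intro power_increasing) auto
    moreover have "(2::nat) ^ b < 2 ^ c" using bc by simp
    ultimately show False using that(1) by simp
  qed
  from this[of b c] this[of c b] have "b = c" using assms by (metis add.commute nle_le)
  moreover from this have "(2::nat) ^ a = 2 ^ Suc b" using assms by simp
  ultimately show ?thesis by (metis power_inject_exp one_less_numeral_iff semiring_norm(76))
qed

lemma skein_triple:
  fixes c :: "('p \<Rightarrow> resolution) \<Rightarrow> nat"
  assumes c: "\<And>S. card (labellings S) = 2 ^ c S" and x: "x \<in> X"
  shows "(- 2 :: 'k::comm_ring_1) ^ c (S(pt x := Virt)) + (- 2) ^ c (S(pt x := Orient))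
      + (- 2) ^ c (S(pt x := Unorient)) = 0"
proof -
  define y where "y = mate x"
  have y: "y \<in> X" "mate y = x" using mate[OF x] by (auto simp: y_def)
  define R where "R = labellings_off {pt x} S"
  have cons: "of_bool (f (pr x)) + of_bool (f (pr y)) = (of_bool (f x) + of_bool (f y) :: int)" if "f \<in> R" for f
    using conservation[of f x S] that x by (simp add: R_def y_def)
  \<comment> \<open>In \<open>A0\<close> all four labels at the crossing agree; in \<open>A1\<close>
    the incoming labels differ and pass straight through; in \<open>A2\<close> they differ and are
    exchanged. Conservation leaves no other case. \<open>Virt\<close>, \<open>Orient\<close> and
    \<open>Unorient\<close> exclude \<open>A2\<close>, \<open>A1\<close> and \<open>A0\<close>
    respectively and admit the rest.\<close>
  define A0 A1 A2 where "A0 = {f \<in> R. f (pr x) = f (pr y) \<and> f x = f (pr x) \<and> f y = f (pr x)}"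
    and "A1 = {f \<in> R. f (pr x) \<noteq> f (pr y) \<and> f x = f (pr x) \<and> f y = f (pr y)}"
    and "A2 = {f \<in> R. f (pr x) \<noteq> f (pr y) \<and> f x = f (pr y) \<and> f y = f (pr x)}"
  have fin: "finite A0" "finite A1" "finite A2"
    using finite_labellings_off by (auto simp: A0_def A1_def A2_def R_def)
  have L: "labellings (S(pt x := r)) = {f \<in> R. consistent f r x \<and> consistent f r y}" for r
    using labellings_fun_upd[OF x] by (simp add: R_def y_def)
  have "labellings (S(pt x := Virt)) = A0 \<union> A1"
    unfolding L A0_def A1_def consistent_def using cons y by (auto simp: of_bool_def split: if_splits)
  moreover have "labellings (S(pt x := Orient)) = A0 \<union> A2"
    unfolding L A0_def A2_def consistent_def using cons y y_def by (auto simp: of_bool_def split: if_splits)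
  moreover have "labellings (S(pt x := Unorient)) = A1 \<union> A2"
    unfolding L A1_def A2_def consistent_def using cons y y_def by (auto simp: of_bool_def split: if_splits)
  moreover have "A0 \<inter> A1 = {}" "A0 \<inter> A2 = {}" "A1 \<inter> A2 = {}"
    by (auto simp: A0_def A1_def A2_def)
  ultimately have eqs: "2 ^ c (S(pt x := Virt)) = card A0 + card A1"
      "2 ^ c (S(pt x := Orient)) = card A0 + card A2"
      "2 ^ c (S(pt x := Unorient)) = card A1 + card A2"
    using fin by (simp_all flip: c add: card_Un_disjoint)
  txt \<open>The constraints are affine, so the sum of one labelling of each kind would again be a
    labelling; but it would violate conservation.\<close>
  have "A0 = {} \<or> A1 = {} \<or> A2 = {}"
  proof (rule ccontr)
    assume "\<not> ?thesis"
    then obtain f0 f1 f2 where f: "f0 \<in> A0" "f1 \<in> A1" "f2 \<in> A2" by blast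
    \<comment> \<open>On Booleans this is the sum of the three values modulo two. At the crossing it
      gives two equal incoming labels and two outgoing labels opposite to them.\<close>
    define h where "h = (\<lambda>z\<in>K. f0 z = (f1 z = f2 z))"
    have hK: "h z = (f0 z = (f1 z = f2 z))" if "z \<in> K" for z using that by (simp add: h_def)
    have fR: "f0 \<in> R" "f1 \<in> R" "f2 \<in> R" using f by (auto simp: A0_def A1_def A2_def)
    have "h \<in> R"
      unfolding R_def labellings_off_def
    proof (clarsimp, intro conjI ballI impI)
      show "h \<in> K \<rightarrow>\<^sub>E UNIV" by (simp add: h_def)
      show "h (pr z) = h z" if "z \<in> K - X" for z
        using that fR pr_in[of z] unfolding R_def labellings_off_def by (simp add: hK)
      show "consistent h (S (pt z)) z" if z: "z \<in> X" "pt z \<noteq> pt x" for z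
      proof -
        have K: "z \<in> K" "mate z \<in> K" "pr z \<in> K" "pr (mate z) \<in> K"
          using z X_sub mate_in pr_in by auto
        have "consistent f0 (S (pt z)) z" "consistent f1 (S (pt z)) z" "consistent f2 (S (pt z)) z"
          using fR z unfolding R_def labellings_off_def by auto
        then show ?thesis using K by (auto simp: consistent_def hK split: resolution.splits)
      qed
    qed
    moreover have K: "x \<in> K" "y \<in> K" "pr x \<in> K" "pr y \<in> K"
      using x y X_sub pr_in by auto
    ultimately show False
      using cons[of h] f unfolding A0_def A1_def A2_def
      by (auto simp: hK of_bool_def split: if_splits)
  qed
  then consider "2 ^ c (S(pt x := Virt)) = (2::nat) ^ c (S(pt x := Orient)) + 2 ^ c (S(pt x := Unorient))"
    | "2 ^ c (S(pt x := Orient)) = (2::nat) ^ c (S(pt x := Virt)) + 2 ^ c (S(pt x := Unorient))"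
    | "2 ^ c (S(pt x := Unorient)) = (2::nat) ^ c (S(pt x := Virt)) + 2 ^ c (S(pt x := Orient))"
    using eqs by fastforce
  then show ?thesis
    by cases (drule two_power_eq_sum, simp add: algebra_simps)+
qed

lemma straight_labellings:
  "labellings (\<lambda>p\<in>pt ` X. Virt) = {f \<in> K \<rightarrow>\<^sub>E UNIV. \<forall>x\<in>K. f (pr x) = f x}"
  using X_sub unfolding labellings_off_def by (auto simp: consistent_def)

text \<open>
  For the weights of \<open>\<nu> = -1\<close> only the labellings that pass straight through all crossings
  survive, since the two smoothings of a crossing where a labelling turns have opposite weights.
\<close>

lemma state_sum_labellings:
  fixes w :: "'p \<Rightarrow> resolution \<Rightarrow> 'k::comm_ring_1"
  assumes w: "\<And>p. p \<in> pt ` X \<Longrightarrow> w p Unorient = - w p Orient \<and> w p Virt = 1 - w p Orient"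
  shows "(\<Sum>S\<in>pt ` X \<rightarrow>\<^sub>E UNIV. (\<Prod>p\<in>pt ` X. w p (S p)) * of_nat (card (labellings S))) =
    (\<Sum>f\<in>{f \<in> K \<rightarrow>\<^sub>E (UNIV :: bool set). \<forall>x\<in>K. f (pr x) = f x}.
       \<Prod>p\<in>pt ` X. if \<exists>x\<in>X. pt x = p \<and> f x \<noteq> f (mate x) then w p Virt - w p Orient else 1)"
proof -
  define C where "C = pt ` X"
  have finC: "finite C" using finite_X by (simp add: C_def)
  define ok where "ok f p c \<longleftrightarrow> (\<forall>x\<in>X. pt x = p \<longrightarrow> consistent f c x)" for f p c
  define B :: "('x \<Rightarrow> bool) set" where "B = {f \<in> K \<rightarrow>\<^sub>E UNIV. \<forall>x\<in>K - X. f (pr x) = f x}"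
  have "finite (K \<rightarrow>\<^sub>E (UNIV :: bool set))" by (intro finite_PiE finite_K) simp
  then have finB: "finite B" 
    by (rule rev_finite_subset) (auto simp: B_def)
  have lab: "labellings S = {f \<in> B. \<forall>p\<in>C. ok f p (S p)}" for S
    by (auto simp: labellings_off_def B_def ok_def C_def)
  have card_lab: "of_nat (card (labellings S)) = (\<Sum>f\<in>B. \<Prod>p\<in>C. of_bool (ok f p (S p)) :: 'k)" for S
  proof -
    have "(\<Prod>p\<in>C. of_bool (ok f p (S p)) :: 'k) = of_bool (\<forall>p\<in>C. ok f p (S p))" for f
    proof (cases "\<forall>p\<in>C. ok f p (S p)")
      case False
      then obtain p where "p \<in> C" "\<not> ok f p (S p)" by blast
      then show ?thesis using finC by (auto intro!: prod_zero)
    qed simp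
    then have "(\<Sum>f\<in>B. \<Prod>p\<in>C. of_bool (ok f p (S p)) :: 'k) = (\<Sum>f\<in>B. of_bool (\<forall>p\<in>C. ok f p (S p)))"
      by simp
    also have "\<dots> = of_nat (card (labellings S))"
      unfolding lab of_bool_def using finB by (simp add: sum.If_cases Int_def)
    finally show ?thesis by simp
  qed
  have fin: "finite (UNIV :: resolution set)" by (simp add: UNIV_resolution)
  have "(\<Sum>S\<in>C \<rightarrow>\<^sub>E UNIV. (\<Prod>p\<in>C. w p (S p)) * of_nat (card (labellings S))) =
     (\<Sum>f\<in>B. \<Sum>S\<in>C \<rightarrow>\<^sub>E UNIV. \<Prod>p\<in>C. w p (S p) * of_bool (ok f p (S p)))"
    unfolding card_lab sum_distrib_left prod.distrib[symmetric] by (rule sum.swap)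
  \<comment> \<open>Once the labelling is fixed, the resolutions at different crossings are chosen
    independently, so the inner sum factorises over the crossings.\<close>
  also have "\<dots> = (\<Sum>f\<in>B. \<Prod>p\<in>C. \<Sum>c\<in>UNIV. w p c * of_bool (ok f p c))"
    by (simp add: prod_sum_PiE[OF finC fin])
  also have "\<dots> = (\<Sum>f\<in>{f \<in> K \<rightarrow>\<^sub>E (UNIV :: bool set). \<forall>x\<in>K. f (pr x) = f x}.
       \<Prod>p\<in>C. if \<exists>x\<in>X. pt x = p \<and> f x \<noteq> f (mate x) then w p Virt - w p Orient else 1)"
  proof (rule sum.mono_neutral_cong_right[OF finB])
    show "{f \<in> K \<rightarrow>\<^sub>E UNIV. \<forall>x\<in>K. f (pr x) = f x} \<subseteq> B" by (auto simp: B_def)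
    have fib: "(z \<in> X \<and> pt z = pt x) \<longleftrightarrow> z = x \<or> z = mate x" if "x \<in> X" for x z
      using that mate_in(1) pt_eq[OF that, of z] pt_mate by metis
    have okx: "ok f (pt x) c \<longleftrightarrow> consistent f c x \<and> consistent f c (mate x)" if "x \<in> X" for f x c
      using fib[OF that] unfolding ok_def by metis
    have split: "(\<exists>z\<in>X. pt z = pt x \<and> f z \<noteq> f (mate z)) \<longleftrightarrow> f x \<noteq> f (mate x)" if xX: "x \<in> X" for f x
    proof
      assume "\<exists>z\<in>X. pt z = pt x \<and> f z \<noteq> f (mate z)"
      then obtain z where "z = x \<or> z = mate x" "f z \<noteq> f (mate z)" using fib[OF xX] by metis
      then show "f x \<noteq> f (mate x)" using mate[OF xX] by auto
    qed (use xX in blast)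
    show "\<forall>f\<in>B - {f \<in> K \<rightarrow>\<^sub>E UNIV. \<forall>x\<in>K. f (pr x) = f x}.
      (\<Prod>p\<in>C. \<Sum>c\<in>UNIV. w p c * of_bool (ok f p c)) = 0"
    proof
      fix f :: "'x \<Rightarrow> bool" assume "f \<in> B - {f \<in> K \<rightarrow>\<^sub>E UNIV. \<forall>x\<in>K. f (pr x) = f x}"
      then obtain x where x: "x \<in> X" "f (pr x) \<noteq> f x" by (auto simp: B_def)
      have K: "mate x \<in> X" "mate (mate x) = x" using mate[OF x(1)] by auto
      have wx: "w (pt x) Unorient = - w (pt x) Orient" "w (pt x) Virt = 1 - w (pt x) Orient"
        using w[of "pt x"] x by auto
      have "pt x \<in> C" using x by (simp add: C_def)
      \<comment> \<open>A labelling that turns at \<open>x\<close> excludes \<open>Virt\<close> and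
        admits either both smoothings, whose weights are opposite, or neither.\<close>
      moreover have "(\<Sum>c\<in>UNIV. w (pt x) c * of_bool (ok f (pt x) c)) = 0"
        using x(2) unfolding sum_resolution okx[OF x(1)] consistent_def wx K(2) of_bool_def
        by (cases "f x"; cases "f (pr x)"; cases "f (mate x)"; cases "f (pr (mate x))") simp_all
      ultimately show "(\<Prod>p\<in>C. \<Sum>c\<in>UNIV. w p c * of_bool (ok f p c)) = 0"
        using finC by (auto intro: prod_zero)
    qed
    fix f :: "'x \<Rightarrow> bool" assume f: "f \<in> {f \<in> K \<rightarrow>\<^sub>E UNIV. \<forall>x\<in>K. f (pr x) = f x}"
    show "(\<Prod>p\<in>C. \<Sum>c\<in>UNIV. w p c * of_bool (ok f p c)) =
      (\<Prod>p\<in>C. if \<exists>x\<in>X. pt x = p \<and> f x \<noteq> f (mate x) then w p Virt - w p Orient else 1)"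
    proof (rule prod.cong)
      fix p assume "p \<in> C"
      then obtain x where x: "x \<in> X" "p = pt x" by (auto simp: C_def)
      have K: "mate (mate x) = x" using mate[OF x(1)] by auto
      have wx: "w (pt x) Unorient = - w (pt x) Orient" "w (pt x) Virt = 1 - w (pt x) Orient"
        using w[of "pt x"] x by auto
      have "f (pr x) = f x" "f (pr (mate x)) = f (mate x)"
        using f x X_sub mate_in by auto
      \<comment> \<open>A straight labelling admits \<open>Virt\<close> together with
        \<open>Orient\<close> if the two strands carry equal labels, with total weight
        \<open>1\<close>, and \<open>Virt\<close> together with \<open>Unorient\<close>
        otherwise.\<close>
      then show "(\<Sum>c\<in>UNIV. w p c * of_bool (ok f p c)) =
        (if \<exists>x\<in>X. pt x = p \<and> f x \<noteq> f (mate x) then w p Virt - w p Orient else 1)"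
        unfolding sum_resolution x(2) okx[OF x(1)] split[OF x(1)] consistent_def wx K of_bool_def
        by (cases "f x"; cases "f (mate x)") simp_all
    qed simp
  qed
  finally show ?thesis unfolding C_def .
qed

end

section \<open>Arcs and circles\<close>

text \<open>The marks of one circle, lifted to the line. The mark \<open>0\<close> guarantees that a
  component without crossings still has an arc and that the suprema below are taken over nonempty
  sets.\<close>

locale periodic_marks =
  fixes M :: "real set"
  assumes zero_mem: "0 \<in> M" and period: "t + 1 \<in> M \<longleftrightarrow> t \<in> M" and finite_unit: "finite (M \<inter> {0..<1})"
begin

lemma period_int: "t + of_int k \<in> M \<longleftrightarrow> t \<in> M"
proof (induction k rule: int_induct[where k = 0])
  case (step1 k)
  then show ?case using period[of "t + of_int k"] by (simp add: add.assoc)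
next
  case (step2 k)
  then show ?case using period[of "t + of_int (k - 1)"] by (simp add: algebra_simps)
qed simp

lemma frac_mem: "frac t \<in> M \<longleftrightarrow> t \<in> M"
  using period_int[of "frac t" "floor t"] by (simp add: frac_def)

lemma finite_bounded: "finite (M \<inter> {a..b})"
proof (rule finite_subset)
  show "M \<inter> {a..b} \<subseteq> (\<lambda>(x, k). x + of_int k) ` ((M \<inter> {0..<1}) \<times> {floor a..floor b})"
  proof
    fix t assume t: "t \<in> M \<inter> {a..b}"
    then have "t = (\<lambda>(x, k). x + of_int k) (frac t, floor t)" "frac t \<in> M \<inter> {0..<1}" "floor t \<in> {floor a..floor b}"
      by (auto simp: frac_def frac_mem[unfolded frac_def] frac_lt_1[unfolded frac_def] intro: floor_mono)
    then show "t \<in> (\<lambda>(x, k). x + of_int k) ` ((M \<inter> {0..<1}) \<times> {floor a..floor b})" by blast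
  qed
qed (use finite_unit in auto)

text \<open>\<open>last t\<close> is the start of the arc that runs on from \<open>t\<close>, and
  \<open>prev t\<close> the start of the arc that arrives at \<open>t\<close>; the two differ
  exactly when \<open>t\<close> is a mark.\<close>

definition last :: "real \<Rightarrow> real" where "last t = Sup {m \<in> M. m \<le> t}"
definition prev :: "real \<Rightarrow> real" where "prev t = Sup {m \<in> M. m < t}"

text \<open>Only finitely many marks lie between \<open>m0\<close> and \<open>t\<close>, so the
  supremum is a maximum. The predicate \<open>P\<close> serves both for \<open>m \<le> t\<close> and
  for \<open>m < t\<close>.\<close>

lemma greatest_mark:
  assumes P: "\<And>m. P m \<Longrightarrow> m \<le> t" and m0: "m0 \<in> M" "P m0"
  shows "Sup {m \<in> M. P m} \<in> M" "P (Sup {m \<in> M. P m})" "m \<in> M \<Longrightarrow> P m \<Longrightarrow> m \<le> Sup {m \<in> M. P m}"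
proof -
  define A where "A = {m \<in> M. P m \<and> m0 \<le> m}"
  have A: "finite A" "A \<noteq> {}"
    using P m0 by (auto simp: A_def intro: finite_subset[OF _ finite_bounded[of m0 t]])
  have mx: "Max A \<in> A" and le: "\<And>m. m \<in> A \<Longrightarrow> m \<le> Max A" using A by simp_all
  have eq: "Sup {m \<in> M. P m} = Max A"
  proof (rule cSup_eq_maximum)
    show "Max A \<in> {m \<in> M. P m}" using mx by (auto simp: A_def)
    show "m \<le> Max A" if m: "m \<in> {m \<in> M. P m}" for m
    proof (cases "m0 \<le> m")
      case True
      then show ?thesis using m by (intro le) (auto simp: A_def)
    next
      case False
      then show ?thesis using mx by (auto simp: A_def)
    qed
  qed
  then show "Sup {m \<in> M. P m} \<in> M" "P (Sup {m \<in> M. P m})" using mx by (auto simp: A_def)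
  show "m \<le> Sup {m \<in> M. P m}" if "m \<in> M" "P m"
    using that mx le[of m] unfolding eq by (cases "m0 \<le> m") (auto simp: A_def)
qed

lemma int_mem: "of_int k \<in> M"
  using period_int[of 0 k] zero_mem by simp

lemma last: "last t \<in> M" "last t \<le> t" "m \<in> M \<Longrightarrow> m \<le> t \<Longrightarrow> m \<le> last t"
  using greatest_mark[of "\<lambda>m. m \<le> t" t "of_int (floor t)"] int_mem by (auto simp: last_def)

lemma prev: "prev t \<in> M" "prev t < t" "m \<in> M \<Longrightarrow> m < t \<Longrightarrow> m \<le> prev t"
proof -
  have "of_int (floor t - 1) < t" by linarith
  then show "prev t \<in> M" "prev t < t" "m \<in> M \<Longrightarrow> m < t \<Longrightarrow> m \<le> prev t"
    using greatest_mark[of "\<lambda>m. m < t" t "of_int (floor t - 1)"] int_mem[of "floor t - 1"]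
    unfolding prev_def by (blast intro: less_imp_le)+
qed

lemma last_add_int: "last (t + of_int k) = last t + of_int k"
proof (rule antisym)
  have "last (t + of_int k) - of_int k \<in> M"
    using period_int[of "last (t + of_int k)" "- k"] last(1) by simp
  then show "last (t + of_int k) \<le> last t + of_int k"
    using last(3)[of "last (t + of_int k) - of_int k" t] last(2)[of "t + of_int k"] by simp
  show "last t + of_int k \<le> last (t + of_int k)"
    using last period_int by (intro last(3)) auto
qed

lemma prev_add_int: "prev (t + of_int k) = prev t + of_int k"
proof (rule antisym)
  have "prev (t + of_int k) - of_int k \<in> M"
    using period_int[of "prev (t + of_int k)" "- k"] prev(1) by simp
  then show "prev (t + of_int k) \<le> prev t + of_int k"
    using prev(3)[of "prev (t + of_int k) - of_int k" t] prev(2)[of "t + of_int k"] by simp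
  show "prev t + of_int k \<le> prev (t + of_int k)"
    using prev period_int by (intro prev(3)) auto
qed

lemma last_mark: "t \<in> M \<Longrightarrow> last t = t"
  using last(2)[of t] last(3)[of t t] by simp

lemma prev_eq_last: "t \<notin> M \<Longrightarrow> prev t = last t"
proof (rule antisym)
  assume t: "t \<notin> M"
  show "prev t \<le> last t" using prev(1,2)[of t] by (intro last(3)) auto
  have "last t \<noteq> t" using last(1)[of t] t by auto
  then show "last t \<le> prev t" using last(1,2)[of t] by (intro prev(3)) auto
qed

lemma last_eq_prev:
  assumes "s < t" "M \<inter> {s<..<t} = {}"
  shows "last s = prev t"
proof (rule antisym)
  show "last s \<le> prev t" using last[of s] assms by (intro prev(3)) auto
  show "prev t \<le> last s" using prev[of t] assms by (intro last(3)) force+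
qed

lemma prev_inj: "a \<in> M \<Longrightarrow> b \<in> M \<Longrightarrow> prev a = prev b \<Longrightarrow> a = b"
  by (metis linorder_less_linear prev(2,3) not_le)

lemma gap_after: "\<exists>s>t. M \<inter> {t<..s} = {}"
proof -
  have "finite (M \<inter> {t<..t+1})" by (rule finite_subset[OF _ finite_bounded[of t "t+1"]]) auto
  then obtain e where e: "e > 0" "\<forall>x\<in>M \<inter> {t<..t+1}. x \<noteq> t \<longrightarrow> e \<le> dist t x"
    using finite_set_avoid by blast
  have "x \<notin> M" if x: "t < x" "x \<le> t + min (e/2) 1" for x
  proof
    assume "x \<in> M"
    then have "e \<le> dist t x" using e x by auto
    then show False using x e(1) by (auto simp: dist_real_def)
  qed
  then show ?thesis
    using e(1) by (intro exI[of _ "t + min (e/2) 1"]) auto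
qed

end

lemma frac_add_int: "frac (x + of_int k) = frac x"
  by (simp add: frac_def)

section \<open>The Gauss diagram of a link diagram\<close>

locale diagram =
  fixes L :: wdiagram
  assumes welded: "welded_diagram L"
begin

definition pt :: "nat \<times> real \<Rightarrow> complex" where "pt x = curve L (fst x) (snd x)"

definition classical_branches :: "(nat \<times> real) set" where
  "classical_branches = {(i, t). i < num_comps L \<and> 0 \<le> t \<and> t < 1 \<and> curve L i t \<in> classical L}"

text \<open>Each component gets a base point at parameter \<open>0\<close>, which may coincide with
  a passage through a crossing. Virtual crossings give no marks, since the circles of every state
  pass straight through them.\<close>

definition marks :: "(nat \<times> real) set" where
  "marks = classical_branches \<union> {..<num_comps L} \<times> {0}"

definition mark_params :: "nat \<Rightarrow> real set" where
  "mark_params i = {t. (i, frac t) \<in> marks}"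

definition mate :: "nat \<times> real \<Rightarrow> nat \<times> real" where
  "mate x = (THE y. y \<in> branches L (pt x) \<and> y \<noteq> x)"

lemma curve_period: "i < num_comps L \<Longrightarrow> curve L i (t + 1) = curve L i t"
  using welded by (simp add: welded_diagram_def closed_immersion_def)

lemma curve_add_int: "i < num_comps L \<Longrightarrow> curve L i (t + of_int k) = curve L i t"
proof (induction k rule: int_induct[where k = 0])
  case (step1 k)
  then show ?case using curve_period[of i "t + of_int k"] by (simp add: add.assoc)
next
  case (step2 k)
  then show ?case using curve_period[of i "t + of_int (k - 1)"] by (simp add: algebra_simps)
qed simp

lemma curve_frac: "i < num_comps L \<Longrightarrow> curve L i (frac t) = curve L i t"
  using curve_add_int[of i "frac t" "floor t"] by (simp add: frac_def)

lemma classical_branches: "classical_branches = (\<Union>p\<in>classical L. branches L p)"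
  by (auto simp: classical_branches_def branches_def)

lemma finite_classical: "finite (classical L)"
  using welded by (simp add: welded_diagram_def classical_def)

lemma finite_classical_branches: "finite classical_branches"
  using welded finite_classical by (simp add: classical_branches welded_diagram_def)

lemma finite_marks: "finite marks"
  using finite_classical_branches by (simp add: marks_def)

lemma pt_branch: "x \<in> branches L p \<Longrightarrow> pt x = p"
  by (auto simp: pt_def branches_def)

lemma branches_eq:
  assumes "x \<in> branches L p" "p \<in> classical L"
  shows "branches L p = {x, mate x} \<and> mate x \<noteq> x"
proof -
  have "card (branches L p) = 2" using assms by (simp add: classical_def crossings_def)
  then obtain y where y: "branches L p = {x, y}" "y \<noteq> x"
    using assms(1) by (auto simp: card_2_iff doubleton_eq_iff)
  then have "mate x = y"
    unfolding mate_def pt_branch[OF assms(1)] by (intro the_equality) auto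
  then show ?thesis using y by simp
qed

lemma classical_branch: "x \<in> classical_branches \<Longrightarrow> x \<in> branches L (pt x) \<and> pt x \<in> classical L"
  by (auto simp: classical_branches_def branches_def pt_def)

lemma mate_classical_branch:
  assumes "x \<in> classical_branches"
  shows "mate x \<in> classical_branches" "mate x \<noteq> x" "mate (mate x) = x" "pt (mate x) = pt x"
proof -
  have x: "x \<in> branches L (pt x)" "pt x \<in> classical L" using classical_branch[OF assms] by auto
  note b = branches_eq[OF this]
  then have m: "mate x \<in> branches L (pt x)" by blast
  show "mate x \<in> classical_branches" using m x(2) by (auto simp: classical_branches)
  show "mate x \<noteq> x" using b by blast
  show "mate (mate x) = x" using b branches_eq[OF m x(2)] by (auto simp: doubleton_eq_iff)
  show "pt (mate x) = pt x" using pt_branch[OF m] .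
qed

lemma pt_image: "pt ` classical_branches = classical L"
proof -
  have "\<exists>x. x \<in> branches L p" if "p \<in> classical L" for p
  proof -
    have "branches L p \<noteq> {}" using that by (auto simp: classical_def crossings_def)
    then show ?thesis by blast
  qed
  then have "p \<in> pt ` classical_branches" if "p \<in> classical L" for p
    using that pt_branch unfolding classical_branches by (metis UN_I image_eqI)
  moreover have "pt ` classical_branches \<subseteq> classical L" using classical_branch by blast
  ultimately show ?thesis by blast
qed

lemma periodic_marks: "i < num_comps L \<Longrightarrow> periodic_marks (mark_params i)"
proof
  assume i: "i < num_comps L"
  then show "0 \<in> mark_params i" by (simp add: mark_params_def marks_def)
  show "t + 1 \<in> mark_params i \<longleftrightarrow> t \<in> mark_params i" for t
    by (simp add: mark_params_def frac_def algebra_simps)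
  show "finite (mark_params i \<inter> {0..<1})"
  proof (rule finite_subset[of _ "snd ` marks"])
    show "mark_params i \<inter> {0..<1} \<subseteq> snd ` marks"
    proof
      fix t assume t: "t \<in> mark_params i \<inter> {0..<1}"
      then have "frac t = t" by (simp add: frac_eq)
      then have "(i, t) \<in> marks" using t by (simp add: mark_params_def)
      then show "t \<in> snd ` marks" by force
    qed
  qed (simp add: finite_marks)
qed

definition arc :: "nat \<times> real \<Rightarrow> nat \<times> real" where
  "arc x = (fst x, frac (periodic_marks.last (mark_params (fst x)) (snd x)))"

definition prev_arc :: "nat \<times> real \<Rightarrow> nat \<times> real" where
  "prev_arc x = (fst x, frac (periodic_marks.prev (mark_params (fst x)) (snd x)))"

lemma marks_bound: "(i, t) \<in> marks \<Longrightarrow> i < num_comps L \<and> 0 \<le> t \<and> t < 1 \<and> frac t = t \<and> t \<in> mark_params i"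
  by (auto simp: marks_def classical_branches_def mark_params_def frac_eq)

lemma arc_mem: "i < num_comps L \<Longrightarrow> arc (i, t) \<in> marks"
  using periodic_marks.last(1)[OF periodic_marks, of i t] by (simp add: arc_def mark_params_def)

lemma prev_arc_mem: "i < num_comps L \<Longrightarrow> prev_arc (i, t) \<in> marks"
  using periodic_marks.prev(1)[OF periodic_marks, of i t] by (simp add: prev_arc_def mark_params_def)

lemma arc_mark: "i < num_comps L \<Longrightarrow> t \<in> mark_params i \<Longrightarrow> arc (i, t) = (i, frac t)"
  by (simp add: arc_def periodic_marks.last_mark[OF periodic_marks])

lemma arc_marks: "x \<in> marks \<Longrightarrow> arc x = x"
  using marks_bound[of "fst x" "snd x"] arc_mark[of "fst x" "snd x"] by simp

lemma arc_add_int: "i < num_comps L \<Longrightarrow> arc (i, t + of_int k) = arc (i, t)"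
  by (simp add: arc_def periodic_marks.last_add_int[OF periodic_marks] frac_add_int)

lemma prev_arc_frac: "i < num_comps L \<Longrightarrow> prev_arc (i, frac t) = prev_arc (i, t)"
  using periodic_marks.prev_add_int[OF periodic_marks, of i "frac t" "floor t"]
  by (simp add: prev_arc_def frac_add_int) (simp add: frac_def)

lemma prev_arc_eq_arc: "i < num_comps L \<Longrightarrow> t \<notin> mark_params i \<Longrightarrow> prev_arc (i, t) = arc (i, t)"
  by (simp add: arc_def prev_arc_def periodic_marks.prev_eq_last[OF periodic_marks])

lemma arc_eq_prev_arc:
  "i < num_comps L \<Longrightarrow> s < t \<Longrightarrow> mark_params i \<inter> {s<..<t} = {} \<Longrightarrow> arc (i, s) = prev_arc (i, t)"
  by (simp add: arc_def prev_arc_def periodic_marks.last_eq_prev[OF periodic_marks])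

text \<open>Marks with equal predecessors modulo \<open>1\<close> are themselves equal modulo
  \<open>1\<close>, and an injective map of a finite set into itself is onto.\<close>

lemma bij_prev_arc: "bij_betw prev_arc marks marks"
proof -
  have "inj_on prev_arc marks"
  proof (rule inj_onI)
    fix x y assume xy: "x \<in> marks" "y \<in> marks" "prev_arc x = prev_arc y"
    obtain i s t where eq: "x = (i, s)" "y = (i, t)"
      using xy(3) by (cases x; cases y) (auto simp: prev_arc_def)
    have i: "i < num_comps L" and st: "0 \<le> s" "s < 1" "0 \<le> t" "t < 1" "s \<in> mark_params i" "t \<in> mark_params i"
      using marks_bound xy unfolding eq by auto
    interpret periodic_marks "mark_params i" by (rule periodic_marks[OF i])
    have "frac (prev s) = frac (prev t)" using xy(3) by (simp add: eq prev_arc_def)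
    then obtain k where k: "prev s = prev t + of_int k"
      unfolding frac_def by (intro that[of "floor (prev s) - floor (prev t)"]) simp
    have "s = t + of_int k"
      using prev_inj[of s "t + of_int k"] st k period_int[of t k] prev_add_int[of t k] by simp
    then have "k = 0" using st by linarith
    then show "x = y" using \<open>s = t + of_int k\<close> by (simp add: eq)
  qed
  moreover have "prev_arc ` marks \<subseteq> marks"
    using prev_arc_mem marks_bound by force
  ultimately show ?thesis
    using finite_marks by (simp add: bij_betw_def endo_inj_surj)
qed

sublocale gauss_diagram marks classical_branches prev_arc mate pt
proof
  show "finite marks" by (rule finite_marks)
  show "bij_betw prev_arc marks marks" by (rule bij_prev_arc)
  show "classical_branches \<subseteq> marks" by (simp add: marks_def)
  show "mate x \<in> classical_branches \<and> mate x \<noteq> x \<and> mate (mate x) = x" if "x \<in> classical_branches" for x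
    using mate_classical_branch[OF that] by blast
  show "pt x = pt y \<longleftrightarrow> y = x \<or> y = mate x" if "x \<in> classical_branches" "y \<in> classical_branches" for x y
  proof
    assume "pt x = pt y"
    then have "y \<in> branches L (pt x)" using classical_branch[OF that(2)] by simp
    then show "y = x \<or> y = mate x" using branches_eq[of x "pt x"] classical_branch[OF that(1)] by blast
  qed (use mate_classical_branch(4)[OF that(1)] in metis)
qed

lemma cut_mark:
  assumes "(i, t) \<in> cuts L S"
  shows "i < num_comps L" "t \<in> mark_params i" "(i, frac t) \<in> classical_branches" "S (pt (i, frac t)) \<noteq> Virt"
  using assms curve_frac[of i t] frac_lt_1[of t] frac_ge_0[of t]
  by (auto simp: cuts_def mark_params_def marks_def classical_branches_def pt_def)

lemma classical_branch_cut:
  "(i, frac t) \<in> classical_branches \<Longrightarrow> S (pt (i, frac t)) \<noteq> Virt \<Longrightarrow> (i, t) \<in> cuts L S"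
  using curve_frac[of i t] by (auto simp: cuts_def classical_branches_def pt_def)

text \<open>Off the marks both sides name the same arc. A mark that is not a cut is a mere base
  point or a crossing resolved as \<open>Virt\<close>, and both let the label through.\<close>

lemma label_uncut:
  assumes f: "f \<in> labellings S" and i: "i < num_comps L" and t: "(i, t) \<notin> cuts L S"
  shows "f (prev_arc (i, t)) = f (arc (i, t))"
proof (cases "t \<in> mark_params i")
  case True
  then have m: "(i, frac t) \<in> marks" by (simp add: mark_params_def)
  have "f (prev_arc (i, frac t)) = f (i, frac t)"
  proof (cases "(i, frac t) \<in> classical_branches")
    case True
    then have "S (pt (i, frac t)) = Virt" using classical_branch_cut t by blast
    then show ?thesis using f True by (auto simp: labellings_off_def consistent_def)
  qed (use f m in \<open>auto simp: labellings_off_def\<close>)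
  then show ?thesis using True i by (simp add: prev_arc_frac arc_mark)
qed (simp add: prev_arc_eq_arc i)

lemma label_along:
  assumes f: "f \<in> labellings S" and i: "i < num_comps L"
    and "s < t" and "\<And>u. s < u \<Longrightarrow> u < t \<Longrightarrow> (i, u) \<notin> cuts L S"
  shows "f (arc (i, s)) = f (prev_arc (i, t))"
  using assms(3,4)
proof (induction "card (mark_params i \<inter> {s<..<t})" arbitrary: s t rule: less_induct)
  case less
  interpret periodic_marks "mark_params i" by (rule periodic_marks[OF i])
  have fin: "finite (mark_params i \<inter> {s<..<t})"
    by (rule finite_subset[OF _ finite_bounded[of s t]]) auto
  show ?case
  proof (cases "mark_params i \<inter> {s<..<t} = {}")
    case True
    then show ?thesis using arc_eq_prev_arc[OF i less.prems(1)] by simp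
  next
    case False
    then obtain u where u: "u \<in> mark_params i" "s < u" "u < t" by auto
    have "card (mark_params i \<inter> {s<..<u}) < card (mark_params i \<inter> {s<..<t})"
      "card (mark_params i \<inter> {u<..<t}) < card (mark_params i \<inter> {s<..<t})"
      using u by (intro psubset_card_mono fin; auto)+
    then have "f (arc (i, s)) = f (prev_arc (i, u))" "f (arc (i, u)) = f (prev_arc (i, t))"
      using less u by (meson less_trans)+
    then show ?thesis using label_uncut[OF f i] less.prems(2) u by metis
  qed
qed

lemma label_incoming:
  assumes "f \<in> labellings S" "x' \<in> incoming L S x" "x \<in> branches L p"
  shows "f (arc x') = f (prev_arc x)"
  using assms label_along[of f S "fst x" "snd x'" "snd x"]
  by (cases x; cases x') (auto simp: incoming_def branches_def)

lemma label_outgoing: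
  assumes "f \<in> labellings S" "x' \<in> outgoing L S x" "x \<in> branches L p" "p \<in> classical L"
  shows "f (arc x') = f x"
proof -
  obtain i t s where x: "x = (i, t)" "x' = (i, s)" "t < s" "i < num_comps L" "(i, s) \<notin> cuts L S"
    and "\<And>u. t < u \<Longrightarrow> u < s \<Longrightarrow> (i, u) \<notin> cuts L S"
    using assms(2,3) by (cases x; cases x') (auto simp: outgoing_def branches_def)
  then have "f (arc (i, t)) = f (prev_arc (i, s))" "f (prev_arc (i, s)) = f (arc (i, s))"
    using label_along[OF assms(1), of i t s] label_uncut[OF assms(1), of i s] by blast+
  moreover have "x \<in> marks" using assms(3,4) by (auto simp: marks_def classical_branches)
  ultimately show ?thesis using x arc_marks by auto
qed

lemma label_across:
  assumes "f \<in> labellings S" "p \<in> classical L" "x \<in> branches L p" "y \<in> branches L p" "x \<noteq> y"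
  shows "S p = Orient \<Longrightarrow> f (prev_arc x) = f y"
    and "S p = Unorient \<Longrightarrow> f (prev_arc x) \<noteq> f (prev_arc y)"
    and "S p = Unorient \<Longrightarrow> f x \<noteq> f y"
proof -
  have "y = mate x" "x \<in> classical_branches" "pt x = p"
    using branches_eq[OF assms(3,2)] assms(2-5) pt_branch[OF assms(3)] by (auto simp: classical_branches)
  moreover from this have "consistent f (S p) x" using assms(1) by (auto simp: labellings_off_def)
  ultimately show "S p = Orient \<Longrightarrow> f (prev_arc x) = f y"
    "S p = Unorient \<Longrightarrow> f (prev_arc x) \<noteq> f (prev_arc y)"
    "S p = Unorient \<Longrightarrow> f x \<noteq> f y"
    by (auto simp: consistent_def)
qed

text \<open>The label itself flips where two heads or two tails are glued, but it flips for every
  labelling at once. So agreement of two labellings, unlike the label, is a property of a whole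
  circle.\<close>

lemma label_joined:
  assumes f: "f \<in> labellings S" and g: "g \<in> labellings S" and j: "joined L S z w"
  shows "(f (arc z) = g (arc z)) = (f (arc w) = g (arc w))"
  using j
proof (induction rule: joined.induct)
  case (period i t)
  then show ?case using arc_add_int[of i t 1] by (auto simp: state_points_def)
next
  case (along s t i)
  show ?case
  proof (cases "s = t")
    case False
    then have st: "s < t" using along by simp
    have "(i, t) \<in> state_points L S" using along by auto
    then have i: "i < num_comps L" "(i, t) \<notin> cuts L S" by (auto simp: state_points_def)
    have "(i, u) \<notin> cuts L S" if "s < u" "u < t" for u
    proof -
      have "(i, u) \<in> state_points L S" using along(2) that by auto
      then show ?thesis by (simp add: state_points_def)
    qed
    then show ?thesis
      using label_along[OF f i(1) st] label_along[OF g i(1) st] label_uncut[OF f i] label_uncut[OF g i] by metis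
  qed simp
next
  case (oriented p x y x' y')
  then show ?case
    using label_across(1)[OF f, of p x y] label_across(1)[OF g, of p x y]
      label_incoming[OF f, of x' x p] label_incoming[OF g, of x' x p]
      label_outgoing[OF f, of y' y p] label_outgoing[OF g, of y' y p] by simp
next
  case (unoriented_in p x y x' y')
  then show ?case
    using label_across(2)[OF f, of p x y] label_across(2)[OF g, of p x y]
      label_incoming[OF f, of x' x p] label_incoming[OF g, of x' x p]
      label_incoming[OF f, of y' y p] label_incoming[OF g, of y' y p] by auto
next
  case (unoriented_out p x y x' y')
  then show ?case
    using label_across(3)[OF f, of p x y] label_across(3)[OF g, of p x y]
      label_outgoing[OF f, of x' x p] label_outgoing[OF g, of x' x p]
      label_outgoing[OF f, of y' y p] label_outgoing[OF g, of y' y p] by auto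
qed auto

section \<open>From arcs to the circles of a state\<close>

text \<open>A mark may be a cut, which is no state point, so an arc is represented by a point after
  its start.\<close>

definition inner_point :: "nat \<times> real \<Rightarrow> nat \<times> real" where
  "inner_point x = (fst x, SOME s. snd x < s \<and> mark_params (fst x) \<inter> {snd x<..s} = {})"

lemma inner_point:
  assumes "(i, t) \<in> marks"
  obtains s where "inner_point (i, t) = (i, s)" "t < s" "mark_params i \<inter> {t<..s} = {}"
proof -
  have "i < num_comps L" using assms marks_bound by blast
  then interpret periodic_marks "mark_params i" by (rule periodic_marks)
  show ?thesis
    using someI_ex[OF gap_after[of t]] that by (auto simp: inner_point_def)
qed

lemma unmarked_state_point:
  "i < num_comps L \<Longrightarrow> t \<notin> mark_params i \<Longrightarrow> (i, t) \<in> state_points L S"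
  using cut_mark(2) by (auto simp: state_points_def)

lemma inner_point_state_point: "x \<in> marks \<Longrightarrow> inner_point x \<in> state_points L S"
  using inner_point[of "fst x" "snd x"] marks_bound[of "fst x" "snd x"]
  by (metis unmarked_state_point disjoint_iff greaterThanAtMost_iff order_refl prod.collapse)

lemma joined_refl: "z \<in> state_points L S \<Longrightarrow> joined L S z z"
  using joined.along[of "snd z" "snd z" "fst z" L S] by auto

lemma joined_add_int: "(i, t) \<in> state_points L S \<Longrightarrow> joined L S (i, t) (i, t + of_int k)"
proof (induction k rule: int_induct[where k = 0])
  case base
  then show ?case using joined_refl by simp
next
  case (step1 k)
  have "(i, t + of_int k) \<in> state_points L S"
    using step1.prems curve_add_int by (auto simp: state_points_def cuts_def)
  from joined.period[OF this] step1 show ?case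
    using joined.trans[of L S "(i, t)" "(i, t + of_int k)"] by (simp add: add.assoc)
next
  case (step2 k)
  have "(i, t + of_int (k - 1)) \<in> state_points L S"
    using step2.prems curve_add_int[of i t "k - 1"] by (auto simp: state_points_def cuts_def)
  from joined.period[OF this] have "joined L S (i, t + of_int (k - 1)) (i, t + of_int k)"
    by (simp add: algebra_simps)
  from joined.trans[OF step2.IH[OF step2.prems] joined.symm[OF this]] show ?case .
qed

text \<open>Up to a whole period, the point and the representative of its arc lie in the same gap
  between marks.\<close>

lemma joined_inner_point:
  assumes "z \<in> state_points L S"
  shows "joined L S z (inner_point (arc z))"
proof -
  obtain i t where z: "z = (i, t)" by (cases z)
  have i: "i < num_comps L" using assms by (auto simp: z state_points_def)
  interpret periodic_marks "mark_params i" by (rule periodic_marks[OF i])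
  define m where "m = last t"
  have arcz: "arc z = (i, frac m)" by (simp add: z arc_def m_def)
  obtain s where s: "inner_point (arc z) = (i, s)" "frac m < s" "mark_params i \<inter> {frac m<..s} = {}"
    using inner_point[of i "frac m"] arc_mem[OF i, of t] arcz z by auto
  \<comment> \<open>The representative belongs to the arc named in the unit interval; it is moved to
    the period in which the arc through \<open>t\<close> starts.\<close>
  define s' where "s' = s + of_int (floor m)"
  have ms': "m < s'" using s(2) by (simp add: s'_def frac_def)
  have no_s: "u \<notin> mark_params i" if "m < u" "u \<le> s'" for u
  proof -
    have "u - of_int (floor m) \<in> {frac m<..s}" using that by (auto simp: s'_def frac_def)
    then have "u - of_int (floor m) \<notin> mark_params i" using s(3) by blast
    then show ?thesis using period_int[of u "- floor m"] by simp
  qed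
  have no_t: "u \<notin> mark_params i" if "m < u" "u \<le> t" for u
    using last(3)[of u t] that by (auto simp: m_def)
  have mt: "m \<le> t" using last(2) by (simp add: m_def)
  \<comment> \<open>The only possible mark in this interval is \<open>t\<close> itself, and it is a
    state point by assumption.\<close>
  have sub: "{i} \<times> {min t s'..max t s'} \<subseteq> state_points L S"
  proof
    fix y assume y: "y \<in> {i} \<times> {min t s'..max t s'}"
    then obtain u where u: "y = (i, u)" "min t s' \<le> u" "u \<le> max t s'" by auto
    show "y \<in> state_points L S"
    proof (cases "u = t")
      case True
      then show ?thesis using assms u z by simp
    next
      case False
      then have "u \<notin> mark_params i" using no_s no_t mt ms' u by (cases "u \<le> t") auto
      then show ?thesis using unmarked_state_point[OF i] u by simp
    qed
  qed
  have "joined L S (i, t) (i, s')"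
    using joined.along[OF _ sub] by (cases "t \<le> s'") (auto simp: min_def max_def intro: joined.symm)
  moreover have "joined L S (i, s) (i, s')"
    unfolding s'_def using inner_point_state_point[OF arc_mem[OF i, of t]] s z by (intro joined_add_int) auto
  ultimately have "joined L S (i, t) (i, s)" by (rule joined.trans[OF _ joined.symm])
  then show ?thesis using s(1) z by simp
qed

lemma arc_inner_point: "x \<in> marks \<Longrightarrow> arc (inner_point x) = x"
proof -
  assume x: "x \<in> marks"
  obtain i t where it: "x = (i, t)" by (cases x)
  then have i: "i < num_comps L" "t \<in> mark_params i" "frac t = t" using x marks_bound by auto
  obtain s where s: "inner_point (i, t) = (i, s)" "t < s" "mark_params i \<inter> {t<..s} = {}"
    using inner_point x it by blast
  have "arc (i, t) = prev_arc (i, s)" using s by (intro arc_eq_prev_arc i) auto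
  also have "\<dots> = arc (i, s)" using s by (intro prev_arc_eq_arc i) auto
  finally show ?thesis using arc_marks[OF x] s it by simp
qed

text \<open>The midpoint between the mark and its predecessor represents the arriving arc and has an
  uncut stretch up to the mark, as \<open>incoming\<close> and \<open>along\<close> require.\<close>

lemma before_mark:
  assumes "(i, t) \<in> marks"
  obtains u where "u < t" "(i, u) \<in> state_points L S" "joined L S (i, u) (inner_point (prev_arc (i, t)))"
    "\<And>v. u \<le> v \<Longrightarrow> v < t \<Longrightarrow> (i, v) \<in> state_points L S"
proof -
  have i: "i < num_comps L" using assms marks_bound by blast
  interpret periodic_marks "mark_params i" by (rule periodic_marks[OF i])
  define u where "u = (prev t + t) / 2"
  have u: "prev t < u" "u < t" using prev(2)[of t] by (auto simp: u_def)
  have no: "v \<notin> mark_params i" if "prev t < v" "v < t" for v using prev(3)[of v t] that by auto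
  have sp: "(i, v) \<in> state_points L S" if "u \<le> v" "v < t" for v
    using unmarked_state_point[OF i no] that u by auto
  have "arc (i, u) = prev_arc (i, t)"
    using u no by (intro arc_eq_prev_arc i) auto
  then show ?thesis using that u sp joined_inner_point by (metis order_refl)
qed

lemma joined_uncut:
  assumes x: "x \<in> marks" "x \<notin> cuts L S"
  shows "joined L S (inner_point (prev_arc x)) (inner_point x)"
proof -
  obtain i t where it: "x = (i, t)" by (cases x)
  obtain u where u: "u < t" "(i, u) \<in> state_points L S" "joined L S (i, u) (inner_point (prev_arc (i, t)))"
    "\<And>v. u \<le> v \<Longrightarrow> v < t \<Longrightarrow> (i, v) \<in> state_points L S"
    using before_mark x it by metis
  have t: "(i, t) \<in> state_points L S" using x marks_bound by (auto simp: it state_points_def)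
  have "joined L S (i, u) (i, t)"
  proof (rule joined.along)
    show "{i} \<times> {u..t} \<subseteq> state_points L S"
      using u(4) t by (auto simp: le_less)
  qed (use u in simp)
  moreover have "joined L S (i, t) (inner_point x)"
    using joined_inner_point[OF t] arc_marks[OF x(1)] it by simp
  ultimately show ?thesis using u(3) it by (metis joined.symm joined.trans)
qed

lemma inner_point_incoming:
  assumes "x \<in> classical_branches"
  obtains x' where "x' \<in> incoming L S x" "joined L S x' (inner_point (prev_arc x))"
proof -
  obtain i t where it: "x = (i, t)" by (cases x)
  have "(i, t) \<in> marks" using assms it by (simp add: marks_def)
  from before_mark[OF this, of S] obtain u where u: "u < t" "joined L S (i, u) (inner_point (prev_arc (i, t)))"
    "\<And>v. u \<le> v \<Longrightarrow> v < t \<Longrightarrow> (i, v) \<in> state_points L S" by metis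
  have "(i, v) \<notin> cuts L S" if "u \<le> v" "v < t" for v
    using u(3)[OF that] by (simp add: state_points_def)
  then have "(i, u) \<in> incoming L S x" using u(1) by (simp add: it incoming_def)
  then show ?thesis using that u(2) it by blast
qed

lemma inner_point_outgoing:
  assumes "x \<in> classical_branches"
  shows "inner_point x \<in> outgoing L S x"
proof -
  obtain i t where it: "x = (i, t)" by (cases x)
  have "(i, t) \<in> marks" using assms it by (simp add: marks_def)
  from inner_point[OF this] obtain s where s: "inner_point (i, t) = (i, s)" "t < s" "mark_params i \<inter> {t<..s} = {}" .
  have "(i, u) \<notin> cuts L S" if "t < u" "u \<le> s" for u
    using cut_mark(2)[of i u S] s(3) that by auto
  then show ?thesis using s(1,2) it by (auto simp: outgoing_def)
qed

text \<open>This is the counterpart of \<open>label_across\<close>: arcs whose labels determine each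
  other at a smoothing lie on one circle.\<close>

lemma joined_across:
  assumes x: "x \<in> classical_branches"
  shows "S (pt x) = Orient \<Longrightarrow> joined L S (inner_point (prev_arc x)) (inner_point (mate x))"
    and "S (pt x) = Unorient \<Longrightarrow> joined L S (inner_point (prev_arc x)) (inner_point (prev_arc (mate x)))"
    and "S (pt x) = Unorient \<Longrightarrow> joined L S (inner_point x) (inner_point (mate x))"
proof -
  note mx = mate_classical_branch[OF x]
  have b: "pt x \<in> classical L" "x \<in> branches L (pt x)" "mate x \<in> branches L (pt x)" "x \<noteq> mate x"
    using classical_branch[OF x] classical_branch[OF mx(1)] mx by auto
  obtain x' where x': "x' \<in> incoming L S x" "joined L S x' (inner_point (prev_arc x))"
    using inner_point_incoming[OF x] .
  obtain y' where y': "y' \<in> incoming L S (mate x)" "joined L S y' (inner_point (prev_arc (mate x)))"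
    using inner_point_incoming[OF mx(1)] .
  note o = inner_point_outgoing[OF x, of S] inner_point_outgoing[OF mx(1), of S]
  show "S (pt x) = Orient \<Longrightarrow> joined L S (inner_point (prev_arc x)) (inner_point (mate x))"
    using joined.oriented[OF b(1) _ b(2,3,4) x'(1) o(2)] x'(2) by (metis joined.symm joined.trans)
  show "S (pt x) = Unorient \<Longrightarrow> joined L S (inner_point (prev_arc x)) (inner_point (prev_arc (mate x)))"
    using joined.unoriented_in[OF b(1) _ b(2,3,4) x'(1) y'(1)] x'(2) y'(2) by (metis joined.symm joined.trans)
  show "S (pt x) = Unorient \<Longrightarrow> joined L S (inner_point x) (inner_point (mate x))"
    using joined.unoriented_out[OF b(1) _ b(2,3,4) o] by blast
qed

text \<open>With one labelling \<open>f0\<close> fixed, any other is determined by the circles on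
  which it agrees with \<open>f0\<close>, and every set of circles occurs.\<close>

lemma card_labellings: "card (labellings S) = 2 ^ num_circles L S"
proof -
  define R where "R = {(z, w). joined L S z w}"
  define Q where "Q = state_points L S // R"
  define cls where "cls x = R `` {inner_point x}" for x
  obtain f0 where f0: "f0 \<in> labellings S" using labellings_nonempty by blast
  have cls_eq: "R `` {z} = R `` {w}" if "joined L S z w" for z w
  proof -
    have "joined L S z u \<longleftrightarrow> joined L S w u" for u
      using that joined.trans[of L S z w u] joined.trans[of L S w z u] joined.symm[of L S z w] by blast
    then show ?thesis by (auto simp: R_def)
  qed
  have Q: "Q = cls ` marks"
  proof
    show "Q \<subseteq> cls ` marks"
    proof
      fix c assume "c \<in> Q"
      then obtain z where z: "z \<in> state_points L S" "c = R `` {z}" by (auto simp: Q_def quotient_def)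
      have "c = cls (arc z)" using cls_eq[OF joined_inner_point[OF z(1)]] z(2) by (simp add: cls_def)
      moreover have "arc z \<in> marks" using z(1) arc_mem[of "fst z" "snd z"] by (auto simp: state_points_def)
      ultimately show "c \<in> cls ` marks" by blast
    qed
    show "cls ` marks \<subseteq> Q"
      by (auto simp: Q_def cls_def intro: quotientI inner_point_state_point)
  qed
  \<comment> \<open>\<open>h\<close> says on which circles \<open>f0\<close> is kept; on the others
    it is reversed.\<close>
  define \<Phi> where "\<Phi> h = (\<lambda>x\<in>marks. f0 x = h (cls x))" for h
  have "bij_betw \<Phi> (Q \<rightarrow>\<^sub>E (UNIV :: bool set)) (labellings S)"
    unfolding bij_betw_def
  proof (intro conjI subset_antisym)
    show "inj_on \<Phi> (Q \<rightarrow>\<^sub>E (UNIV :: bool set))"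
    proof (rule inj_onI)
      fix h h' :: "(nat \<times> real) set \<Rightarrow> bool" assume h: "h \<in> Q \<rightarrow>\<^sub>E UNIV" "h' \<in> Q \<rightarrow>\<^sub>E UNIV" "\<Phi> h = \<Phi> h'"
      show "h = h'"
      proof (rule PiE_ext[OF h(1,2)])
        fix c assume "c \<in> Q"
        then obtain x where x: "x \<in> marks" "c = cls x" using Q by blast
        show "h c = h' c" using fun_cong[OF h(3), of x] x unfolding \<Phi>_def by (simp, blast)
      qed
    qed
    show "\<Phi> ` (Q \<rightarrow>\<^sub>E (UNIV :: bool set)) \<subseteq> labellings S"
    proof (rule image_subsetI)
      fix h :: "(nat \<times> real) set \<Rightarrow> bool" assume "h \<in> Q \<rightarrow>\<^sub>E UNIV"
      have val: "\<Phi> h x = (f0 x = h (cls x))" if "x \<in> marks" for x using that by (simp add: \<Phi>_def)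
      show "\<Phi> h \<in> labellings S"
        unfolding labellings_off_def
      proof (clarsimp, intro conjI ballI)
        show "\<Phi> h \<in> marks \<rightarrow>\<^sub>E UNIV" by (simp add: \<Phi>_def)
        show "\<Phi> h (prev_arc x) = \<Phi> h x" if x: "x \<in> marks - classical_branches" for x
        proof -
          have "x \<notin> cuts L S" using x cut_mark(3)[of "fst x" "snd x"] marks_bound[of "fst x" "snd x"] by auto
          then have "cls (prev_arc x) = cls x"
            using x cls_eq[OF joined_uncut] by (simp add: cls_def)
          moreover have "f0 (prev_arc x) = f0 x" using f0 x by (auto simp: labellings_off_def)
          ultimately show ?thesis using x pr_in[of x] by (simp add: val)
        qed
        show "consistent (\<Phi> h) (S (pt x)) x" if x: "x \<in> classical_branches" for x
        proof -
          have K: "x \<in> marks" "mate x \<in> marks" "prev_arc x \<in> marks" "prev_arc (mate x) \<in> marks"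
            using x mate_in(2)[OF x] pr_in by (auto simp: marks_def)
          have c0: "consistent f0 (S (pt x)) x" using f0 x by (auto simp: labellings_off_def)
          have "x \<notin> cuts L S" if "S (pt x) = Virt"
            using that cut_mark(4)[of "fst x" "snd x" S] marks_bound[of "fst x" "snd x"] K(1) by auto
          then show ?thesis
            using c0 joined_across[OF x, of S] joined_uncut[OF K(1), of S] cls_eq
            by (auto simp: consistent_def val K cls_def split: resolution.splits)
        qed
      qed
    qed
    show "labellings S \<subseteq> \<Phi> ` (Q \<rightarrow>\<^sub>E (UNIV :: bool set))"
    proof
      fix f assume f: "f \<in> labellings S"
      \<comment> \<open>One point of a circle decides, because agreement with \<open>f0\<close> does
        not vary along the circle.\<close>
      define h where "h = (\<lambda>c\<in>Q. \<exists>z\<in>c. f (arc z) = f0 (arc z))"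
      have "\<Phi> h x = f x" if x: "x \<in> marks" for x
      proof -
        have "inner_point x \<in> cls x"
          using joined_refl[OF inner_point_state_point[OF x]] by (simp add: cls_def R_def)
        moreover have "(f (arc z) = f0 (arc z)) = (f x = f0 x)" if "z \<in> cls x" for z
          using that label_joined[OF f f0, of "inner_point x" z] by (simp add: arc_inner_point[OF x] cls_def R_def)
        ultimately have "(\<exists>z\<in>cls x. f (arc z) = f0 (arc z)) = (f x = f0 x)" by blast
        moreover have "cls x \<in> Q" using x Q by blast
        ultimately have "h (cls x) = (f x = f0 x)" by (simp add: h_def)
        then show ?thesis using x by (auto simp: \<Phi>_def)
      qed
      moreover have "f \<in> extensional marks" using f by (auto simp: labellings_off_def PiE_def)
      moreover have "\<Phi> h \<in> extensional marks" by (simp add: \<Phi>_def)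
      ultimately have "f = \<Phi> h" by (auto intro: extensionalityI)
      moreover have "h \<in> Q \<rightarrow>\<^sub>E UNIV" by (simp add: h_def)
      ultimately show "f \<in> \<Phi> ` (Q \<rightarrow>\<^sub>E UNIV)" by blast
    qed
  qed
  then have "card (labellings S) = card (Q \<rightarrow>\<^sub>E (UNIV :: bool set))"
    by (simp add: bij_betw_same_card)
  also have "\<dots> = 2 ^ card Q" using finite_marks Q by (simp add: card_funcsetE)
  finally show ?thesis by (simp add: num_circles_def Q_def R_def)
qed

end

section \<open>Linking numbers\<close>

text \<open>The over-strand comes first. For \<open>i = j\<close> pairs \<open>(s, s)\<close> also
  occur, so the pairs correspond to crossings only for distinct components.\<close>

definition crossing_pairs :: "wdiagram \<Rightarrow> nat \<Rightarrow> nat \<Rightarrow> (real \<times> real) set" where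
  "crossing_pairs L i j = {(s, t). 0 \<le> s \<and> s < 1 \<and> 0 \<le> t \<and> t < 1 \<and> curve L i s = curve L j t \<and> over_at L i s}"

definition crossing_sign :: "complex \<Rightarrow> complex \<Rightarrow> int" where
  "crossing_sign u v = (if plane_det u v > 0 then 1 else - 1)"

text \<open>This is the asymmetric linking number of virtual knot theory:
  \<open>linking L i j\<close> and \<open>linking L j i\<close> count different crossings and may
  differ.\<close>

definition linking :: "wdiagram \<Rightarrow> nat \<Rightarrow> nat \<Rightarrow> int" where
  "linking L i j = (\<Sum>(s, t)\<in>crossing_pairs L i j. crossing_sign (velocity L (i, s)) (velocity L (j, t)))"

lemma plane_det_scale: "plane_det (complex_of_real c * u) (complex_of_real d * v) = c * d * plane_det u v"
  by (simp add: plane_det_def algebra_simps)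

lemma crossing_sign_scale:
  "c > 0 \<Longrightarrow> d > 0 \<Longrightarrow> crossing_sign (complex_of_real c * u) (complex_of_real d * v) = crossing_sign u v"
  by (simp add: crossing_sign_def plane_det_scale zero_less_mult_iff mult_less_0_iff)

context diagram
begin

lemma curve_has_velocity:
  assumes "i < num_comps L"
  shows "(curve L i has_vector_derivative velocity L (i, t)) (at t)"
proof -
  have "curve L i C1_differentiable_on UNIV"
    using welded assms by (simp add: welded_diagram_def closed_immersion_def)
  then show ?thesis
    by (auto simp: C1_differentiable_on_eq velocity_def vector_derivative_works)
qed

lemma velocity_unique:
  assumes "i < num_comps L" "(curve L i has_vector_derivative v) (at t)"
  shows "velocity L (i, t) = v"
  using assms by (simp add: velocity_def vector_derivative_at)

lemma isCont_curve: "i < num_comps L \<Longrightarrow> isCont (curve L i) t"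
  using curve_has_velocity has_vector_derivative_continuous by blast

lemma over_at_period: "over_at L i (t + 1) = over_at L i t"
  using welded by (simp add: welded_diagram_def)

lemma over_at_add_int: "over_at L i (t + of_int k) = over_at L i t"
proof (induction k rule: int_induct[where k = 0])
  case (step1 k)
  then show ?case using over_at_period[of i "t + of_int k"] by (simp add: add.assoc)
next
  case (step2 k)
  then show ?case using over_at_period[of i "t + of_int (k - 1)"] by (simp add: algebra_simps)
qed simp

lemma over_at_frac: "over_at L i (frac t) = over_at L i t"
  using over_at_add_int[of i "frac t" "floor t"] by (simp add: frac_def)

lemma velocity_frac:
  assumes "i < num_comps L"
  shows "velocity L (i, frac t) = velocity L (i, t)"
proof (rule velocity_unique[OF assms])
  have "((\<lambda>x. x + of_int (floor t)) has_vector_derivative 1) (at (frac t))"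
    by (auto intro!: derivative_eq_intros)
  moreover have "(curve L i has_vector_derivative velocity L (i, t)) (at (frac t + of_int (floor t)))"
    using curve_has_velocity[OF assms, of t] by (simp add: frac_def)
  ultimately have "(curve L i \<circ> (\<lambda>x. x + of_int (floor t)) has_vector_derivative 1 *\<^sub>R velocity L (i, t)) (at (frac t))"
    by (rule vector_diff_chain_at)
  then show "(curve L i has_vector_derivative velocity L (i, t)) (at (frac t))"
    by (simp add: o_def curve_add_int[OF assms])
qed

lemma over_at_classical: "over_at L i t \<Longrightarrow> i < num_comps L \<and> curve L i t \<in> classical L"
  using welded by (simp add: welded_diagram_def)

lemma finite_crossing_pairs: "i < num_comps L \<Longrightarrow> j < num_comps L \<Longrightarrow> finite (crossing_pairs L i j)"
proof (rule finite_subset)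
  assume "i < num_comps L" "j < num_comps L"
  then show "crossing_pairs L i j \<subseteq> snd ` classical_branches \<times> snd ` classical_branches"
    using over_at_classical by (force simp: crossing_pairs_def classical_branches_def image_iff)
qed (simp add: finite_classical_branches)

lemma transverse:
  assumes "i < num_comps L" "j < num_comps L" "i \<noteq> j" "curve L i s = curve L j t"
  shows "plane_det (velocity L (i, s)) (velocity L (j, t)) \<noteq> 0"
proof -
  have "(i, frac s) \<in> branches L (curve L i s)" "(j, frac t) \<in> branches L (curve L i s)"
    using assms by (auto simp: branches_def curve_frac frac_lt_1)
  then have "plane_det (velocity L (i, frac s)) (velocity L (j, frac t)) \<noteq> 0"
    using welded assms(3) unfolding welded_diagram_def by (metis Pair_inject)
  then show ?thesis by (simp add: velocity_frac assms)
qed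

end

lemma diagramI: "welded_diagram L \<Longrightarrow> diagram L"
  by (simp add: diagram_def)

subsection \<open>Planar isotopy\<close>

text \<open>The factor \<open>plane_det (A 1) (A \<i>)\<close> is the determinant of
  \<open>A\<close> in the basis \<open>1\<close>, \<open>\<i>\<close> of the plane.\<close>

lemma plane_det_linear:
  assumes "linear A"
  shows "plane_det (A u) (A v) = plane_det (A 1) (A \<i>) * plane_det u v"
proof -
  have "A w = of_real (Re w) * A 1 + of_real (Im w) * A \<i>" for w
  proof -
    have "w = Re w *\<^sub>R 1 + Im w *\<^sub>R \<i>" by (simp add: complex_eq_iff)
    then have "A w = A (Re w *\<^sub>R 1 + Im w *\<^sub>R \<i>)" by simp
    also have "\<dots> = Re w *\<^sub>R A 1 + Im w *\<^sub>R A \<i>"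
      using assms by (simp add: linear_add linear_scale)
    finally show ?thesis by (simp add: scaleR_conv_of_real)
  qed
  then have "plane_det (A u) (A v) = plane_det (of_real (Re u) * A 1 + of_real (Im u) * A \<i>) (of_real (Re v) * A 1 + of_real (Im v) * A \<i>)"
    by metis
  also have "\<dots> = plane_det (A 1) (A \<i>) * plane_det u v"
    by (simp add: plane_det_def algebra_simps)
  finally show ?thesis .
qed

lemma plane_det_eq_0: "plane_det u v = 0 \<Longrightarrow> \<exists>c d. (c, d) \<noteq> (0, 0) \<and> c *\<^sub>R u + d *\<^sub>R v = 0"
proof -
  assume d: "plane_det u v = 0"
  show ?thesis
  proof (cases "u = 0 \<and> v = 0")
    case True
    then show ?thesis by (intro exI[of _ 1] exI[of _ 0]) auto
  next
    case False
    then consider "Re u \<noteq> 0 \<or> Re v \<noteq> 0" | "Im u \<noteq> 0 \<or> Im v \<noteq> 0" by (auto simp: complex_eq_iff)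
    then show ?thesis
    proof cases
      case 1
      then show ?thesis
        using d by (intro exI[of _ "- Re v"] exI[of _ "Re u"]) (auto simp: complex_eq_iff plane_det_def algebra_simps)
    next
      case 2
      then show ?thesis
        using d by (intro exI[of _ "- Im v"] exI[of _ "Im u"]) (auto simp: complex_eq_iff plane_det_def algebra_simps)
    qed
  qed
qed

text \<open>Along the isotopy the Jacobian determinant at a fixed point \<open>z\<close> is
  continuous, never zero since the derivatives are injective, and equal to \<open>1\<close> at time
  \<open>0\<close>. By the intermediate value theorem it stays positive, so the final map preserves
  orientation.\<close>

lemma ambient_isotopy_derivative:
  assumes "ambient_isotopy H"
  obtains A where "(H 1 has_derivative A) (at z)" "plane_det (A 1) (A \<i>) > 0"
proof -
  obtain D :: "real \<Rightarrow> complex \<Rightarrow> (complex \<Rightarrow>\<^sub>L complex)" where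
    cont: "continuous_on ({0..1} \<times> UNIV) (\<lambda>(s, z). D s z)" and
    D: "\<And>s z. s \<in> {0..1} \<Longrightarrow> (H s has_derivative blinfun_apply (D s z)) (at z) \<and> inj (blinfun_apply (D s z))"
    using assms by (auto simp: ambient_isotopy_def)
  define g where "g s = plane_det (D s z 1) (D s z \<i>)" for s
  have "continuous_on {0..1} (\<lambda>s. D s z)"
    using continuous_on_compose2[OF cont, of "{0..1}" "\<lambda>s. (s, z)"] by (force intro: continuous_intros)
  then have g: "continuous_on {0..1} g"
    unfolding g_def plane_det_def by (intro continuous_intros)
  have nz: "g s \<noteq> 0" if s: "s \<in> {0..1}" for s
  proof
    assume "g s = 0"
    then obtain c d where cd: "(c, d) \<noteq> (0, 0)" "c *\<^sub>R D s z 1 + d *\<^sub>R D s z \<i> = 0"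
      using plane_det_eq_0 g_def by metis
    then have "D s z (c *\<^sub>R 1 + d *\<^sub>R \<i>) = D s z 0"
      by (simp only: blinfun.add_right blinfun.scaleR_right blinfun.zero_right)
    then have "c *\<^sub>R 1 + d *\<^sub>R \<i> = 0" using D[OF s, of z] by (meson injD)
    then show False using cd(1) by (auto simp: complex_eq_iff)
  qed
  have "(H 0 has_derivative id) (at z)"
    using assms by (simp add: ambient_isotopy_def fun_eq_iff[symmetric] id_def)
  then have "blinfun_apply (D 0 z) = id"
    using D[of 0 z] has_derivative_unique by auto
  then have "g 0 > 0" by (simp add: g_def plane_det_def)
  have "g 1 > 0"
  proof (rule ccontr)
    assume "\<not> g 1 > 0"
    then have "\<exists>s\<ge>0. s \<le> 1 \<and> g s = 0"
      using \<open>g 0 > 0\<close> g by (intro IVT2') auto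
    then show False using nz by auto
  qed
  then show ?thesis using that D[of 1 z] by (auto simp: g_def)
qed

text \<open>Injectivity of \<open>H 1\<close> keeps the crossing parameters, and both velocities at
  a crossing are moved by the same linear map of positive determinant.\<close>

lemma linking_isotopic:
  assumes L: "welded_diagram L" "welded_diagram L'" and iso: "planar_isotopic L L'"
    and ij: "i < num_comps L" "j < num_comps L"
  shows "linking L' i j = linking L i j"
proof -
  interpret L: diagram L by (rule diagramI[OF L(1)])
  interpret L': diagram L' by (rule diagramI[OF L(2)])
  obtain H where H: "ambient_isotopy H" and n: "num_comps L' = num_comps L"
    and c: "\<And>i t. i < num_comps L \<Longrightarrow> curve L' i t = H 1 (curve L i t) \<and> over_at L' i t = over_at L i t"
    using iso by (auto simp: planar_isotopic_def)
  have "inj (H 1)" using H by (auto simp: ambient_isotopy_def bij_def)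
  then have pairs: "crossing_pairs L' i j = crossing_pairs L i j"
    using ij by (auto simp: crossing_pairs_def c inj_eq)
  have vel: "velocity L' (i, t) = A (velocity L (i, t))"
    if "i < num_comps L" "(H 1 has_derivative A) (at (curve L i t))" for i t A
  proof (rule L'.velocity_unique)
    have "(H 1 \<circ> curve L i has_derivative A \<circ> (\<lambda>h. h *\<^sub>R velocity L (i, t))) (at t)"
      using L.curve_has_velocity[OF that(1), of t] that(2)
      unfolding has_vector_derivative_def by (rule diff_chain_at)
    moreover have "A \<circ> (\<lambda>h. h *\<^sub>R velocity L (i, t)) = (\<lambda>h. h *\<^sub>R A (velocity L (i, t)))"
      using has_derivative_linear[OF that(2)] by (auto simp: fun_eq_iff linear_scale)
    moreover have "H 1 \<circ> curve L i = curve L' i" using c[OF that(1)] by auto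
    ultimately show "(curve L' i has_vector_derivative A (velocity L (i, t))) (at t)"
      by (simp add: has_vector_derivative_def)
  qed (use n that in simp)
  show ?thesis
    unfolding linking_def pairs
  proof (intro sum.cong refl, clarify)
    fix s t assume st: "(s, t) \<in> crossing_pairs L i j"
    obtain A where A: "(H 1 has_derivative A) (at (curve L i s))" "plane_det (A 1) (A \<i>) > 0"
      using ambient_isotopy_derivative[OF H] .
    have "curve L i s = curve L j t" using st by (simp add: crossing_pairs_def)
    then have "velocity L' (i, s) = A (velocity L (i, s))" "velocity L' (j, t) = A (velocity L (j, t))"
      using vel ij A(1) by auto
    moreover have "linear A" using A(1) has_derivative_linear by blast
    ultimately show "crossing_sign (velocity L' (i, s)) (velocity L' (j, t)) =
        crossing_sign (velocity L (i, s)) (velocity L (j, t))"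
      using A(2) plane_det_linear[of A "velocity L (i, s)" "velocity L (j, t)"]
      by (simp add: crossing_sign_def zero_less_mult_iff)
  qed
qed

subsection \<open>Change of parametrisation\<close>

text \<open>A strictly increasing continuous map that commutes with the unit shift descends to a
  bijection of the circle, represented here by the half-open unit interval.\<close>

lemma circle_diffeo_bij:
  fixes \<theta> :: "real \<Rightarrow> real"
  assumes C1: "\<theta> C1_differentiable_on UNIV" and \<theta>: "\<And>t. \<theta> (t + 1) = \<theta> t + 1 \<and> deriv \<theta> t > 0"
  shows "bij_betw (\<lambda>s. frac (\<theta> s)) {0..<1} {0..<1}"
proof -
  have der: "(\<theta> has_real_derivative deriv \<theta> t) (at t)" for t
    using C1 by (simp add: C1_differentiable_on_eq DERIV_deriv_iff_real_differentiable)
  have mono: "\<theta> s < \<theta> t" if "s < t" for s t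
    using DERIV_pos_imp_increasing[OF that] der \<theta> by blast
  have \<theta>_int: "\<theta> (t + of_int k) = \<theta> t + of_int k" for t k
  proof (induction k rule: int_induct[where k = 0])
    case (step1 k)
    then show ?case using \<theta>[of "t + of_int k"] by (simp add: add.assoc)
  next
    case (step2 k)
    then show ?case using \<theta>[of "t + of_int (k - 1)"] by (simp add: algebra_simps)
  qed simp
  have "inj_on (\<lambda>s. frac (\<theta> s)) {0..<1}"
  proof (rule inj_onI)
    fix s t assume st: "s \<in> {0..<1}" "t \<in> {0..<1}" "frac (\<theta> s) = frac (\<theta> t)"
    then obtain k where "\<theta> s = \<theta> t + of_int k"
      unfolding frac_def by (intro that[of "floor (\<theta> s) - floor (\<theta> t)"]) simp
    then have "\<theta> s = \<theta> (t + of_int k)" by (simp add: \<theta>_int)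
    then have eq: "s = t + of_int k" by (metis mono linorder_neqE_linordered_idom less_irrefl)
    then have "k = 0" using st by auto
    then show "s = t" using eq by simp
  qed
  moreover have "y \<in> (\<lambda>s. frac (\<theta> s)) ` {0..<1}" if y: "y \<in> {0..<1}" for y
  proof -
    \<comment> \<open>With this \<open>k\<close> the value \<open>y\<close> lies between the values
      of \<open>\<theta>\<close> at \<open>k\<close> and \<open>k + 1\<close>.\<close>
    define k where "k = floor (y - \<theta> 0)"
    have "of_int k \<le> y - \<theta> 0" "y - \<theta> 0 \<le> of_int k + 1" unfolding k_def by linarith+
    then have "\<theta> (of_int k) \<le> y" "y \<le> \<theta> (of_int (k + 1))"
      using \<theta>_int[of 0 k] \<theta>_int[of 0 "k + 1"] by simp_all
    moreover have "continuous_on {of_int k..of_int (k + 1)} \<theta>"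
      using der by (meson DERIV_isCont continuous_at_imp_continuous_on)
    ultimately obtain x where x: "\<theta> x = y"
      using IVT'[of \<theta> "of_int k" y "of_int (k + 1)"] by auto
    have "\<theta> (frac x) = y + of_int (- floor x)"
      using \<theta>_int[of x "- floor x"] x by (simp add: frac_def)
    then have "frac (\<theta> (frac x)) = frac y" by (simp add: frac_def)
    then have "frac (\<theta> (frac x)) = y" using y by (simp add: frac_eq)
    then show ?thesis using frac_lt_1[of x] by (intro image_eqI[of _ _ "frac x"]) auto
  qed
  moreover have "(\<lambda>s. frac (\<theta> s)) ` {0..<1} \<subseteq> {0..<1}" by (auto simp: frac_lt_1)
  ultimately show ?thesis unfolding bij_betw_def by blast
qed

text \<open>Reparametrisation multiplies velocities by positive factors, which leaves the signs
  alone; \<open>\<pi>\<close> only renames the components.\<close>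

lemma linking_reparametrised:
  assumes L: "welded_diagram L" "welded_diagram L'" and re: "reparametrised L L'"
  obtains \<pi> where "\<pi> permutes {..<num_comps L}"
    "\<And>i j. i < num_comps L \<Longrightarrow> j < num_comps L \<Longrightarrow> linking L' i j = linking L (\<pi> i) (\<pi> j)"
proof -
  interpret L: diagram L by (rule diagramI[OF L(1)])
  interpret L': diagram L' by (rule diagramI[OF L(2)])
  obtain \<pi> \<theta> where \<pi>: "\<pi> permutes {..<num_comps L}" and n: "num_comps L' = num_comps L"
    and \<theta>: "\<And>i. \<theta> i C1_differentiable_on UNIV" "\<And>i t. \<theta> i (t + 1) = \<theta> i t + 1 \<and> deriv (\<theta> i) t > 0"
    and c: "\<And>i t. i < num_comps L \<Longrightarrow>
      curve L' i t = curve L (\<pi> i) (\<theta> i t) \<and> over_at L' i t = over_at L (\<pi> i) (\<theta> i t)"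
    using re unfolding reparametrised_def by metis
  have \<pi>n: "\<pi> i < num_comps L" if "i < num_comps L" for i
    using permutes_in_image[OF \<pi>, of i] that by simp
  have vel: "velocity L' (i, t) = complex_of_real (deriv (\<theta> i) t) * velocity L (\<pi> i, frac (\<theta> i t))"
    if i: "i < num_comps L" for i t
  proof (rule L'.velocity_unique)
    have "(\<theta> i has_vector_derivative deriv (\<theta> i) t) (at t)"
      using \<theta>(1)[of i] by (simp add: C1_differentiable_on_eq DERIV_deriv_iff_real_differentiable
          has_real_derivative_iff_has_vector_derivative[symmetric])
    from vector_diff_chain_at[OF this L.curve_has_velocity[OF \<pi>n[OF i]]]
    show "(curve L' i has_vector_derivative complex_of_real (deriv (\<theta> i) t) * velocity L (\<pi> i, frac (\<theta> i t))) (at t)"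
      unfolding ext[OF c[OF i, THEN conjunct1]] by (simp add: o_def scaleR_conv_of_real L.velocity_frac[OF \<pi>n[OF i]])
  qed (use n i in simp)
  have "linking L' i j = linking L (\<pi> i) (\<pi> j)" if ij: "i < num_comps L" "j < num_comps L" for i j
  proof -
    define f where "f = (\<lambda>(s, t). (frac (\<theta> i s), frac (\<theta> j t)))"
    have bi: "bij_betw (\<lambda>s. frac (\<theta> i s)) {0..<1} {0..<1}" and bj: "bij_betw (\<lambda>s. frac (\<theta> j s)) {0..<1} {0..<1}"
      using circle_diffeo_bij \<theta> by blast+
    have mem: "f (s, t) \<in> crossing_pairs L (\<pi> i) (\<pi> j) \<longleftrightarrow> (s, t) \<in> crossing_pairs L' i j"
      if "s \<in> {0..<1}" "t \<in> {0..<1}" for s t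
      using that ij by (auto simp: f_def crossing_pairs_def c L.curve_frac \<pi>n L.over_at_frac frac_lt_1)
    have sub: "crossing_pairs L' i j \<subseteq> {0..<1} \<times> {0..<1}" "crossing_pairs L (\<pi> i) (\<pi> j) \<subseteq> {0..<1} \<times> {0..<1}"
      by (auto simp: crossing_pairs_def)
    have "bij_betw f (crossing_pairs L' i j) (crossing_pairs L (\<pi> i) (\<pi> j))"
      unfolding bij_betw_def
    proof (intro conjI subset_antisym)
      show "inj_on f (crossing_pairs L' i j)"
      proof (rule inj_onI, clarify)
        fix s t s' t' assume "(s, t) \<in> crossing_pairs L' i j" "(s', t') \<in> crossing_pairs L' i j"
          and eq: "f (s, t) = f (s', t')"
        then have "s \<in> {0..<1}" "t \<in> {0..<1}" "s' \<in> {0..<1}" "t' \<in> {0..<1}" using sub(1) by blast+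
        then show "s = s' \<and> t = t'"
          using eq inj_onD[OF bij_betw_imp_inj_on[OF bi], of s s'] inj_onD[OF bij_betw_imp_inj_on[OF bj], of t t']
          by (simp add: f_def)
      qed
      show "f ` crossing_pairs L' i j \<subseteq> crossing_pairs L (\<pi> i) (\<pi> j)"
      proof (rule image_subsetI, unfold split_paired_all)
        fix s t assume st: "(s, t) \<in> crossing_pairs L' i j"
        then have "s \<in> {0..<1}" "t \<in> {0..<1}" using sub(1) by blast+
        then show "f (s, t) \<in> crossing_pairs L (\<pi> i) (\<pi> j)" using mem st by blast
      qed
      show "crossing_pairs L (\<pi> i) (\<pi> j) \<subseteq> f ` crossing_pairs L' i j"
      proof clarify
        fix s' t' assume st': "(s', t') \<in> crossing_pairs L (\<pi> i) (\<pi> j)"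
        then have "s' \<in> {0..<1}" "t' \<in> {0..<1}" using sub(2) by auto
        then obtain s t where st: "s \<in> {0..<1}" "t \<in> {0..<1}" "s' = frac (\<theta> i s)" "t' = frac (\<theta> j t)"
          using bi bj unfolding bij_betw_def by blast
        then have "(s', t') = f (s, t)" by (simp add: f_def)
        then show "(s', t') \<in> f ` crossing_pairs L' i j" using mem[OF st(1,2)] st' by auto
      qed
    qed
    then have "linking L (\<pi> i) (\<pi> j) = (\<Sum>x\<in>crossing_pairs L' i j. case f x of (s, t) \<Rightarrow>
        crossing_sign (velocity L (\<pi> i, s)) (velocity L (\<pi> j, t)))"
      unfolding linking_def by (rule sum.reindex_bij_betw[symmetric])
    also have "\<dots> = linking L' i j"
      unfolding linking_def
      using ij \<theta>(2) by (intro sum.cong refl) (auto simp: f_def vel crossing_sign_scale)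
    finally show ?thesis by simp
  qed
  then show ?thesis using that \<pi> by blast
qed

subsection \<open>Local moves\<close>

text \<open>
  In each triangle move the second picture is the first one rotated by \<open>\<pi>\<close> with all strands
  reversed, and the second picture of R2 is its own mirror image in the real axis with both strands
  reversed. Rotation preserves the signs of the crossings, and reflection reverses them; so no
  crossing needs to be computed.
\<close>

definition rotated :: "tangle \<Rightarrow> tangle \<Rightarrow> bool" where
  "rotated T T' \<longleftrightarrow> num_strands T' = num_strands T \<and> (\<forall>j<num_strands T. \<forall>u.
     strand T' j u = - strand T j (- u) \<and> ((j, u) \<in> tover T' \<longleftrightarrow> (j, - u) \<in> tover T))"

definition mirrored :: "tangle \<Rightarrow> bool" where
  "mirrored T \<longleftrightarrow> (\<forall>j<num_strands T. \<forall>u.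
     strand T j u = cnj (strand T j (- u)) \<and> ((j, u) \<in> tover T \<longleftrightarrow> (j, - u) \<in> tover T))"

text \<open>Strand \<open>j\<close> passes over strand \<open>k\<close>. A self-crossing of one
  strand joins a component to itself and is left out, so kinks contribute nothing; virtual crossings
  are excluded by \<open>tover\<close>.\<close>

definition crossing_params :: "tangle \<Rightarrow> (nat \<times> real \<times> nat \<times> real) set" where
  "crossing_params T = {(j, u, k, v). j < num_strands T \<and> k < num_strands T \<and> j \<noteq> k \<and>
     u \<in> {-1..1} \<and> v \<in> {-1..1} \<and> (j, u) \<in> tover T \<and> strand T j u = strand T k v}"

text \<open>Away from the ends of the strands the picture determines the velocities, and inside the
  square \<open>contains_tangle\<close> identifies the strand through a point uniquely.\<close>

definition interior_crossings :: "tangle \<Rightarrow> bool" where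
  "interior_crossings T \<longleftrightarrow> (\<forall>(j, u, k, v)\<in>crossing_params T.
     u \<in> {-1<..<1} \<and> v \<in> {-1<..<1} \<and> strand T j u \<in> square)"

lemma num_strands_mk [simp]: "num_strands (mk_tangle cs V U) = length cs"
  and strand_mk [simp]: "strand (mk_tangle cs V U) j = cs ! j"
  and tover_mk [simp]: "tover (mk_tangle cs V U) = U"
  by (simp_all add: mk_tangle_def)

lemma mem_square: "z \<in> square \<longleftrightarrow> \<bar>Re z\<bar> \<le> 1 \<and> \<bar>Im z\<bar> \<le> 1"
  by (auto simp: square_def in_cbox_complex_iff)

lemma one_minus_square: "u \<in> {-1..1} \<Longrightarrow> 0 \<le> (1 - u\<^sup>2 :: real) \<and> (1 - u\<^sup>2)\<^sup>2 \<le> 1"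
  using abs_square_le_1[of u] by (auto simp: abs_le_iff power_le_one)

lemma interior_triangle:
  assumes "\<sigma> \<in> {1, -1}" and U: "\<And>j u. (j, u) \<in> U \<Longrightarrow> u \<in> {-1<..<1}"
  shows "interior_crossings (triangle \<sigma> V U)"
proof -
  have str: "Re (strand (triangle \<sigma> V U) j u) = u" "\<bar>Im (strand (triangle \<sigma> V U) j u)\<bar> \<le> 1"
    if "j < 3" "u \<in> {-1..1}" for j u
  proof -
    have "j = 0 \<or> j = 1 \<or> j = 2" using that by auto
    then show "Re (strand (triangle \<sigma> V U) j u) = u" "\<bar>Im (strand (triangle \<sigma> V U) j u)\<bar> \<le> 1"
      using that assms(1) one_minus_square[OF that(2)]
      by (auto simp: triangle_def diag_up_def diag_down_def across_def abs_mult)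
  qed
  show ?thesis
    unfolding interior_crossings_def
  proof clarify
    fix j u k v assume c: "(j, u, k, v) \<in> crossing_params (triangle \<sigma> V U)"
    then have *: "j < 3" "k < 3" "u \<in> {-1..1}" "v \<in> {-1..1}" "(j, u) \<in> U"
      "strand (triangle \<sigma> V U) j u = strand (triangle \<sigma> V U) k v"
      by (auto simp: crossing_params_def triangle_def)
    \<comment> \<open>All strands of a triangle are graphs over the real axis with the parameter as
      abscissa, so they meet only at equal parameters.\<close>
    then have "v = u" using str(1)[of j u] str(1)[of k v] by simp
    then show "u \<in> {-1<..<1} \<and> v \<in> {-1<..<1} \<and> strand (triangle \<sigma> V U) j u \<in> square"
      using U[OF *(5)] str[OF *(1,3)] *(3) by (auto simp: mem_square)
  qed
qed

lemma rotated_triangle: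
  assumes "\<And>j u. j < 3 \<Longrightarrow> (j, u) \<in> U' \<longleftrightarrow> (j, - u) \<in> U"
  shows "rotated (triangle 1 V U) (triangle (-1) V' U')"
proof -
  have "strand (triangle (-1) V' U') j u = - strand (triangle 1 V U) j (- u)" if "j < 3" for j u
  proof -
    have "j = 0 \<or> j = 1 \<or> j = 2" using that by auto
    then show ?thesis
      by (auto simp: triangle_def diag_up_def diag_down_def across_def complex_eq_iff)
  qed
  then show ?thesis using assms by (auto simp: rotated_def triangle_def)
qed

lemma interior_bigon:
  assumes U: "\<And>j u. (j, u) \<in> U \<Longrightarrow> u \<in> {-1<..<1}"
  shows "interior_crossings (mk_tangle [bigon_left2, bigon_right2] V U)"
proof -
  let ?T = "mk_tangle [bigon_left2, bigon_right2] V U"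
  have str: "Im (strand ?T j u) = u" "\<bar>Re (strand ?T j u)\<bar> \<le> 1" if "j < 2" "u \<in> {-1..1}" for j u
  proof -
    define y where "y = (1 - u\<^sup>2)\<^sup>2"
    have y: "0 \<le> y" "y \<le> 1" using one_minus_square[OF that(2)] by (simp_all add: y_def)
    have "j = 0 \<or> j = 1" using that by auto
    then show "Im (strand ?T j u) = u" "\<bar>Re (strand ?T j u)\<bar> \<le> 1"
      using y by (auto simp: bigon_left2_def bigon_right2_def y_def[symmetric] abs_le_iff)
  qed
  show ?thesis
    unfolding interior_crossings_def
  proof clarify
    fix j u k v assume c: "(j, u, k, v) \<in> crossing_params ?T"
    then have *: "j < 2" "k < 2" "u \<in> {-1..1}" "v \<in> {-1..1}" "(j, u) \<in> U" "strand ?T j u = strand ?T k v"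
      by (auto simp: crossing_params_def)
    then have "v = u" using str(1)[of j u] str(1)[of k v] by simp
    then show "u \<in> {-1<..<1} \<and> v \<in> {-1<..<1} \<and> strand ?T j u \<in> square"
      using U[OF *(5)] str[OF *(1,3)] *(3) by (auto simp: mem_square)
  qed
qed

lemma mirrored_bigon:
  assumes "\<And>j u. (j, u) \<in> U \<longleftrightarrow> (j, - u) \<in> U"
  shows "mirrored (mk_tangle [bigon_left2, bigon_right2] V U)"
proof -
  let ?T = "mk_tangle [bigon_left2, bigon_right2] V U"
  have "strand ?T j u = cnj (strand ?T j (- u))" if "j < length [bigon_left2, bigon_right2]" for j u
  proof -
    have "j = 0 \<or> j = 1" using that by auto
    then show ?thesis by (auto simp: bigon_left2_def bigon_right2_def complex_eq_iff)
  qed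
  then show ?thesis using assms unfolding mirrored_def num_strands_mk tover_mk by blast
qed

text \<open>R1 has a single strand, and in V1, V2 and V3 no strand is over. The two sides of R3, M
  and F1 are related by the rotation. For R2 one side has no crossing, and the other is symmetric
  under the reflection, which makes its signs cancel.\<close>

lemma basic_move_symmetric:
  assumes "basic_move T T'"
  shows "interior_crossings T \<and> interior_crossings T' \<and>
    (crossing_params T = {} \<and> crossing_params T' = {} \<or> rotated T T' \<or>
     crossing_params T = {} \<and> mirrored T')"
  using assms
proof cases
  case (R1 s)
  then show ?thesis by (auto simp: interior_crossings_def crossing_params_def)
next
  case V1
  then show ?thesis by (auto simp: interior_crossings_def crossing_params_def)
next
  case (R2 j)
  have "crossing_params T = {}" by (auto simp: R2 crossing_params_def)
  moreover have "mirrored T'" unfolding R2 by (rule mirrored_bigon) auto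
  moreover have "interior_crossings T'" unfolding R2 by (rule interior_bigon) auto
  ultimately show ?thesis by (auto simp: interior_crossings_def)
next
  case V2
  then show ?thesis by (auto simp: interior_crossings_def crossing_params_def)
next
  case (R3 h)
  have "rotated T T'"
    unfolding R3 by (rule rotated_triangle) (auto simp: layered_def split: if_splits)
  moreover have "interior_crossings T" "interior_crossings T'"
    unfolding R3 by (rule interior_triangle; auto simp: layered_def split: if_splits)+
  ultimately show ?thesis by blast
next
  case V3
  then show ?thesis by (auto simp: interior_crossings_def crossing_params_def triangle_def)
next
  case (M j)
  have "rotated T T'" unfolding M by (rule rotated_triangle) auto
  moreover have "interior_crossings T" "interior_crossings T'"
    unfolding M by (rule interior_triangle; auto)+
  ultimately show ?thesis by blast
next
  case F1
  have "rotated T T'" unfolding F1 by (rule rotated_triangle) auto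
  moreover have "interior_crossings T" "interior_crossings T'"
    unfolding F1 by (rule interior_triangle; auto)+
  ultimately show ?thesis by blast
qed

lemma crossing_params_reverse:
  "(j, u, k, v) \<in> crossing_params (reverse_strands J T) \<longleftrightarrow>
   (j, if j \<in> J then - u else u, k, if k \<in> J then - v else v) \<in> crossing_params T"
  by (auto simp: crossing_params_def reverse_strands_def)

lemma crossing_params_reverse_empty:
  "crossing_params T = {} \<Longrightarrow> crossing_params (reverse_strands J T) = {}"
proof (rule equals0I)
  fix x assume "crossing_params T = {}" "x \<in> crossing_params (reverse_strands J T)"
  then show False using crossing_params_reverse[of _ _ _ _ J T] by (cases x) simp
qed

lemma interior_reverse:
  assumes "interior_crossings T"
  shows "interior_crossings (reverse_strands J T)"
  unfolding interior_crossings_def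
proof clarify
  fix j u k v assume "(j, u, k, v) \<in> crossing_params (reverse_strands J T)"
  then have "(j, if j \<in> J then - u else u, k, if k \<in> J then - v else v) \<in> crossing_params T"
    by (simp only: crossing_params_reverse)
  then show "u \<in> {-1<..<1} \<and> v \<in> {-1<..<1} \<and> strand (reverse_strands J T) j u \<in> square"
    using assms unfolding interior_crossings_def
    by (fastforce simp: reverse_strands_def split: if_splits)
qed

text \<open>Reversing a strand commutes with replacing \<open>u\<close> by \<open>- u\<close>, so
  the symmetry holds for every choice of orientations.\<close>

lemma rotated_reverse: "rotated T T' \<Longrightarrow> rotated (reverse_strands J T) (reverse_strands J T')"
  unfolding rotated_def by (simp add: reverse_strands_def)

lemma mirrored_reverse:
  assumes "mirrored T"
  shows "mirrored (reverse_strands J T)"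
  unfolding mirrored_def
proof (intro allI impI)
  fix j u assume "j < num_strands (reverse_strands J T)"
  then have "j < num_strands T" by (simp add: reverse_strands_def)
  then have "\<And>u. strand T j u = cnj (strand T j (- u)) \<and> ((j, u) \<in> tover T \<longleftrightarrow> (j, - u) \<in> tover T)"
    using assms unfolding mirrored_def by blast
  from this[of u] this[of "- u"] show "strand (reverse_strands J T) j u = cnj (strand (reverse_strands J T) j (- u)) \<and>
      ((j, u) \<in> tover (reverse_strands J T) \<longleftrightarrow> (j, - u) \<in> tover (reverse_strands J T))"
    by (simp add: reverse_strands_def)
qed

section \<open>Tangles inside a diagram\<close>

definition strand_param :: "nat \<times> real \<times> real \<Rightarrow> real \<Rightarrow> real" where
  "strand_param l u = (case l of (i, a, b) \<Rightarrow> (a + b) / 2 + u * ((b - a) / 2))"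

text \<open>Running backwards contributes the minus sign. For the rotation \<open>A\<close> is
  itself negation, and the velocity is unchanged; for the reflection both velocities at a crossing
  become negated conjugates, which negates their determinant.\<close>

lemma velocity_reflected:
  assumes L: "welded_diagram L" "welded_diagram L'" and i: "i < num_comps L" "i < num_comps L'"
    and A: "bounded_linear A" and x0: "a < x0" "x0 < b"
    and eq: "\<And>x. a < x \<Longrightarrow> x < b \<Longrightarrow> curve L' i x = A (curve L i (a + b - x))"
  shows "velocity L' (i, x0) = - A (velocity L (i, a + b - x0))"
proof -
  interpret L: diagram L by (rule diagramI[OF L(1)])
  interpret L': diagram L' by (rule diagramI[OF L(2)])
  have "((\<lambda>x. a + b - x) has_vector_derivative - 1) (at x0)"
    by (auto intro!: derivative_eq_intros)
  from vector_diff_chain_at[OF this L.curve_has_velocity[OF i(1)]]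
  have "((\<lambda>x. curve L i (a + b - x)) has_vector_derivative - velocity L (i, a + b - x0)) (at x0)"
    by (simp add: o_def)
  from bounded_linear.has_vector_derivative[OF A this]
  have "((\<lambda>x. A (curve L i (a + b - x))) has_vector_derivative - A (velocity L (i, a + b - x0))) (at x0)"
    using linear_neg[OF bounded_linear.linear[OF A]] by simp
  then have "(curve L' i has_vector_derivative - A (velocity L (i, a + b - x0))) (at x0)"
    by (rule has_vector_derivative_transform_within_open[of _ _ _ "{a<..<b}"]) (use x0 eq in auto)
  then show ?thesis by (rule L'.velocity_unique[OF i(2)])
qed

locale tangle_in_diagram = diagram L for L +
  fixes loc :: "nat \<Rightarrow> nat \<times> real \<times> real" and T :: tangle
  assumes contained: "contains_tangle L loc T" and interior: "interior_crossings T"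
begin

abbreviation comp :: "nat \<Rightarrow> nat" where "comp j \<equiv> fst (loc j)"

lemma strand_located:
  assumes "j < num_strands T"
  obtains a b where "loc j = (comp j, a, b)" "comp j < num_comps L" "a < b" "b < a + 1"
proof -
  obtain i a b where l: "loc j = (i, a, b)" by (cases "loc j")
  note c = contained[unfolded contains_tangle_def, THEN conjunct1, THEN spec, THEN mp, OF assms]
  show ?thesis using c that[of a b] unfolding l by simp
qed

lemma strand_at:
  assumes "j < num_strands T" "u \<in> {-1..1}"
  shows "curve L (comp j) (strand_param (loc j) u) = strand T j u"
    and "over_at L (comp j) (strand_param (loc j) u) = ((j, u) \<in> tover T)"
    and "comp j < num_comps L"
proof -
  obtain i a b where l: "loc j = (i, a, b)" by (cases "loc j")
  note c = contained[unfolded contains_tangle_def, THEN conjunct1, THEN spec, THEN mp, OF assms(1), unfolded l prod.case]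
  show "curve L (comp j) (strand_param (loc j) u) = strand T j u"
    "over_at L (comp j) (strand_param (loc j) u) = ((j, u) \<in> tover T)" "comp j < num_comps L"
    using c assms(2) unfolding l strand_param_def by (simp_all only: prod.case fst_conv)
qed

lemma unique_strand:
  assumes "i < num_comps L" "curve L i t \<in> square"
  shows "\<exists>!j. j < num_strands T \<and>
     (case loc j of (i', a, b) \<Rightarrow> i' = i \<and> (\<exists>m::int. a \<le> t + m \<and> t + m \<le> b))"
  by (rule contained[unfolded contains_tangle_def, THEN conjunct2, THEN conjunct1,
        THEN spec, THEN mp, OF assms(1), THEN spec, THEN mp, OF assms(2)])

text \<open>The uniqueness clause of \<open>contains_tangle\<close> makes the two strands equal.
  Then both parameters lie in one interval shorter than a period, where equality modulo
  \<open>1\<close> is equality.\<close>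

lemma strand_param_inj:
  assumes j: "j < num_strands T" "j' < num_strands T" and comp: "comp j = comp j'"
    and u: "u \<in> {-1..1}" "u' \<in> {-1..1}"
    and frac: "frac (strand_param (loc j) u) = frac (strand_param (loc j') u')"
    and square: "strand T j u \<in> square"
  shows "j = j' \<and> u = u'"
proof -
  obtain a b where l: "loc j = (comp j, a, b)" "comp j < num_comps L" "a < b" "b < a + 1"
    by (rule strand_located[OF j(1)])
  obtain a' b' where l': "loc j' = (comp j', a', b')" "comp j' < num_comps L" "a' < b'" "b' < a' + 1"
    by (rule strand_located[OF j(2)])
  define t where "t = strand_param (loc j) u"
  define t' where "t' = strand_param (loc j') u'"
  have t: "t = (a + b) / 2 + u * ((b - a) / 2)" unfolding t_def by (subst l(1)) (simp add: strand_param_def)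
  have t': "t' = (a' + b') / 2 + u' * ((b' - a') / 2)" unfolding t'_def by (subst l'(1)) (simp add: strand_param_def)
  have bound: "a \<le> t \<and> t \<le> b" if "t = (a + b) / 2 + u * ((b - a) / 2)" "a < b" "u \<in> {-1..1}" for a b t u :: real
  proof -
    have "u * ((b - a) / 2) \<le> 1 * ((b - a) / 2)" "(-1) * ((b - a) / 2) \<le> u * ((b - a) / 2)"
      using that by (intro mult_right_mono; simp)+
    then show ?thesis using that by (simp add: field_simps)
  qed
  have ab: "a \<le> t" "t \<le> b" using bound[OF t l(3) u(1)] by auto
  have ab': "a' \<le> t'" "t' \<le> b'" using bound[OF t' l'(3) u(2)] by auto
  obtain k where k: "t' = t + of_int k"
    using frac unfolding t_def[symmetric] t'_def[symmetric] frac_def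
    by (intro that[of "floor t' - floor t"]) simp
  have "curve L (comp j) t \<in> square" using strand_at(1)[OF j(1) u(1)] square by (simp add: t_def)
  define P where "P x \<longleftrightarrow> x < num_strands T \<and>
     (case loc x of (i', a, b) \<Rightarrow> i' = comp j \<and> (\<exists>m::int. a \<le> t + m \<and> t + m \<le> b))" for x
  have uniq: "\<exists>!x. P x"
    using unique_strand[OF l(2) \<open>curve L (comp j) t \<in> square\<close>] by (simp only: P_def)
  have "P j"
    using ab j(1) unfolding P_def by (subst l(1)) (auto intro!: exI[of _ 0])
  moreover have "P j'"
    using ab' k comp j(2) unfolding P_def by (subst l'(1)) auto
  ultimately have jj: "j = j'" using uniq by blast
  have "snd (loc j) = (a, b)" "snd (loc j') = (a', b')" by (subst l(1), simp) (subst l'(1), simp)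
  then have "a' = a" "b' = b" using jj by simp_all
  then have "k = 0" using ab ab' k l(4) by auto
  then have "u * ((b - a) / 2) = u' * ((b - a) / 2)" using k t t' \<open>a' = a\<close> \<open>b' = b\<close> by auto
  then show ?thesis using jj l(3) by simp
qed

lemma strand_param_surj:
  assumes "i < num_comps L" "curve L i t \<in> square" "0 \<le> t" "t < 1"
  obtains j u where "j < num_strands T" "comp j = i" "u \<in> {-1..1}" "frac (strand_param (loc j) u) = t"
proof -
  obtain j a b and m :: int where j: "j < num_strands T" "loc j = (i, a, b)" "a \<le> t + m" "t + m \<le> b"
  proof -
    obtain j where j: "j < num_strands T \<and>
        (case loc j of (i', a, b) \<Rightarrow> i' = i \<and> (\<exists>m::int. a \<le> t + m \<and> t + m \<le> b))"
      using ex1_implies_ex[OF unique_strand[OF assms(1,2)]] ..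
    obtain i' a b where l: "loc j = (i', a, b)" by (cases "loc j")
    have "i' = i" "\<exists>m::int. a \<le> t + m \<and> t + m \<le> b" using j unfolding l by simp_all
    then show ?thesis using that[of j a b] j l by auto
  qed
  have ab: "a < b" by (rule strand_located[OF j(1)]) (use j(2) in auto)
  define u where "u = (t + m - (a + b) / 2) / ((b - a) / 2)"
  have "u \<in> {-1..1}" using ab j(3,4) by (auto simp: u_def field_simps)
  moreover have "(b - a) / 2 \<noteq> 0" using ab by simp
  from iffD1[OF nonzero_eq_divide_eq[OF this] u_def]
  have "strand_param (loc j) u = t + of_int m"
    unfolding strand_param_def j(2) prod.case by linarith
  then have "frac (strand_param (loc j) u) = t" using assms(3,4) by (simp add: frac_add_int frac_eq)
  ultimately show ?thesis using that[of j u] j by simp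
qed

definition crossing_params_between :: "nat \<Rightarrow> nat \<Rightarrow> (nat \<times> real \<times> nat \<times> real) set" where
  "crossing_params_between i i' = {(j, u, k, v) \<in> crossing_params T. comp j = i \<and> comp k = i'}"

definition to_pair :: "nat \<times> real \<times> nat \<times> real \<Rightarrow> real \<times> real" where
  "to_pair = (\<lambda>(j, u, k, v). (frac (strand_param (loc j) u), frac (strand_param (loc k) v)))"

text \<open>The crossings of \<open>i\<close> over \<open>i'\<close> inside the square are those of
  the picture between strands of these components; since the components differ, so do the strands,
  as \<open>crossing_params\<close> demands.\<close>

lemma bij_to_pair:
  assumes i: "i < num_comps L" "i' < num_comps L" "i \<noteq> i'"
  shows "bij_betw to_pair (crossing_params_between i i') {(s, t) \<in> crossing_pairs L i i'. curve L i s \<in> square}"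
  unfolding bij_betw_def
proof (intro conjI subset_antisym)
  have crossing: "j < num_strands T" "k < num_strands T" "u \<in> {-1..1}" "v \<in> {-1..1}" "(j, u) \<in> tover T"
      "strand T j u = strand T k v" "strand T j u \<in> square" "comp j = i" "comp k = i'"
    if "(j, u, k, v) \<in> crossing_params_between i i'" for j u k v
    using that interior unfolding crossing_params_between_def crossing_params_def interior_crossings_def by auto
  show "inj_on to_pair (crossing_params_between i i')"
  proof (rule inj_onI, unfold split_paired_all)
    fix j u k v j' u' k' v'
    assume c: "(j, u, k, v) \<in> crossing_params_between i i'" "(j', u', k', v') \<in> crossing_params_between i i'"
      and eq: "to_pair (j, u, k, v) = to_pair (j', u', k', v')"
    have "j = j' \<and> u = u'"
      using crossing[OF c(1)] crossing[OF c(2)] eq by (intro strand_param_inj) (auto simp: to_pair_def)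
    moreover have "k = k' \<and> v = v'"
      using crossing[OF c(1)] crossing[OF c(2)] eq by (intro strand_param_inj) (auto simp: to_pair_def)
    ultimately show "(j, u, k, v) = (j', u', k', v')" by blast
  qed
  show "to_pair ` crossing_params_between i i' \<subseteq> {(s, t) \<in> crossing_pairs L i i'. curve L i s \<in> square}"
  proof (rule image_subsetI, unfold split_paired_all)
    fix j u k v assume c: "(j, u, k, v) \<in> crossing_params_between i i'"
    note cr = crossing[OF c]
    show "to_pair (j, u, k, v) \<in> {(s, t) \<in> crossing_pairs L i i'. curve L i s \<in> square}"
      using cr i strand_at(1,2)[OF cr(1,3)] strand_at(1)[OF cr(2,4)]
      by (auto simp: to_pair_def crossing_pairs_def curve_frac over_at_frac frac_lt_1)
  qed
  show "{(s, t) \<in> crossing_pairs L i i'. curve L i s \<in> square} \<subseteq> to_pair ` crossing_params_between i i'"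
  proof clarify
    fix s t assume st: "(s, t) \<in> crossing_pairs L i i'" "curve L i s \<in> square"
    then have eq: "curve L i s = curve L i' t" "0 \<le> s" "s < 1" "0 \<le> t" "t < 1" "over_at L i s"
      by (auto simp: crossing_pairs_def)
    obtain j u where j: "j < num_strands T" "comp j = i" "u \<in> {-1..1}" "frac (strand_param (loc j) u) = s"
      using strand_param_surj[OF i(1) st(2) eq(2,3)] .
    obtain k v where k: "k < num_strands T" "comp k = i'" "v \<in> {-1..1}" "frac (strand_param (loc k) v) = t"
      using strand_param_surj[OF i(2) _ eq(4,5)] st(2) eq(1) by metis
    have "strand T j u = curve L i s" "(j, u) \<in> tover T"
      using strand_at(1,2)[OF j(1,3)] j(2,4) eq(6) curve_frac[OF i(1)] over_at_frac by metis+
    moreover have "strand T k v = curve L i' t"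
      using strand_at(1)[OF k(1,3)] k(2,4) curve_frac[OF i(2)] by metis
    ultimately have "(j, u, k, v) \<in> crossing_params_between i i'"
      using j k i(3) eq(1) by (auto simp: crossing_params_between_def crossing_params_def)
    moreover have "to_pair (j, u, k, v) = (s, t)" using j k by (simp add: to_pair_def)
    ultimately show "(s, t) \<in> to_pair ` crossing_params_between i i'" by (metis image_eqI)
  qed
qed

definition sign_at :: "nat \<times> real \<times> nat \<times> real \<Rightarrow> int" where
  "sign_at = (\<lambda>(j, u, k, v). crossing_sign (velocity L (comp j, strand_param (loc j) u))
      (velocity L (comp k, strand_param (loc k) v)))"

lemma linking_inside:
  assumes i: "i < num_comps L" "i' < num_comps L" "i \<noteq> i'"
  shows "(\<Sum>(s, t)\<in>{(s, t) \<in> crossing_pairs L i i'. curve L i s \<in> square}.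
      crossing_sign (velocity L (i, s)) (velocity L (i', t))) = sum sign_at (crossing_params_between i i')"
proof -
  have "(\<Sum>(s, t)\<in>{(s, t) \<in> crossing_pairs L i i'. curve L i s \<in> square}.
      crossing_sign (velocity L (i, s)) (velocity L (i', t))) =
    (\<Sum>x\<in>crossing_params_between i i'. case to_pair x of (s, t) \<Rightarrow>
      crossing_sign (velocity L (i, s)) (velocity L (i', t)))"
    by (rule sum.reindex_bij_betw[OF bij_to_pair[OF i], symmetric])
  also have "\<dots> = sum sign_at (crossing_params_between i i')"
  proof (intro sum.cong refl, unfold split_paired_all)
    fix j u k v assume "(j, u, k, v) \<in> crossing_params_between i i'"
    then have "comp j = i" "comp k = i'" by (simp_all add: crossing_params_between_def)
    then show "(case to_pair (j, u, k, v) of (s, t) \<Rightarrow>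
        crossing_sign (velocity L (i, s)) (velocity L (i', t))) = sign_at (j, u, k, v)"
      using i by (simp add: to_pair_def sign_at_def velocity_frac)
  qed
  finally show ?thesis .
qed

end

section \<open>The contribution of the square to a linking number\<close>

lemma sum_crossing_params_neg:
  fixes f :: "nat \<times> real \<times> nat \<times> real \<Rightarrow> int"
  assumes "\<And>j u k v. (j, u, k, v) \<in> C' \<longleftrightarrow> (j, - u, k, - v) \<in> C"
  shows "sum f C' = (\<Sum>(j, u, k, v)\<in>C. f (j, - u, k, - v))"
proof -
  have "bij_betw (\<lambda>(j, u, k, v). (j, - u, k, - v)) C C'"
    by (rule bij_betw_byWitness[of _ "\<lambda>(j, u, k, v). (j, - u, k, - v)"]) (use assms in force)+
  from sum.reindex_bij_betw[OF this, of f] show ?thesis by (simp add: case_prod_unfold)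
qed

text \<open>On the component, negating \<open>u\<close> is reflection of \<open>[a, b]\<close> in
  its midpoint. As \<open>u\<close> is interior, the relation between the curves holds on an open
  interval around the point and so determines the derivative.\<close>

lemma velocity_strand_reflected:
  assumes "tangle_in_diagram L loc T" "tangle_in_diagram L' loc T'"
    and n: "num_comps L' = num_comps L" "num_strands T' = num_strands T"
    and A: "bounded_linear A" and eq: "\<And>u. strand T' j u = A (strand T j (- u))"
    and j: "j < num_strands T" and u: "u \<in> {-1<..<1}"
  shows "velocity L' (fst (loc j), strand_param (loc j) u) = - A (velocity L (fst (loc j), strand_param (loc j) (- u)))"
proof -
  interpret L: tangle_in_diagram L loc T by fact
  interpret L': tangle_in_diagram L' loc T' by fact
  obtain a b where l: "loc j = (fst (loc j), a, b)" "fst (loc j) < num_comps L" "a < b" "b < a + 1"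
    by (rule L.strand_located[OF j])
  define h where "h = (b - a) / 2"
  have h: "h > 0" "a = (a + b) / 2 - h" "b = (a + b) / 2 + h" using l(3) by (auto simp: h_def field_simps)
  have sp: "strand_param (loc j) w = (a + b) / 2 + w * h" for w
    by (subst l(1)) (simp add: strand_param_def h_def)
  have neg: "a + b - strand_param (loc j) w = strand_param (loc j) (- w)" for w
    by (simp add: sp field_simps)
  have "velocity L' (fst (loc j), strand_param (loc j) u) =
    - A (velocity L (fst (loc j), a + b - strand_param (loc j) u))"
  proof (rule velocity_reflected[OF L.welded L'.welded l(2) _ A, where a = a and b = b])
    have "- h < u * h" "u * h < h" using u h(1) by (auto simp: mult_less_cancel_right2 minus_less_iff[of "h"] ) 
       (use mult_strict_right_mono[of "-1" u h] in auto)
    then show "a < strand_param (loc j) u" "strand_param (loc j) u < b" using h(2,3) unfolding sp by linarith+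
    show "curve L' (fst (loc j)) x = A (curve L (fst (loc j)) (a + b - x))" if x: "a < x" "x < b" for x
    proof -
      define w where "w = (x - (a + b) / 2) / h"
      have xw: "x = strand_param (loc j) w" using h by (simp add: sp w_def)
      have w: "w \<in> {-1..1}" "- w \<in> {-1..1}" using x h by (auto simp: w_def field_simps)
      show ?thesis
        unfolding xw neg using L'.strand_at(1)[of j w] L.strand_at(1)[of j "- w"] w j n eq by simp
    qed
  qed (use n l in simp)
  then show ?thesis by (simp add: neg)
qed

lemma linking_inside_eq:
  assumes L: "tangle_in_diagram L loc T" "tangle_in_diagram L' loc T'"
    and n: "num_comps L' = num_comps L" and i: "i < num_comps L" "i' < num_comps L" "i \<noteq> i'"
    and T: "crossing_params T = {} \<and> crossing_params T' = {} \<or> rotated T T' \<or>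
      crossing_params T = {} \<and> mirrored T'"
  shows "sum (tangle_in_diagram.sign_at L' loc) (tangle_in_diagram.crossing_params_between loc T' i i') =
    sum (tangle_in_diagram.sign_at L loc) (tangle_in_diagram.crossing_params_between loc T i i')"
proof -
  interpret L: tangle_in_diagram L loc T by fact
  interpret L': tangle_in_diagram L' loc T' by fact
  have inter: "j < num_strands T' \<and> k < num_strands T' \<and> u \<in> {-1<..<1} \<and> v \<in> {-1<..<1} \<and> fst (loc j) = i \<and> fst (loc k) = i'
      \<and> strand T' j u = strand T' k v"
    if "(j, u, k, v) \<in> L'.crossing_params_between i i'" for j u k v
    using that L'.interior unfolding L'.crossing_params_between_def crossing_params_def interior_crossings_def by auto
  consider "crossing_params T = {}" "crossing_params T' = {}" | "rotated T T'"
    | "crossing_params T = {}" "mirrored T'" using T by blast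
  then show ?thesis
  proof cases
    case 1
    then have "L.crossing_params_between i i' = {}" "L'.crossing_params_between i i' = {}"
      by (auto simp: L.crossing_params_between_def L'.crossing_params_between_def)
    then show ?thesis by simp
  next
    case 2
    then have nT: "num_strands T' = num_strands T"
      and str: "\<And>j u. j < num_strands T \<Longrightarrow> strand T' j u = - strand T j (- u)"
      and ov: "\<And>j u. j < num_strands T \<Longrightarrow> (j, u) \<in> tover T' \<longleftrightarrow> (j, - u) \<in> tover T"
      by (auto simp: rotated_def)
    \<comment> \<open>The rotation matches the crossings of the two pictures one to one, with
      parameters negated.\<close>
    have "sum L.sign_at (L.crossing_params_between i i') =
      (\<Sum>(j, u, k, v)\<in>L'.crossing_params_between i i'. L.sign_at (j, - u, k, - v))"
    proof (rule sum_crossing_params_neg)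
      show "(j, u, k, v) \<in> L.crossing_params_between i i' \<longleftrightarrow> (j, - u, k, - v) \<in> L'.crossing_params_between i i'" for j u k v
        by (auto simp: L.crossing_params_between_def L'.crossing_params_between_def crossing_params_def nT str ov)
    qed
    also have "\<dots> = sum L'.sign_at (L'.crossing_params_between i i')"
    proof (intro sum.cong refl, clarify)
      fix j u k v assume "(j, u, k, v) \<in> L'.crossing_params_between i i'"
      note c = inter[OF this]
      have "velocity L' (fst (loc j), strand_param (loc j) u) = velocity L (fst (loc j), strand_param (loc j) (- u))"
        "velocity L' (fst (loc k), strand_param (loc k) v) = velocity L (fst (loc k), strand_param (loc k) (- v))"
        using velocity_strand_reflected[OF L n nT bounded_linear_minus[OF bounded_linear_ident] str, of j u]
          velocity_strand_reflected[OF L n nT bounded_linear_minus[OF bounded_linear_ident] str, of k v]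
          c nT by simp_all
      then show "L.sign_at (j, - u, k, - v) = L'.sign_at (j, u, k, v)"
        by (simp add: L.sign_at_def L'.sign_at_def)
    qed
    finally show ?thesis by simp
  next
    case 3
    have str: "strand T' j u = cnj (strand T' j (- u))" and ov: "(j, u) \<in> tover T' \<longleftrightarrow> (j, - u) \<in> tover T'"
      if "j < num_strands T'" for j u
      using 3(2) that unfolding mirrored_def by blast+
    have cc: "strand T' j (- u) = strand T' k (- v) \<longleftrightarrow> strand T' j u = strand T' k v"
      if "j < num_strands T'" "k < num_strands T'" for j k u v
      by (simp only: str[OF that(1), of u] str[OF that(2), of v] complex_cnj_cancel_iff)
    \<comment> \<open>The reflection permutes the crossings of the second picture and reverses every
      sign, so their sum equals its own negative.\<close>
    have "sum L'.sign_at (L'.crossing_params_between i i') =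
      (\<Sum>(j, u, k, v)\<in>L'.crossing_params_between i i'. L'.sign_at (j, - u, k, - v))"
    proof (rule sum_crossing_params_neg)
      show "(j, u, k, v) \<in> L'.crossing_params_between i i' \<longleftrightarrow> (j, - u, k, - v) \<in> L'.crossing_params_between i i'" for j u k v
        using ov[of j u] cc[of j k u v] unfolding L'.crossing_params_between_def crossing_params_def
        by (cases "j < num_strands T' \<and> k < num_strands T'") auto
    qed
    also have "\<dots> = (\<Sum>x\<in>L'.crossing_params_between i i'. - L'.sign_at x)"
    proof (intro sum.cong refl, clarify)
      fix j u k v assume "(j, u, k, v) \<in> L'.crossing_params_between i i'"
      note c = inter[OF this]
      define p q where "p = velocity L' (i, strand_param (loc j) (- u))" and "q = velocity L' (i', strand_param (loc k) (- v))"
      have "velocity L' (i, strand_param (loc j) u) = - cnj p" "velocity L' (i', strand_param (loc k) v) = - cnj q"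
        using velocity_strand_reflected[OF L(2) L(2) refl refl bounded_linear_cnj str, of j u]
          velocity_strand_reflected[OF L(2) L(2) refl refl bounded_linear_cnj str, of k v] c
        unfolding p_def q_def by auto
      \<comment> \<open>Transversality matters here: \<open>crossing_sign\<close> counts determinant
        zero as \<open>- 1\<close>, so negating the determinant negates the sign only when it is
        nonzero.\<close>
      moreover have "plane_det p q \<noteq> 0"
        unfolding p_def q_def
      proof (rule L'.transverse)
        show "curve L' i (strand_param (loc j) (- u)) = curve L' i' (strand_param (loc k) (- v))"
          using L'.strand_at(1)[of j "- u"] L'.strand_at(1)[of k "- v"] c cc[of j k u v] by auto
      qed (use i n in auto)
      moreover have "plane_det (- cnj p) (- cnj q) = - plane_det p q" by (simp add: plane_det_def)
      ultimately show "L'.sign_at (j, - u, k, - v) = - L'.sign_at (j, u, k, v)"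
        using c by (auto simp: L'.sign_at_def crossing_sign_def p_def q_def)
    qed
    also have "\<dots> = - sum L'.sign_at (L'.crossing_params_between i i')" by (rule sum_negf)
    finally have "sum L'.sign_at (L'.crossing_params_between i i') = 0" by simp
    moreover have "L.crossing_params_between i i' = {}" using 3(1) by (auto simp: L.crossing_params_between_def)
    ultimately show ?thesis by simp
  qed
qed

text \<open>The crossings are split by the square: outside it the diagrams coincide, and inside it
  the symmetry of the pictures applies.\<close>

lemma linking_local_move:
  assumes W: "welded_diagram L" "welded_diagram L'" and move: "local_move L L'"
    and i: "i < num_comps L" "i' < num_comps L" "i \<noteq> i'"
  shows "linking L' i i' = linking L i i'"
proof -
  obtain T T' J loc where T: "basic_move T T'" and cont: "contains_tangle L loc (reverse_strands J T)"
    "contains_tangle L' loc (reverse_strands J T')" and out: "same_outside_square L L'"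
    using move by (auto simp: local_move_def)
  note sym = basic_move_symmetric[OF T]
  have tid: "tangle_in_diagram L loc (reverse_strands J T)" "tangle_in_diagram L' loc (reverse_strands J T')"
    using W cont sym interior_reverse by (auto intro!: tangle_in_diagram.intro diagramI tangle_in_diagram_axioms.intro)
  interpret L: tangle_in_diagram L loc "reverse_strands J T" by (rule tid)
  interpret L': tangle_in_diagram L' loc "reverse_strands J T'" by (rule tid)
  have n: "num_comps L' = num_comps L"
    and same: "\<And>i t. i < num_comps L \<Longrightarrow> curve L i t \<notin> square \<or> curve L' i t \<notin> square \<Longrightarrow>
      curve L' i t = curve L i t \<and> over_at L' i t = over_at L i t"
    using out unfolding same_outside_square_def by blast+
  define f where "f = (\<lambda>L (s, t). crossing_sign (velocity L (i, s)) (velocity L (i', t)))"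
  define inside where "inside L = {(s, t) \<in> crossing_pairs L i i'. curve L i s \<in> square}" for L :: wdiagram
  define outside where "outside L = {(s, t) \<in> crossing_pairs L i i'. curve L i s \<notin> square}" for L :: wdiagram
  have split: "linking M i i' = sum (f M) (inside M) + sum (f M) (outside M)" if "finite (crossing_pairs M i i')" for M
  proof -
    have "crossing_pairs M i i' = inside M \<union> outside M" "inside M \<inter> outside M = {}"
      by (auto simp: inside_def outside_def)
    moreover from this have "finite (inside M)" "finite (outside M)" using that by (auto intro: finite_subset)
    ultimately show ?thesis unfolding linking_def f_def by (simp add: sum.union_disjoint)
  qed
  have "sum (f L') (inside L') = sum (f L) (inside L)"
  proof -
    have "crossing_params (reverse_strands J T) = {} \<and> crossing_params (reverse_strands J T') = {} \<or>
        rotated (reverse_strands J T) (reverse_strands J T') \<or>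
        crossing_params (reverse_strands J T) = {} \<and> mirrored (reverse_strands J T')"
      using sym crossing_params_reverse_empty rotated_reverse mirrored_reverse by metis
    from linking_inside_eq[OF tid n i this] show ?thesis
      using L.linking_inside[OF i] L'.linking_inside[of i i'] i n by (simp add: f_def inside_def)
  qed
  moreover have "outside L' = outside L"
  proof -
    have "(s, t) \<in> outside L' \<longleftrightarrow> (s, t) \<in> outside L" for s t
      using same[OF i(1), of s] same[OF i(2), of t] unfolding outside_def crossing_pairs_def by auto
    then show ?thesis by auto
  qed
  moreover have "sum (f L') (outside L) = sum (f L) (outside L)"
  proof -
    \<comment> \<open>The complement of the square is open, so the two curves agree near the
      parameter and have the same derivative there.\<close>
    have vel: "velocity L' (k, t) = velocity L (k, t)" if k: "k < num_comps L" "curve L k t \<notin> square" for k t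
    proof (rule L'.velocity_unique)
      have "continuous_on UNIV (curve L k)"
        using L.isCont_curve[OF k(1)] by (simp add: continuous_at_imp_continuous_on)
      then have "open (curve L k -` (- square))"
        by (intro open_vimage) (auto simp: square_def closed_cbox)
      moreover have "curve L k x = curve L' k x" if "x \<in> curve L k -` (- square)" for x
        using same[OF k(1), of x] that by simp
      ultimately show "(curve L' k has_vector_derivative velocity L (k, t)) (at t)"
        using k(2) has_vector_derivative_transform_within_open[OF L.curve_has_velocity[OF k(1)]] by blast
    qed (use k n in simp)
    show ?thesis
      using i by (intro sum.cong refl) (auto simp: f_def outside_def crossing_pairs_def vel)
  qed
  ultimately show ?thesis
    using split[OF L.finite_crossing_pairs[OF i(1,2)]] split[OF L'.finite_crossing_pairs[of i i']] i n by simp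
qed

section \<open>The invariant in terms of linking numbers\<close>

lemma power_int_sum:
  fixes x :: "'k::field"
  assumes "x \<noteq> 0"
  shows "x powi (\<Sum>i\<in>A. f i) = (\<Prod>i\<in>A. x powi f i)"
proof (induction A rule: infinite_finite_induct)
  case (insert i A)
  then show ?case using assms by (simp add: power_int_add)
qed simp_all

text \<open>
  The factor \<open>(a r - \<nu> b)\<^bsup>-w\<^esup>\<close> and the powers of \<open>r\<close> are distributed over the crossings; each virtual
  crossing of the diagram contributes \<open>r\<^sup>2 = 1\<close>.
\<close>

definition normalised_weight :: "'k::field \<Rightarrow> 'k \<Rightarrow> 'k \<Rightarrow> 'k \<Rightarrow> bool \<Rightarrow> resolution \<Rightarrow> 'k" where
  "normalised_weight a b r \<nu> pos c = (if pos then inverse (a * r - \<nu> * b) else a * r - \<nu> * b) *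
     skein_coeff a b \<nu> pos c * (if c = Virt then r else 1)"

text \<open>As \<open>r\<close> and \<open>\<nu>\<close> have square \<open>1\<close>, the
  denominator \<open>b\<^sup>2 - a\<^sup>2\<close> is the negated product of
  \<open>a * r - \<nu> * b\<close> and \<open>a * r + \<nu> * b\<close>, and at a negative crossing
  the normalisation cancels the first factor. For \<open>\<nu> = - 1\<close> the last value is the
  weight of a crossing whose strands carry different labels.\<close>

lemma normalised_weight:
  fixes a b r \<nu> :: "'k::field"
  assumes r: "r * r = 1" and \<nu>: "\<nu> * \<nu> = 1" and q: "a * r - \<nu> * b \<noteq> 0" "a * r + \<nu> * b \<noteq> 0"
  shows "normalised_weight a b r \<nu> pos Unorient = \<nu> * normalised_weight a b r \<nu> pos Orient"
    and "normalised_weight a b r \<nu> pos Virt = 1 + \<nu> * normalised_weight a b r \<nu> pos Orient"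
    and "normalised_weight a b r \<nu> pos Virt + \<nu> * normalised_weight a b r \<nu> pos Orient =
      (if pos then (a * r + \<nu> * b) / (a * r - \<nu> * b) else (a * r - \<nu> * b) / (a * r + \<nu> * b))"
proof -
  define q\<^sub>1 q\<^sub>2 where "q\<^sub>1 = a * r - \<nu> * b" and "q\<^sub>2 = a * r + \<nu> * b"
  have q': "q\<^sub>1 \<noteq> 0" "q\<^sub>2 \<noteq> 0" using q by (simp_all add: q\<^sub>1_def q\<^sub>2_def)
  have "q\<^sub>1 * q\<^sub>2 = (r * r) * a\<^sup>2 - (\<nu> * \<nu>) * b\<^sup>2"
    by (simp add: q\<^sub>1_def q\<^sub>2_def algebra_simps power2_eq_square)
  then have delta: "b\<^sup>2 - a\<^sup>2 = - (q\<^sub>1 * q\<^sub>2)" by (simp add: r \<nu>)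
  let ?w = "normalised_weight a b r \<nu> pos"
  define d where "d = (if pos then q\<^sub>1 else - q\<^sub>2)"
  have d: "d \<noteq> 0" using q' by (simp add: d_def)
  have w: "?w Orient = b / d" "?w Unorient = \<nu> * (b / d)" "?w Virt = (if pos then a * r / d else - (a * r / d))"
    using q' unfolding normalised_weight_def q\<^sub>1_def[symmetric] d_def
    by (cases pos; simp add: delta divide_inverse mult_ac)+
  show "?w Unorient = \<nu> * ?w Orient" by (simp add: w)
  show "?w Virt = 1 + \<nu> * ?w Orient"
    unfolding w using d by (cases pos) (simp_all add: d_def q\<^sub>1_def q\<^sub>2_def field_simps)
  show "?w Virt + \<nu> * ?w Orient =
      (if pos then (a * r + \<nu> * b) / (a * r - \<nu> * b) else (a * r - \<nu> * b) / (a * r + \<nu> * b))"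
  proof -
    have "q\<^sub>2 / q\<^sub>1 = a * r / q\<^sub>1 + \<nu> * b / q\<^sub>1" "q\<^sub>1 / q\<^sub>2 = a * r / q\<^sub>2 - \<nu> * b / q\<^sub>2"
      by (simp_all only: q\<^sub>1_def q\<^sub>2_def add_divide_distrib diff_divide_distrib)
    then show ?thesis
      unfolding w q\<^sub>1_def[symmetric] q\<^sub>2_def[symmetric] by (cases pos) (simp_all add: d_def)
  qed
qed

context diagram
begin

lemma over_under_branch:
  assumes "p \<in> classical L"
  shows "over_branch L p \<in> branches L p" "over_at L (fst (over_branch L p)) (snd (over_branch L p))"
    "under_branch L p \<in> branches L p" "branches L p = {over_branch L p, under_branch L p}"
    "under_branch L p \<noteq> over_branch L p"
    "x \<in> branches L p \<Longrightarrow> over_at L (fst x) (snd x) \<Longrightarrow> x = over_branch L p"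
proof -
  define P where "P x \<longleftrightarrow> x \<in> branches L p \<and> over_at L (fst x) (snd x)" for x
  have ex1: "\<exists>!x. P x"
    using welded assms by (simp add: welded_diagram_def P_def)
  have o: "over_branch L p = (THE x. P x)" by (simp add: over_branch_def P_def)
  have Po: "P (over_branch L p)" unfolding o by (rule theI'[OF ex1])
  show 1: "over_branch L p \<in> branches L p" and "over_at L (fst (over_branch L p)) (snd (over_branch L p))"
    using Po by (simp_all add: P_def)
  show uniq: "x = over_branch L p" if "x \<in> branches L p" "over_at L (fst x) (snd x)" for x
    using ex1 Po that by (auto simp: P_def)
  have b: "branches L p = {over_branch L p, mate (over_branch L p)}" "mate (over_branch L p) \<noteq> over_branch L p"
    using branches_eq[OF 1 assms] by auto
  have "under_branch L p = mate (over_branch L p)"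
    unfolding under_branch_def
  proof (rule the_equality)
    show "mate (over_branch L p) \<in> branches L p \<and>
        \<not> over_at L (fst (mate (over_branch L p))) (snd (mate (over_branch L p)))"
      using b uniq by blast
    show "x = mate (over_branch L p)" if "x \<in> branches L p \<and> \<not> over_at L (fst x) (snd x)" for x
    proof -
      have "x = over_branch L p \<or> x = mate (over_branch L p)" using that b(1) by blast
      then show ?thesis using that Po by (auto simp: P_def)
    qed
  qed
  then show "under_branch L p \<in> branches L p" "branches L p = {over_branch L p, under_branch L p}"
    "under_branch L p \<noteq> over_branch L p"
    using b by auto
qed

lemma over_branch_eq:
  assumes "i \<noteq> j" "(s, t) \<in> crossing_pairs L i j" "j < num_comps L"
  shows "curve L i s \<in> classical L" "over_branch L (curve L i s) = (i, s)" "under_branch L (curve L i s) = (j, t)"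
proof -
  have st: "0 \<le> s" "s < 1" "0 \<le> t" "t < 1" "curve L i s = curve L j t" "over_at L i s"
    using assms(2) by (auto simp: crossing_pairs_def)
  have cl: "i < num_comps L" "curve L i s \<in> classical L" using over_at_classical[OF st(6)] by blast+
  have b: "(i, s) \<in> branches L (curve L i s)" "(j, t) \<in> branches L (curve L i s)"
    using st cl assms(3) by (auto simp: branches_def)
  have o: "(i, s) = over_branch L (curve L i s)"
    by (rule over_under_branch(6)[OF cl(2) b(1)]) (use st in simp)
  show "curve L i s \<in> classical L" by (rule cl(2))
  show "over_branch L (curve L i s) = (i, s)" using o by simp
  show "under_branch L (curve L i s) = (j, t)"
  proof -
    have "(j, t) \<noteq> over_branch L (curve L i s)" using o assms(1) by (metis prod.inject)
    moreover have "(j, t) \<in> {over_branch L (curve L i s), under_branch L (curve L i s)}"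
      using b(2) over_under_branch(4)[OF cl(2)] by (rule back_subst[of "\<lambda>B. (j, t) \<in> B"])
    ultimately show ?thesis by simp
  qed
qed

text \<open>A crossing between distinct components is recorded by its two parameters, so the product
  runs over \<open>crossing_pairs\<close>; each sign becomes an exponent of
  \<open>\<rho>\<close>.\<close>

lemma prod_crossings_between:
  fixes \<rho> :: "'k::field"
  assumes ij: "i \<noteq> j" "i < num_comps L" "j < num_comps L" and \<rho>: "\<rho> \<noteq> 0"
  shows "(\<Prod>p\<in>{p \<in> classical L. fst (over_branch L p) = i \<and> fst (under_branch L p) = j}.
      if positive_crossing L p then \<rho> else inverse \<rho>) = \<rho> powi linking L i j"
proof -
  let ?C = "{p \<in> classical L. fst (over_branch L p) = i \<and> fst (under_branch L p) = j}"
  have "\<rho> powi linking L i j = (\<Prod>(s, t)\<in>crossing_pairs L i j.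
      \<rho> powi crossing_sign (velocity L (i, s)) (velocity L (j, t)))"
    unfolding linking_def power_int_sum[OF \<rho>] by (simp add: case_prod_unfold)
  also have "\<dots> = (\<Prod>p\<in>?C. if positive_crossing L p then \<rho> else inverse \<rho>)"
  proof (rule prod.reindex_bij_witness[of _ "\<lambda>p. (snd (over_branch L p), snd (under_branch L p))" "\<lambda>(s, t). curve L i s"])
    fix x assume "x \<in> crossing_pairs L i j"
    then obtain s t where x: "x = (s, t)" "(s, t) \<in> crossing_pairs L i j" by (cases x) auto
    note o = over_branch_eq[OF ij(1) x(2) ij(3)]
    show "(snd (over_branch L (case x of (s, t) \<Rightarrow> curve L i s)),
        snd (under_branch L (case x of (s, t) \<Rightarrow> curve L i s))) = x"
      using o x(1) by simp
    show "(case x of (s, t) \<Rightarrow> curve L i s) \<in> ?C" using o x(1) by simp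
    show "(if positive_crossing L (case x of (s, t) \<Rightarrow> curve L i s) then \<rho> else inverse \<rho>) =
        (case x of (s, t) \<Rightarrow> \<rho> powi crossing_sign (velocity L (i, s)) (velocity L (j, t)))"
      using o x(1) by (simp add: positive_crossing_def crossing_sign_def power_int_minus)
  next
    fix p assume p: "p \<in> ?C"
    then have cl: "p \<in> classical L" by simp
    obtain s t where o: "over_branch L p = (i, s)" "under_branch L p = (j, t)"
      using p by (metis (mono_tags, lifting) mem_Collect_eq prod.collapse)
    have b: "(i, s) \<in> branches L p" "(j, t) \<in> branches L p" "over_at L i s"
      using over_under_branch(1-3)[OF cl] o by auto
    then show "(case (snd (over_branch L p), snd (under_branch L p)) of (s, t) \<Rightarrow> curve L i s) = p"
      by (simp add: o branches_def)
    show "(snd (over_branch L p), snd (under_branch L p)) \<in> crossing_pairs L i j"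
      using b by (simp add: o branches_def crossing_pairs_def)
  qed
  finally show ?thesis by simp
qed

text \<open>Both orders of a pair of components occur, since each may be the upper one. The diagonal
  contributes \<open>1\<close>, so self-crossings have no effect.\<close>

definition separated_linking :: "'k::field \<Rightarrow> (nat \<Rightarrow> bool) \<Rightarrow> 'k" where
  "separated_linking \<rho> \<epsilon> = (\<Prod>(i, j)\<in>{..<num_comps L} \<times> {..<num_comps L}.
     if \<epsilon> i \<noteq> \<epsilon> j then \<rho> powi linking L i j else 1)"

text \<open>Crossings are grouped by the ordered pair of their upper and lower components.\<close>

lemma prod_separated_crossings:
  fixes \<rho> :: "'k::field"
  assumes "\<rho> \<noteq> 0"
  shows "(\<Prod>p\<in>classical L. if \<epsilon> (fst (over_branch L p)) \<noteq> \<epsilon> (fst (under_branch L p))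
      then if positive_crossing L p then \<rho> else inverse \<rho> else 1) = separated_linking \<rho> \<epsilon>"
proof -
  define g where "g p = (fst (over_branch L p), fst (under_branch L p))" for p
  let ?h = "\<lambda>p. if \<epsilon> (fst (over_branch L p)) \<noteq> \<epsilon> (fst (under_branch L p))
      then if positive_crossing L p then \<rho> else inverse \<rho> else 1"
  have "g ` classical L \<subseteq> {..<num_comps L} \<times> {..<num_comps L}"
    using over_under_branch(1,3) by (fastforce simp: g_def branches_def)
  from prod.group[OF finite_classical _ this, of ?h]
  have "prod ?h (classical L) =
      (\<Prod>x\<in>{..<num_comps L} \<times> {..<num_comps L}. \<Prod>p\<in>{p \<in> classical L. g p = x}. ?h p)"
    by simp
  also have "\<dots> = separated_linking \<rho> \<epsilon>"
    unfolding separated_linking_def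
  proof (intro prod.cong refl)
    fix x assume x: "x \<in> {..<num_comps L} \<times> {..<num_comps L}"
    obtain i j where ij: "x = (i, j)" "i < num_comps L" "j < num_comps L" using x by (cases x) auto
    have "(\<Prod>p\<in>{p \<in> classical L. g p = x}. ?h p) =
      (\<Prod>p\<in>{p \<in> classical L. fst (over_branch L p) = i \<and> fst (under_branch L p) = j}.
        if \<epsilon> i \<noteq> \<epsilon> j then if positive_crossing L p then \<rho> else inverse \<rho> else 1)"
      by (rule prod.cong) (auto simp: g_def ij(1))
    also have "\<dots> = (if \<epsilon> i \<noteq> \<epsilon> j then \<rho> powi linking L i j else 1)"
      using prod_crossings_between[of i j \<rho>] ij assms by (cases "\<epsilon> i = \<epsilon> j") auto
    finally show "(\<Prod>p\<in>{p \<in> classical L. g p = x}. ?h p) =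
        (case x of (i, j) \<Rightarrow> if \<epsilon> i \<noteq> \<epsilon> j then \<rho> powi linking L i j else 1)"
      by (simp add: ij(1))
  qed
  finally show ?thesis .
qed

lemma card_vcross_Un: "card (vcross L \<union> {p \<in> classical L. S p = Virt}) =
    card (vcross L) + card {p \<in> classical L. S p = Virt}"
proof (rule card_Un_disjoint)
  show "finite (vcross L)"
    using welded unfolding welded_diagram_def by (meson finite_subset)
  show "finite {p \<in> classical L. S p = Virt}" using finite_classical by simp
qed (auto simp: classical_def)

lemma Y_state_sum:
  fixes a b r \<nu> :: "'k::field"
  assumes r: "r * r = 1" and q: "a * r - \<nu> * b \<noteq> 0"
  shows "Y a b r \<nu> L = (\<Sum>S\<in>classical L \<rightarrow>\<^sub>E UNIV.
    (\<Prod>p\<in>classical L. normalised_weight a b r \<nu> (positive_crossing L p) (S p)) *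
    (- 2 * \<nu>) ^ num_circles L S)"
proof -
  define q where "q = a * r - \<nu> * b"
  let ?P = "\<lambda>p. if positive_crossing L p then inverse q else q"
  have "q powi (- writhe L) = inverse q ^ card {p \<in> classical L. positive_crossing L p} *
      q ^ card {p \<in> classical L. \<not> positive_crossing L p}"
    using q unfolding writhe_def minus_diff_eq q_def[symmetric]
    by (subst power_int_diff) (auto simp: field_simps power_inverse)
  also have "\<dots> = prod ?P (classical L)"
    using finite_classical by (subst prod.If_cases) (auto simp: Int_def conj_commute)
  finally have w: "q powi (- writhe L) = prod ?P (classical L)" .
  have v: "r ^ virtual_writhe L * r ^ num_virtual L S = (\<Prod>p\<in>classical L. if S p = Virt then r else 1)" for S
  proof -
    have "r ^ virtual_writhe L * r ^ num_virtual L S = (r * r) ^ card (vcross L) * r ^ card {p \<in> classical L. S p = Virt}"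
      unfolding virtual_writhe_def num_virtual_def card_vcross_Un by (simp add: power_add power_mult_distrib)
    also have "\<dots> = r ^ card {p \<in> classical L. S p = Virt}" by (simp add: r)
    also have "\<dots> = (\<Prod>p\<in>classical L. if S p = Virt then r else 1)"
      using finite_classical by (subst prod.If_cases) (auto simp: Int_def conj_commute)
    finally show ?thesis .
  qed
  show ?thesis
    unfolding Y_def bracket_def states_def state_value_def q_def[symmetric] w sum_distrib_left
  proof (intro sum.cong refl)
    fix S
    have "r ^ virtual_writhe L * prod ?P (classical L) *
        ((\<Prod>p\<in>classical L. skein_coeff a b \<nu> (positive_crossing L p) (S p)) *
         (r ^ num_virtual L S * (- 2 * \<nu>) ^ num_circles L S)) =
        (prod ?P (classical L) * (\<Prod>p\<in>classical L. skein_coeff a b \<nu> (positive_crossing L p) (S p)) *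
        (r ^ virtual_writhe L * r ^ num_virtual L S)) * (- 2 * \<nu>) ^ num_circles L S"
      by (simp add: mult_ac)
    then show "r ^ virtual_writhe L * prod ?P (classical L) *
        ((\<Prod>p\<in>classical L. skein_coeff a b \<nu> (positive_crossing L p) (S p)) *
         (r ^ num_virtual L S * (- 2 * \<nu>) ^ num_circles L S)) =
        (\<Prod>p\<in>classical L. normalised_weight a b r \<nu> (positive_crossing L p) (S p)) *
        (- 2 * \<nu>) ^ num_circles L S"
      by (simp only: v prod.distrib normalised_weight_def q_def)
  qed
qed

text \<open>A label that never changes at a mark is constant along each component and is read off at
  the base point.\<close>

lemma bij_straight_labellings:
  "bij_betw (\<lambda>\<epsilon>. \<lambda>x\<in>marks. \<epsilon> (fst x)) ({..<num_comps L} \<rightarrow>\<^sub>E (UNIV :: bool set))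
     {f \<in> marks \<rightarrow>\<^sub>E UNIV. \<forall>x\<in>marks. f (prev_arc x) = f x}"
  unfolding bij_betw_def
proof (intro conjI subset_antisym)
  let ?F = "\<lambda>\<epsilon> :: nat \<Rightarrow> bool. \<lambda>x\<in>marks. \<epsilon> (fst x)"
  have zero: "(i, 0) \<in> marks" if "i < num_comps L" for i using that by (simp add: marks_def)
  show "inj_on ?F ({..<num_comps L} \<rightarrow>\<^sub>E UNIV)"
  proof (rule inj_onI)
    fix \<epsilon> \<epsilon>' :: "nat \<Rightarrow> bool"
    assume e: "\<epsilon> \<in> {..<num_comps L} \<rightarrow>\<^sub>E UNIV" "\<epsilon>' \<in> {..<num_comps L} \<rightarrow>\<^sub>E UNIV" "?F \<epsilon> = ?F \<epsilon>'"
    show "\<epsilon> = \<epsilon>'"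
    proof (rule PiE_ext[OF e(1,2)])
      fix i assume "i \<in> {..<num_comps L}"
      then show "\<epsilon> i = \<epsilon>' i" using fun_cong[OF e(3), of "(i, 0)"] zero by simp
    qed
  qed
  show "?F ` ({..<num_comps L} \<rightarrow>\<^sub>E UNIV) \<subseteq> {f \<in> marks \<rightarrow>\<^sub>E UNIV. \<forall>x\<in>marks. f (prev_arc x) = f x}"
  proof (rule image_subsetI)
    fix \<epsilon> :: "nat \<Rightarrow> bool"
    have "?F \<epsilon> (prev_arc x) = ?F \<epsilon> x" if "x \<in> marks" for x
      using that pr_in[OF that] by (simp add: prev_arc_def)
    then show "?F \<epsilon> \<in> {f \<in> marks \<rightarrow>\<^sub>E UNIV. \<forall>x\<in>marks. f (prev_arc x) = f x}" by simp
  qed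
  show "{f \<in> marks \<rightarrow>\<^sub>E UNIV. \<forall>x\<in>marks. f (prev_arc x) = f x} \<subseteq> ?F ` ({..<num_comps L} \<rightarrow>\<^sub>E UNIV)"
  proof
    fix f assume f: "f \<in> {f \<in> marks \<rightarrow>\<^sub>E (UNIV :: bool set). \<forall>x\<in>marks. f (prev_arc x) = f x}"
    define \<epsilon> where "\<epsilon> = (\<lambda>i\<in>{..<num_comps L}. f (i, 0))"
    \<comment> \<open>In the state without smoothings nothing is cut, so labels can be carried from
      the base point along the whole component.\<close>
    define V where "V = (\<lambda>p\<in>classical L. Virt)"
    have lab: "f \<in> labellings V" using f straight_labellings by (simp add: V_def pt_image)
    have no_cut: "(i, t) \<notin> cuts L V" for i t by (auto simp: cuts_def V_def)
    have "f (i, t) = f (i, 0)" if it: "(i, t) \<in> marks" for i t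
    proof (cases "t = 0")
      case False
      have i: "i < num_comps L" "0 < t" using marks_bound[OF it] False by auto
      have "f (arc (i, 0)) = f (prev_arc (i, t))" using label_along[OF lab i no_cut] .
      also have "\<dots> = f (arc (i, t))" using label_uncut[OF lab i(1) no_cut] .
      finally show ?thesis using arc_marks[OF it] arc_marks[OF zero[OF i(1)]] by simp
    qed simp
    then have "?F \<epsilon> x = f x" if "x \<in> marks" for x
      using that marks_bound[of "fst x" "snd x"] by (cases x) (auto simp: \<epsilon>_def)
    then have "f = ?F \<epsilon>" using f by (intro extensionalityI[of _ marks]) (auto simp: PiE_def)
    moreover have "\<epsilon> \<in> {..<num_comps L} \<rightarrow>\<^sub>E UNIV" by (simp add: \<epsilon>_def)
    ultimately show "f \<in> ?F ` ({..<num_comps L} \<rightarrow>\<^sub>E UNIV)" by blast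
  qed
qed

text \<open>The exponent is read off from the number of labellings, one free label for each
  component, instead of from the classes of \<open>joined\<close>.\<close>

lemma num_circles_all_virtual: "num_circles L (\<lambda>p\<in>classical L. Virt) = num_comps L"
proof -
  have "2 ^ num_circles L (\<lambda>p\<in>classical L. Virt) = card ({..<num_comps L} \<rightarrow>\<^sub>E (UNIV :: bool set))"
    using card_labellings[of "\<lambda>p\<in>classical L. Virt"] straight_labellings bij_betw_same_card[OF bij_straight_labellings]
    by (simp add: pt_image)
  then have "(2::nat) ^ num_circles L (\<lambda>p\<in>classical L. Virt) = 2 ^ num_comps L"
    by (simp add: card_funcsetE)
  then show ?thesis by simp
qed

lemma Y_one:
  fixes a b r :: "'k::field"
  assumes r: "r * r = 1" and q: "a * r - b \<noteq> 0" "a * r + b \<noteq> 0"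
  shows "Y a b r 1 L = (- 2) ^ num_comps L"
proof -
  define w where "w p = normalised_weight a b r 1 (positive_crossing L p)" for p
  have "Y a b r 1 L = (\<Sum>S\<in>classical L \<rightarrow>\<^sub>E UNIV. (\<Prod>p\<in>classical L. w p (S p)) * (- 2) ^ num_circles L S)"
    using Y_state_sum[OF r, of a 1 b] q by (simp add: w_def)
  also have "\<dots> = (- 2) ^ num_circles L (\<lambda>p\<in>classical L. Virt)"
  proof (rule state_sum_all_virtual[OF finite_classical])
    fix S p assume "p \<in> classical L"
    then have "p \<in> pt ` classical_branches" by (simp add: pt_image)
    then obtain x where x: "x \<in> classical_branches" "pt x = p" by auto
    show "(- 2 :: 'k) ^ num_circles L (S(p := Virt)) + (- 2) ^ num_circles L (S(p := Orient)) +
        (- 2) ^ num_circles L (S(p := Unorient)) = 0"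
      using skein_triple[OF card_labellings x(1), of S] by (simp add: x(2))
  next
    fix p
    show "w p Unorient = w p Orient \<and> w p Virt = 1 + w p Orient"
      using normalised_weight(1,2)[OF r, of 1 a b] q by (simp add: w_def)
  qed
  finally show ?thesis by (simp add: num_circles_all_virtual)
qed

lemma Y_minus_one:
  fixes a b r :: "'k::field"
  assumes r: "r * r = 1" and q: "a * r - b \<noteq> 0" "a * r + b \<noteq> 0"
  shows "Y a b r (- 1) L = (\<Sum>\<epsilon>\<in>{..<num_comps L} \<rightarrow>\<^sub>E (UNIV :: bool set).
    separated_linking ((a * r - b) / (a * r + b)) \<epsilon>)"
proof -
  define \<rho> where "\<rho> = (a * r - b) / (a * r + b)"
  have \<rho>: "\<rho> \<noteq> 0" using q by (simp add: \<rho>_def)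
  define w where "w p = normalised_weight a b r (- 1) (positive_crossing L p)" for p
  have w: "w p Unorient = - w p Orient \<and> w p Virt = 1 - w p Orient" for p
    using normalised_weight(1,2)[OF r, of "- 1" a b] q by (simp add: w_def)
  have w\<rho>: "w p Virt - w p Orient = (if positive_crossing L p then \<rho> else inverse \<rho>)" for p
    using normalised_weight(3)[OF r, of "- 1" a b "positive_crossing L p"] q by (simp add: w_def \<rho>_def)
  have "Y a b r (- 1) L = (\<Sum>S\<in>classical L \<rightarrow>\<^sub>E UNIV. (\<Prod>p\<in>classical L. w p (S p)) * 2 ^ num_circles L S)"
    using Y_state_sum[OF r, of a "- 1" b] q by (simp add: w_def)
  also have "\<dots> = (\<Sum>S\<in>pt ` classical_branches \<rightarrow>\<^sub>E UNIV.
      (\<Prod>p\<in>pt ` classical_branches. w p (S p)) * of_nat (card (labellings S)))"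
    by (simp add: pt_image card_labellings)
  also have "\<dots> = (\<Sum>f\<in>{f \<in> marks \<rightarrow>\<^sub>E (UNIV :: bool set). \<forall>x\<in>marks. f (prev_arc x) = f x}.
       \<Prod>p\<in>pt ` classical_branches.
         if \<exists>x\<in>classical_branches. pt x = p \<and> f x \<noteq> f (mate x) then w p Virt - w p Orient else 1)"
    by (rule state_sum_labellings[OF w])
  also have "\<dots> = (\<Sum>\<epsilon>\<in>{..<num_comps L} \<rightarrow>\<^sub>E (UNIV :: bool set). \<Prod>p\<in>pt ` classical_branches.
         if \<exists>x\<in>classical_branches. pt x = p \<and> (\<lambda>x\<in>marks. \<epsilon> (fst x)) x \<noteq> (\<lambda>x\<in>marks. \<epsilon> (fst x)) (mate x)
         then w p Virt - w p Orient else 1)"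
    by (rule sum.reindex_bij_betw[OF bij_straight_labellings, symmetric])
  also have "\<dots> = (\<Sum>\<epsilon>\<in>{..<num_comps L} \<rightarrow>\<^sub>E (UNIV :: bool set). separated_linking \<rho> \<epsilon>)"
  proof (intro sum.cong refl)
    fix \<epsilon> :: "nat \<Rightarrow> bool"
    \<comment> \<open>The two passages through \<open>p\<close> are mates of each other, so the
      condition compares the labels of the upper and the lower component.\<close>
    have turn: "(\<exists>x\<in>classical_branches. pt x = p \<and> (\<lambda>x\<in>marks. \<epsilon> (fst x)) x \<noteq> (\<lambda>x\<in>marks. \<epsilon> (fst x)) (mate x)) \<longleftrightarrow>
        \<epsilon> (fst (over_branch L p)) \<noteq> \<epsilon> (fst (under_branch L p))" if p: "p \<in> classical L" for p
    proof -
      note o = over_under_branch(1,3-5)[OF p]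
      have m: "mate (over_branch L p) = under_branch L p" "mate (under_branch L p) = over_branch L p"
        using branches_eq[OF o(1) p] branches_eq[OF o(2) p] o(3,4) by (metis doubleton_eq_iff)+
      have mk: "(\<lambda>x\<in>marks. \<epsilon> (fst x)) x = \<epsilon> (fst x)" "(\<lambda>x\<in>marks. \<epsilon> (fst x)) (mate x) = \<epsilon> (fst (mate x))"
        if "x \<in> classical_branches" for x
        using that mate_in[OF that] by (auto simp: marks_def)
      have fib: "x \<in> classical_branches \<and> pt x = p \<longleftrightarrow> x = over_branch L p \<or> x = under_branch L p" for x
      proof
        assume "x \<in> classical_branches \<and> pt x = p"
        then show "x = over_branch L p \<or> x = under_branch L p"
          using classical_branch[of x] o(3) by auto
      next
        assume "x = over_branch L p \<or> x = under_branch L p"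
        then have "x \<in> branches L p" using o by auto
        then show "x \<in> classical_branches \<and> pt x = p"
          using p pt_branch by (auto simp: classical_branches)
      qed
      show ?thesis
      proof
        assume "\<exists>x\<in>classical_branches. pt x = p \<and> (\<lambda>x\<in>marks. \<epsilon> (fst x)) x \<noteq> (\<lambda>x\<in>marks. \<epsilon> (fst x)) (mate x)"
        then obtain x where x: "x \<in> classical_branches" "pt x = p" "\<epsilon> (fst x) \<noteq> \<epsilon> (fst (mate x))"
          using mk by metis
        then have "x = over_branch L p \<or> x = under_branch L p" using fib by blast
        then show "\<epsilon> (fst (over_branch L p)) \<noteq> \<epsilon> (fst (under_branch L p))" using x(3) m by auto
      next
        assume e: "\<epsilon> (fst (over_branch L p)) \<noteq> \<epsilon> (fst (under_branch L p))"
        have x: "over_branch L p \<in> classical_branches" "pt (over_branch L p) = p"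
          using fib[of "over_branch L p"] by simp_all
        show "\<exists>x\<in>classical_branches. pt x = p \<and> (\<lambda>x\<in>marks. \<epsilon> (fst x)) x \<noteq> (\<lambda>x\<in>marks. \<epsilon> (fst x)) (mate x)"
          using mk[OF x(1)] x e m(1) by metis
      qed
    qed
    show "(\<Prod>p\<in>pt ` classical_branches.
         if \<exists>x\<in>classical_branches. pt x = p \<and> (\<lambda>x\<in>marks. \<epsilon> (fst x)) x \<noteq> (\<lambda>x\<in>marks. \<epsilon> (fst x)) (mate x)
         then w p Virt - w p Orient else 1) = separated_linking \<rho> \<epsilon>"
      unfolding prod_separated_crossings[OF \<rho>, symmetric] pt_image w\<rho>
    proof (rule prod.cong[OF refl])
      fix p assume p: "p \<in> classical L"
      show "(if \<exists>x\<in>classical_branches. pt x = p \<and> (\<lambda>x\<in>marks. \<epsilon> (fst x)) x \<noteq> (\<lambda>x\<in>marks. \<epsilon> (fst x)) (mate x)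
         then if positive_crossing L p then \<rho> else inverse \<rho> else 1) =
        (if \<epsilon> (fst (over_branch L p)) \<noteq> \<epsilon> (fst (under_branch L p))
         then if positive_crossing L p then \<rho> else inverse \<rho> else 1)"
        unfolding turn[OF p] by (rule refl)
    qed
  qed
  finally show ?thesis by (simp add: \<rho>_def)
qed

end

section \<open>Invariance under the steps of welded equivalence\<close>

text \<open>Only a change of parametrisation renumbers components; otherwise \<open>\<pi>\<close> is
  the identity. The components are distinct because R1 does not preserve self-crossings.\<close>

lemma welded_step_linking:
  assumes "welded_step L L'"
  obtains \<pi> where "num_comps L' = num_comps L" "\<pi> permutes {..<num_comps L}"
    "\<And>i j. i < num_comps L \<Longrightarrow> j < num_comps L \<Longrightarrow> i \<noteq> j \<Longrightarrow> linking L' i j = linking L (\<pi> i) (\<pi> j)"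
proof -
  have W: "welded_diagram L" "welded_diagram L'"
    and "planar_isotopic L L' \<or> reparametrised L L' \<or> local_move L L'"
    using assms by (auto simp: welded_step_def)
  then consider "planar_isotopic L L'" | "reparametrised L L'" | "local_move L L'" by blast
  then show ?thesis
  proof cases
    case 1
    then have "num_comps L' = num_comps L" by (auto simp: planar_isotopic_def)
    then show ?thesis
      using that[OF _ permutes_id] linking_isotopic[OF W 1] by simp
  next
    case 2
    then have "num_comps L' = num_comps L" by (auto simp: reparametrised_def)
    moreover obtain \<pi> where "\<pi> permutes {..<num_comps L}"
      "\<And>i j. i < num_comps L \<Longrightarrow> j < num_comps L \<Longrightarrow> linking L' i j = linking L (\<pi> i) (\<pi> j)"
      using linking_reparametrised[OF W 2] by blast
    ultimately show ?thesis using that by blast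
  next
    case 3
    then have "num_comps L' = num_comps L" by (auto simp: local_move_def same_outside_square_def)
    then show ?thesis
      using that[OF _ permutes_id] linking_local_move[OF W 3] by simp
  qed
qed

text \<open>For \<open>\<nu> = - 1\<close> the value is a sum over all \<open>\<epsilon>\<close>, so
  renumbering the components by \<open>\<pi>\<close> only permutes its terms; for
  \<open>\<nu> = 1\<close> only the number of components enters.\<close>

lemma Y_welded_step:
  fixes a b r \<nu> :: "'k::field"
  assumes step: "welded_step L L'" and r: "r * r = 1" and \<nu>: "\<nu> \<in> {1, - 1}"
    and q: "a * r - b \<noteq> 0" "a * r + b \<noteq> 0"
  shows "Y a b r \<nu> L' = Y a b r \<nu> L"
proof -
  interpret L: diagram L using step by (intro diagramI) (simp add: welded_step_def)
  interpret L': diagram L' using step by (intro diagramI) (simp add: welded_step_def)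
  obtain \<pi> where n: "num_comps L' = num_comps L" and \<pi>: "\<pi> permutes {..<num_comps L}"
    and lk: "\<And>i j. i < num_comps L \<Longrightarrow> j < num_comps L \<Longrightarrow> i \<noteq> j \<Longrightarrow> linking L' i j = linking L (\<pi> i) (\<pi> j)"
    using welded_step_linking[OF step] by blast
  define N where "N = {..<num_comps L}"
  have \<pi>': "\<pi> permutes N" using \<pi> by (simp add: N_def)
  define E where "E = N \<rightarrow>\<^sub>E (UNIV :: bool set)"
  have mem: "(\<lambda>i\<in>N. \<epsilon> (\<sigma> i)) \<in> E" for \<epsilon> :: "nat \<Rightarrow> bool" and \<sigma> by (simp add: E_def)
  \<comment> \<open>Members of \<open>E\<close> are extensional, so each composition has to be
    restricted to \<open>N\<close> again.\<close>
  have retract: "(\<lambda>i\<in>N. (\<lambda>i\<in>N. \<epsilon> (\<sigma> i)) (\<tau> i)) = \<epsilon>"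
    if "\<epsilon> \<in> E" "\<tau> permutes N" "\<And>i. \<sigma> (\<tau> i) = i" for \<epsilon> :: "nat \<Rightarrow> bool" and \<sigma> \<tau>
    using that permutes_in_image[OF that(2)] by (auto simp: E_def PiE_def extensional_def fun_eq_iff)
  have sl: "L'.separated_linking \<rho> (\<lambda>i\<in>N. \<epsilon> (\<pi> i)) = L.separated_linking \<rho> \<epsilon>" for \<rho> :: 'k and \<epsilon>
  proof -
    let ?g = "\<lambda>(i, j). if \<epsilon> i \<noteq> \<epsilon> j then \<rho> powi linking L i j else 1"
    have "bij_betw (map_prod \<pi> \<pi>) (N \<times> N) (N \<times> N)"
      using permutes_imp_bij[OF \<pi>'] by (intro bij_betw_map_prod)
    then have "L.separated_linking \<rho> \<epsilon> = (\<Prod>x\<in>N \<times> N. ?g (map_prod \<pi> \<pi> x))"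
      unfolding L.separated_linking_def N_def[symmetric] by (rule prod.reindex_bij_betw[symmetric])
    also have "\<dots> = L'.separated_linking \<rho> (\<lambda>i\<in>N. \<epsilon> (\<pi> i))"
      unfolding L'.separated_linking_def n N_def[symmetric]
    proof (intro prod.cong refl, unfold split_paired_all)
      fix i j assume ij: "(i, j) \<in> N \<times> N"
      show "?g (map_prod \<pi> \<pi> (i, j)) = (case (i, j) of (i, j) \<Rightarrow>
          if (\<lambda>i\<in>N. \<epsilon> (\<pi> i)) i \<noteq> (\<lambda>i\<in>N. \<epsilon> (\<pi> i)) j then \<rho> powi linking L' i j else 1)"
        using ij lk[of i j] by (cases "i = j") (simp_all add: N_def)
    qed
    finally show ?thesis by simp
  qed
  have "(\<Sum>\<epsilon>\<in>E. L'.separated_linking \<rho> \<epsilon>) = (\<Sum>\<epsilon>\<in>E. L.separated_linking \<rho> \<epsilon>)" for \<rho> :: 'k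
  proof (rule sum.reindex_bij_witness[of _ "\<lambda>\<epsilon>. \<lambda>i\<in>N. \<epsilon> (\<pi> i)" "\<lambda>\<epsilon>. \<lambda>i\<in>N. \<epsilon> (inv \<pi> i)"])
    fix \<epsilon> assume \<epsilon>: "\<epsilon> \<in> E"
    show 1: "(\<lambda>i\<in>N. (\<lambda>i\<in>N. \<epsilon> (inv \<pi> i)) (\<pi> i)) = \<epsilon>"
      by (rule retract[OF \<epsilon> \<pi>' permutes_inverses(2)[OF \<pi>']])
    show "(\<lambda>i\<in>N. (\<lambda>i\<in>N. \<epsilon> (\<pi> i)) (inv \<pi> i)) = \<epsilon>"
      by (rule retract[OF \<epsilon> permutes_inv[OF \<pi>'] permutes_inverses(1)[OF \<pi>']])
    show "(\<lambda>i\<in>N. \<epsilon> (inv \<pi> i)) \<in> E" "(\<lambda>i\<in>N. \<epsilon> (\<pi> i)) \<in> E" by (rule mem)+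
    show "L.separated_linking \<rho> (\<lambda>i\<in>N. \<epsilon> (inv \<pi> i)) = L'.separated_linking \<rho> \<epsilon>"
      using sl[of \<rho> "\<lambda>i\<in>N. \<epsilon> (inv \<pi> i)"] unfolding 1 by simp
  qed
  then show ?thesis
    using \<nu> L.Y_one[OF r q] L'.Y_one[OF r q] L.Y_minus_one[OF r q] L'.Y_minus_one[OF r q] n
    by (auto simp: E_def N_def)
qed

text \<open>This keeps the normalising factor and the numerator and denominator of
  \<open>\<rho>\<close> from vanishing, whatever the signs. It reduces to an inequality of
  polynomials.\<close>

lemma indet_independent: "indet_a \<noteq> indet_b" "indet_a \<noteq> - indet_b"
proof -
  have "[:[:0, 1:]:] \<noteq> ([:0, 1:] :: rat poly poly)" "[:[:0, 1:]:] \<noteq> (- [:0, 1:] :: rat poly poly)" by auto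
  then show "indet_a \<noteq> indet_b" "indet_a \<noteq> - indet_b"
    unfolding indet_a_def indet_b_def by (simp_all del: to_fract_uminus add: to_fract_uminus[symmetric])
qed

theorem theorem1:
  fixes r \<nu> :: ratfun and L L' :: wdiagram
  assumes "r \<in> {1, -1}" and "\<nu> \<in> {1, -1}"
    and "same_welded_link L L'"
  shows "Y indet_a indet_b r \<nu> L = Y indet_a indet_b r \<nu> L'"
proof -
  have ab: "indet_a - indet_b \<noteq> 0" "indet_a + indet_b \<noteq> 0"
    using indet_independent by (simp_all add: eq_neg_iff_add_eq_0)
  \<comment> \<open>For \<open>r = - 1\<close> the factors \<open>a r - b\<close> and
    \<open>a r + b\<close> turn, up to sign, into \<open>a + b\<close> and
    \<open>a - b\<close>.\<close>
  have "indet_a * (- 1) - indet_b = - (indet_a + indet_b)" "indet_a * (- 1) + indet_b = - (indet_a - indet_b)"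
    by simp_all
  then have neg: "indet_a * (- 1) - indet_b \<noteq> 0" "indet_a * (- 1) + indet_b \<noteq> 0"
    using ab by (simp_all only: neg_equal_0_iff_equal not_False_eq_True)
  have "r = 1 \<or> r = - 1" using assms(1) by blast
  then have r: "r * r = 1" and q: "indet_a * r - indet_b \<noteq> 0" "indet_a * r + indet_b \<noteq> 0"
    using ab neg by (auto simp only: mult_1_right mult_1_left mult_minus_left mult_minus_right minus_minus)
  have "equivclp welded_step L L'" using assms(3) by (simp add: same_welded_link_def)
  then show ?thesis
  \<comment> \<open>A step may be taken in either direction, which is harmless since equality of
    \<open>Y\<close> is symmetric.\<close>
  proof (induction rule: equivclp_induct)
    case (step M M')
    then show ?case using Y_welded_step[OF _ r assms(2) q] by metis
  qed simp
qed
end
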